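(* Let $\{X,A,A(\cdot),\tilde q\}$ be a CTJMDP satisfying $\bar q(x)<\infty$ for all $x\in X$. Let $u_i\in\mathbb{R}_+^0$, $i=1,2,\ldots$, and let the cost functions $c$, $C$, and $G_i$, $i=1,2,\ldots$, take nonnegative values. For an initial distribution $\gamma$ on $X$ and a policy $\pi$, let $\varphi$ be a Markov policy satisfying $$P_\gamma^{\pi}(t,Z,B)=\int_Z\varphi(B\mid z,t)\,P_\gamma^{\pi}(t,dz)\qquad\text{for all } t\in\mathbb{R}_+,\ Z\in\mathfrak{B}(X),\ B\in\mathfrak{B}(A).$$ Then for all $\alpha\in\mathbb{R}_+^0$ $$V_\alpha(\gamma,\varphi)\le V_\alpha(\gamma,\pi).$$ If, in addition, $P_\gamma^\varphi(t,X)=1$ for all $t>0$, then $V_\alpha(\gamma,\varphi)=V_\alpha(\gamma,\pi)$.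
   Context: Notation: $\mathbb{R}_+=(0,+\infty)$, $\mathbb{R}_+^0=[0,+\infty)$, $\bar{\mathbb{R}}_+=(0,+\infty]$, $\bar{\mathbb{R}}=[-\infty,+\infty]$; $\mathfrak{B}(S)$ is the $\sigma$-algebra of a standard Borel space $S$, $\mathcal{P}(S)$ the set of probability measures on it, $I$ denotes indicators, $\delta_s$ the Dirac measure at $s$. Model. A continuous-time jump Markov decision process (CTJMDP) $\{X,A,A(\cdot),\tilde q\}$ consists of standard Borel spaces $X$ (states) and $A$ (actions); nonempty sets $A(x)\subseteq A$, $x\in X$, such that $Gr(A)=\{(x,a):x\in X,\ a\in A(x)\}$ is a measurable subset of $X\times A$ containing the graph of a measurable mapping $X\to A$; and, for $(x,a)\in Gr(A)$, a signed measure $\tilde q(x,a,\cdot)$ on $X$ with $\tilde q(x,a,X)=0$, $0\le\tilde q(x,a,Z\setminus\{x\})<\infty$, and $\tilde q(x,a,Z)$ measurable on $Gr(A)$ for each $Z\in\mathfrak{B}(X)$. Put $\tilde q(x,a)=\tilde q(x,a,X\setminus\{x\})$ and $\bar q(x)=\sup_{a\in A(x)}\tilde q(x,a)$. For a probability measure $p$ on actions and a function $f$ of state-action pairs, $f(z,p)=\int_{A(z)}f(z,a)\,p(da)$ whenever defined; in particular this defines $\tilde q(z,p,Z)$ and $\tilde q(z,p)$. Sample space. Add isolated points $x_\infty\notin X$, $a_\infty\notin A$; $\bar X=X\cup\{x_\infty\}$, $\bar A=A\cup\{a_\infty\}$, $A(x_\infty)=\{a_\infty\}$. $\Omega$ is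 the set of sequences $(x_0,t_1,x_1,t_2,x_2,\ldots)\in X\times(\bar{\mathbb{R}}_+\times\bar X)^\infty$ such that, for $n\ge1$: if $t_n<\infty$ then $x_n\in X$ and $t_{n+1}>t_n$; if $t_n=+\infty$ then $x_n=x_\infty$ and $t_{n+1}=+\infty$. $\mathcal{F}$ is the Borel $\sigma$-algebra of $\Omega$. Put $t_0=0$, $t_\infty=\lim_n t_n$, $\xi_t=x_n$ for $t_n\le t<t_{n+1}$, $\xi_t=x_\infty$ for $t\ge t_\infty$, and $\mathcal{F}_t=\sigma(\xi_s:0\le s\le t)$. Policies. A policy $\pi$ assigns to $(\omega,t)\in\Omega\times\mathbb{R}_+$ a probability measure $\pi_t(\omega)=\pi(\cdot\mid\omega,t)$ such that $\pi(B\mid\omega,t)$ is a predictable process for each $B\in\mathfrak{B}(A)$, $\pi(A(\xi_{t-}(\omega))\mid\omega,t)=1$ if $t<t_\infty(\omega)$, and $\pi(\cdot\mid\omega,t)=\delta_{a_\infty}$ if $t\ge t_\infty(\omega)$. Equivalently, for $t_n<t\le t_{n+1}$, $t<t_\infty$, $\pi(\cdot\mid\omega,t)=\pi^n(\cdot\mid x_0,t_1,x_1,\ldots,t_n,x_n,t-t_n)$ for transition probabilities $\pi^n$, $n\ge0$. A policy is Markov if there is a transition probability $\tilde\pi$ from $X\times\mathbb{R}_+$ to $A$ with $\pi(\cdot\mid\omega,t)=\tilde\pi(\cdot\mid\xi_{t-}(\omega),t)$ for $t<t_\infty(\omega)$; one writes $\pi(\cdot\mid z,t)$ for $\tilde\pi(\cdot\mid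 z,t)$. Probability measures. For a policy $\pi$ and $\gamma\in\mathcal{P}(X)$, $\mathbb{P}_\gamma^\pi$ is the unique probability measure on $(\Omega,\mathcal{F})$ such that $x_0$ has distribution $\gamma$ and the predictable random measure $\nu^\pi([0,t],Z)=\int_0^t\tilde q(\xi_s,\pi_s,Z\setminus\{\xi_s\})I\{\xi_s\in X\}\,ds$ is the compensator, with respect to $(\mathcal{F}_t)$, of the jump measure $\mu([0,t],Z)=\sum_{n\ge1}I\{t_n\le t,\ x_n\in Z\}$; $\mathbb{E}_\gamma^\pi$ is its expectation. The marginals are, for $t\in\mathbb{R}_+$, $Z\in\mathfrak{B}(\bar X)$, $B\in\mathfrak{B}(\bar A)$: $P_\gamma^\pi(t,Z)=\mathbb{P}_\gamma^\pi(\xi_t\in Z)$ and $P_\gamma^\pi(t,Z,B)=\mathbb{E}_\gamma^\pi[I\{\xi_t\in Z\}\,\pi(B\mid\omega,t)]$. Costs. There are a cost rate $c$, instant costs $G_i$ collected at the fixed time epochs $u_i\in\mathbb{R}_+^0$, $i=1,2,\ldots$, and a cost $C(z,y)$ incurred at each jump epoch when the process jumps from $z$ to $y$. The functions $c,G_i:\bar X\times\bar A\to\bar{\mathbb{R}}$, $i=1,2,\ldots$, and $C:\bar X\times\bar X\to\bar{\mathbb{R}}$ are measurable with $c(x_\infty,\cdot)=c(\cdot,a_\infty)=G_i(x_\infty,\cdot)=G_i(\cdot,a_\infty)=C(x_\infty,\cdot)=C(\cdot,x_\infty)=0$. For nonnegative cost functions, the infinite-horizon expected total discounted cost with discount rate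 $\alpha\in\mathbb{R}_+^0$ is $$V_\alpha(\gamma,\pi)=\mathbb{E}_\gamma^\pi\Big[\int_0^{t_\infty}e^{-\alpha s}c(\xi_s,\pi_s)\,ds+\sum_{n=1}^\infty e^{-\alpha t_n}C(\xi_{t_{n-1}},\xi_{t_n})+\sum_{i=1}^\infty e^{-\alpha u_i}G_i(\xi_{u_i},\pi_{u_i})\Big],$$ where terms with $t_n=+\infty$ in the second sum are $0$ (since $C(\cdot,x_\infty)=0$). Policies are specified only for $t>0$; if $u_i=0$, the cost $G_i$ is a function $G_i(z)$ of the state $z\in X$ alone and the corresponding term is $G_i(\xi_0)$. *)

theory Defs
  imports "HOL-Probability.Probability"
begin

definition standard_borel :: "'s measure \<Rightarrow> bool" where
  "standard_borel M \<longleftrightarrow>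
     (\<exists>T. completely_metrizable_space T \<and> second_countable T \<and>
          topspace T = space M \<and> sets M = sigma_sets (topspace T) {U. openin T U})"

text \<open>A (finite) signed measure is rendered as a countably additive real-valued set function.\<close>

definition signed_measure :: "'s measure \<Rightarrow> ('s set \<Rightarrow> real) \<Rightarrow> bool" where
  "signed_measure M m \<longleftrightarrow>
     m {} = 0 \<and>
     (\<forall>S. range S \<subseteq> sets M \<longrightarrow> disjoint_family S \<longrightarrow>
          (\<lambda>i::nat. m (S i)) sums m (\<Union>i. S i))"

text \<open>The model: \<open>X\<close> and \<open>A\<close> are the state and action spaces, \<open>D x\<close> is the set of actions
  available at \<open>x\<close>, and \<open>q x a\<close> is the signed transition rate. The values of a signed
  measure with \<open>q x a (space X) = 0\<close> and \<open>q x a (Z - {x}) < \<infinity>\<close> are all finite.\<close>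

locale ctjmdp =
  fixes X :: "'x measure" and A :: "'a measure"
    and D :: "'x \<Rightarrow> 'a set" and q :: "'x \<Rightarrow> 'a \<Rightarrow> 'x set \<Rightarrow> real"
  assumes X_standard: "standard_borel X"
    and A_standard: "standard_borel A"
    and D_nonempty: "\<And>x. x \<in> space X \<Longrightarrow> D x \<noteq> {}"
    and D_subset: "\<And>x. x \<in> space X \<Longrightarrow> D x \<subseteq> space A"
    and graph_measurable: "Sigma (space X) D \<in> sets (X \<Otimes>\<^sub>M A)"
    and graph_selector: "\<exists>f \<in> measurable X A. \<forall>x\<in>space X. f x \<in> D x"
    and q_signed: "\<And>x a. x \<in> space X \<Longrightarrow> a \<in> D x \<Longrightarrow> signed_measure X (q x a)"
    and q_total: "\<And>x a. x \<in> space X \<Longrightarrow> a \<in> D x \<Longrightarrow> q x a (space X) = 0"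
    and q_nonneg: "\<And>x a Z. x \<in> space X \<Longrightarrow> a \<in> D x \<Longrightarrow> Z \<in> sets X \<Longrightarrow> 0 \<le> q x a (Z - {x})"
    and q_measurable: "\<And>Z. Z \<in> sets X \<Longrightarrow>
          (\<lambda>(x, a). q x a Z) \<in> borel_measurable (restrict_space (X \<Otimes>\<^sub>M A) (Sigma (space X) D))"

definition max_jump_rate ::
    "'x measure \<Rightarrow> ('x \<Rightarrow> 'a set) \<Rightarrow> ('x \<Rightarrow> 'a \<Rightarrow> 'x set \<Rightarrow> real) \<Rightarrow> 'x \<Rightarrow> ereal" where
  "max_jump_rate X D q x = (SUP a\<in>D x. ereal (q x a (space X - {x})))"

text \<open>Adjoining an isolated point: \<open>None\<close> plays the role of \<open>x\<^sub>\<infinity>\<close> and of \<open>a\<^sub>\<infinity>\<close>.\<close>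

definition adjoin_point :: "'s measure \<Rightarrow> 's option measure" where
  "adjoin_point M =
     sigma (insert None (Some ` space M))
       {Z. Z \<subseteq> insert None (Some ` space M) \<and> Some -` Z \<in> sets M}"

definition admissible :: "('x \<Rightarrow> 'a set) \<Rightarrow> 'x option \<Rightarrow> 'a option set" where
  "admissible D z = (case z of None \<Rightarrow> {None} | Some x \<Rightarrow> Some ` D x)"

text \<open>The average \<open>f(z, p)\<close> of a nonnegative \<open>f(z, \<cdot>)\<close> over the admissible actions.\<close>

definition action_average ::
    "('x \<Rightarrow> 'a set) \<Rightarrow> ('x option \<Rightarrow> 'a option \<Rightarrow> ennreal) \<Rightarrow> 'x option \<Rightarrow> 'a option measure \<Rightarrow> ennreal" where
  "action_average D f z p = (\<integral>\<^sup>+a\<in>admissible D z. f z a \<partial>p)"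

text \<open>A trajectory \<open>(x\<^sub>0, t\<^sub>1, x\<^sub>1, t\<^sub>2, x\<^sub>2, \<dots>)\<close> is encoded as the pair of \<open>x\<^sub>0\<close> and the sequence
  whose entry at index \<open>n\<close> is the pair with components number \<open>n + 1\<close>.\<close>

type_synonym 'x traj = "'x \<times> (nat \<Rightarrow> ereal \<times> 'x option)"

definition jump_time :: "'x traj \<Rightarrow> nat \<Rightarrow> ereal" where
  "jump_time \<omega> n = (case n of 0 \<Rightarrow> 0 | Suc k \<Rightarrow> fst (snd \<omega> k))"

definition jump_state :: "'x traj \<Rightarrow> nat \<Rightarrow> 'x option" where
  "jump_state \<omega> n = (case n of 0 \<Rightarrow> Some (fst \<omega>) | Suc k \<Rightarrow> snd (snd \<omega> k))"

definition sample_space :: "'x measure \<Rightarrow> 'x traj set" where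
  "sample_space X =
     {\<omega>. fst \<omega> \<in> space X \<and>
        (\<forall>n\<ge>1. 0 < jump_time \<omega> n \<and>
           (jump_time \<omega> n < \<infinity> \<longrightarrow>
              jump_state \<omega> n \<in> Some ` space X \<and> jump_time \<omega> n < jump_time \<omega> (Suc n)) \<and>
           (jump_time \<omega> n = \<infinity> \<longrightarrow>
              jump_state \<omega> n = None \<and> jump_time \<omega> (Suc n) = \<infinity>))}"

definition trajectories :: "'x measure \<Rightarrow> 'x traj measure" where
  "trajectories X =
     restrict_space (X \<Otimes>\<^sub>M PiM UNIV (\<lambda>_. borel \<Otimes>\<^sub>M adjoin_point X)) (sample_space X)"

definition explosion_time :: "'x traj \<Rightarrow> ereal" where
  "explosion_time \<omega> = lim (jump_time \<omega>)"

definition state :: "'x traj \<Rightarrow> real \<Rightarrow> 'x option" where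
  "state \<omega> t =
     (if \<exists>n. jump_time \<omega> n \<le> ereal t \<and> ereal t < jump_time \<omega> (Suc n)
      then jump_state \<omega> (THE n. jump_time \<omega> n \<le> ereal t \<and> ereal t < jump_time \<omega> (Suc n))
      else None)"

text \<open>The left limit of the state process at \<open>t\<close>; relevant only for \<open>0 < t < explosion_time \<omega>\<close>.\<close>

definition state_left :: "'x traj \<Rightarrow> real \<Rightarrow> 'x option" where
  "state_left \<omega> t =
     (if \<exists>n. jump_time \<omega> n < ereal t \<and> ereal t \<le> jump_time \<omega> (Suc n)
      then jump_state \<omega> (THE n. jump_time \<omega> n < ereal t \<and> ereal t \<le> jump_time \<omega> (Suc n))
      else None)"

definition time_state :: "'x measure \<Rightarrow> (real \<times> 'x) measure" where
  "time_state X = restrict_space borel {0<..} \<Otimes>\<^sub>M X"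

text \<open>The random measure with \<open>\<mu>([0,t], Z) = (\<Sum>n\<ge>1. I{t\<^sub>n \<le> t, x\<^sub>n \<in> Z})\<close>, as a measure on
  \<open>(0,\<infinity>) \<times> X\<close>.\<close>

definition jump_measure :: "'x measure \<Rightarrow> 'x traj \<Rightarrow> (real \<times> 'x) measure" where
  "jump_measure X \<omega> =
     distr (count_space {n. 1 \<le> n \<and> jump_time \<omega> n < \<infinity>}) (time_state X)
       (\<lambda>n. (real_of_ereal (jump_time \<omega> n), the (jump_state \<omega> n)))"

text \<open>The history of the process up to time \<open>t\<close>. The sample space contains trajectories with
  \<open>x\<^sub>n = x\<^sub>n\<^sub>-\<^sub>1\<close>, and such a jump is not visible in the state process. The jump measure is
  therefore included among the generators, so that it is adapted and the explosion time is
  predictable; with the states alone, \<open>{(\<omega>, t). explosion_time \<omega> \<le> t}\<close> would not be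
  predictable and no policy would exist. On trajectories without such jumps (a set of full
  measure for every controlled law below) the jump-measure generators are redundant.\<close>

definition history :: "'x measure \<Rightarrow> real \<Rightarrow> 'x traj measure" where
  "history X t =
     sigma (sample_space X)
       ({{\<omega> \<in> sample_space X. state \<omega> s \<in> Z} |s Z.
            0 \<le> s \<and> s \<le> t \<and> Z \<in> sets (adjoin_point X)} \<union>
        {{\<omega> \<in> sample_space X. emeasure (jump_measure X \<omega>) ({0<..s} \<times> Z) \<in> K} |s Z K.
            0 \<le> s \<and> s \<le> t \<and> Z \<in> sets X \<and> K \<in> sets borel})"

definition predictable :: "'w set \<Rightarrow> (real \<Rightarrow> 'w measure) \<Rightarrow> ('w \<times> real) measure" where
  "predictable W F =
     sigma (W \<times> {0<..}) {C \<times> {s<..t} |C s t. 0 \<le> s \<and> s < t \<and> C \<in> sets (F s)}"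

text \<open>\<open>\<nu>\<close> is the compensator (dual predictable projection) of the random measure \<open>\<mu>\<close> on
  \<open>(0,\<infinity>) \<times> E\<close> with respect to the filtration \<open>F\<close>: it is predictable, and integrals of
  nonnegative predictable functions against \<open>\<mu>\<close> and \<open>\<nu>\<close> have the same expectation.\<close>

definition is_compensator ::
    "'w measure \<Rightarrow> (real \<Rightarrow> 'w measure) \<Rightarrow> 'e measure \<Rightarrow>
     ('w \<Rightarrow> (real \<times> 'e) measure) \<Rightarrow> ('w \<Rightarrow> (real \<times> 'e) measure) \<Rightarrow> bool" where
  "is_compensator P F E \<mu> \<nu> \<longleftrightarrow>
     (\<forall>Z\<in>sets E.
        (\<lambda>(\<omega>, t). emeasure (\<nu> \<omega>) ({0<..t} \<times> Z)) \<in> borel_measurable (predictable (space P) F)) \<and>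
     (\<forall>Y :: ('w \<times> real) \<times> 'e \<Rightarrow> ennreal.
        Y \<in> borel_measurable (predictable (space P) F \<Otimes>\<^sub>M E) \<longrightarrow>
        (\<integral>\<^sup>+\<omega>. (\<integral>\<^sup>+(t, z). Y ((\<omega>, t), z) \<partial>\<mu> \<omega>) \<partial>P) =
        (\<integral>\<^sup>+\<omega>. (\<integral>\<^sup>+(t, z). Y ((\<omega>, t), z) \<partial>\<nu> \<omega>) \<partial>P))"

text \<open>A policy is given by \<open>\<pi> \<omega> t\<close> for \<open>t > 0\<close>, a probability measure on the extended action
  space.\<close>

definition policy ::
    "'x measure \<Rightarrow> 'a measure \<Rightarrow> ('x \<Rightarrow> 'a set) \<Rightarrow> ('x traj \<Rightarrow> real \<Rightarrow> 'a option measure) \<Rightarrow> bool" where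
  "policy X A D \<pi> \<longleftrightarrow>
     (\<forall>\<omega>\<in>sample_space X. \<forall>t>0. \<pi> \<omega> t \<in> space (prob_algebra (adjoin_point A))) \<and>
     (\<forall>B\<in>sets A. (\<lambda>(\<omega>, t). emeasure (\<pi> \<omega> t) (Some ` B))
        \<in> borel_measurable (predictable (sample_space X) (history X))) \<and>
     (\<forall>\<omega>\<in>sample_space X. \<forall>t>0.
        (ereal t < explosion_time \<omega> \<longrightarrow> emeasure (\<pi> \<omega> t) (admissible D (state_left \<omega> t)) = 1) \<and>
        (explosion_time \<omega> \<le> ereal t \<longrightarrow> \<pi> \<omega> t = return (adjoin_point A) None))"

text \<open>\<open>\<phi>\<close> is a Markov policy given by the transition probability \<open>\<kappa>\<close> from states and times to
  actions.\<close>

definition markov_policy ::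
    "'x measure \<Rightarrow> 'a measure \<Rightarrow> ('x \<Rightarrow> 'a set) \<Rightarrow>
     ('x traj \<Rightarrow> real \<Rightarrow> 'a option measure) \<Rightarrow> ('x \<Rightarrow> real \<Rightarrow> 'a measure) \<Rightarrow> bool" where
  "markov_policy X A D \<phi> \<kappa> \<longleftrightarrow>
     policy X A D \<phi> \<and>
     (\<lambda>(z, t). \<kappa> z t) \<in> measurable (X \<Otimes>\<^sub>M restrict_space borel {0<..}) (prob_algebra A) \<and>
     (\<forall>\<omega>\<in>sample_space X. \<forall>t>0. ereal t < explosion_time \<omega> \<longrightarrow>
        \<phi> \<omega> t = distr (\<kappa> (the (state_left \<omega> t)) t) (adjoin_point A) Some)"

definition jump_rate ::
    "('x \<Rightarrow> 'a \<Rightarrow> 'x set \<Rightarrow> real) \<Rightarrow> 'x set \<Rightarrow> 'x option \<Rightarrow> 'a option \<Rightarrow> ennreal" where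
  "jump_rate q Z z a =
     (case (z, a) of (Some x, Some b) \<Rightarrow> ennreal (q x b (Z - {x})) | _ \<Rightarrow> 0)"

text \<open>The random measure with
  \<open>\<nu>([0,t], Z) = \<integral>\<^sub>0\<^sup>t q(\<xi>\<^sub>s, \<pi>\<^sub>s, Z - {\<xi>\<^sub>s}) I{\<xi>\<^sub>s \<in> X} ds\<close>, as a measure on \<open>(0,\<infinity>) \<times> X\<close>.\<close>

definition jump_intensity ::
    "'x measure \<Rightarrow> ('x \<Rightarrow> 'a set) \<Rightarrow> ('x \<Rightarrow> 'a \<Rightarrow> 'x set \<Rightarrow> real) \<Rightarrow>
     ('x traj \<Rightarrow> real \<Rightarrow> 'a option measure) \<Rightarrow> 'x traj \<Rightarrow> (real \<times> 'x) measure" where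
  "jump_intensity X D q \<pi> \<omega> =
     measure_of (space (time_state X)) (sets (time_state X))
       (\<lambda>S. \<integral>\<^sup>+s\<in>{0<..}.
          (action_average D (jump_rate q {z. (s, z) \<in> S}) (state \<omega> s) (\<pi> \<omega> s)
           * indicator (Some ` space X) (state \<omega> s)) \<partial>lborel)"

text \<open>\<open>P\<close> is the law of the process for initial distribution \<open>\<gamma>\<close> and policy \<open>\<pi>\<close>.\<close>

definition controlled_law ::
    "'x measure \<Rightarrow> ('x \<Rightarrow> 'a set) \<Rightarrow> ('x \<Rightarrow> 'a \<Rightarrow> 'x set \<Rightarrow> real) \<Rightarrow> 'x measure \<Rightarrow>
     ('x traj \<Rightarrow> real \<Rightarrow> 'a option measure) \<Rightarrow> 'x traj measure \<Rightarrow> bool" where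
  "controlled_law X D q \<gamma> \<pi> P \<longleftrightarrow>
     prob_space P \<and> sets P = sets (trajectories X) \<and> distr P X fst = \<gamma> \<and>
     is_compensator P (history X) X (jump_measure X) (jump_intensity X D q \<pi>)"

definition state_marginal :: "'x measure \<Rightarrow> 'x traj measure \<Rightarrow> real \<Rightarrow> 'x option measure" where
  "state_marginal X P t = distr P (adjoin_point X) (\<lambda>\<omega>. state \<omega> t)"

definition state_action_marginal ::
    "'x traj measure \<Rightarrow> ('x traj \<Rightarrow> real \<Rightarrow> 'a option measure) \<Rightarrow>
     real \<Rightarrow> 'x option set \<Rightarrow> 'a option set \<Rightarrow> ennreal" where
  "state_action_marginal P \<pi> t Z B =
     (\<integral>\<^sup>+\<omega>. indicator Z (state \<omega> t) * emeasure (\<pi> \<omega> t) B \<partial>P)"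

text \<open>Nonnegative extended-real costs. Policies are specified only for positive times, so an
  instant cost collected at time 0 depends on the state only; for indices \<open>i\<close> with \<open>u i = 0\<close>
  it is \<open>G0 i\<close>, otherwise it is \<open>G i\<close>.\<close>

definition cost_functions ::
    "'x measure \<Rightarrow> 'a measure \<Rightarrow> (nat \<Rightarrow> real) \<Rightarrow>
     ('x option \<Rightarrow> 'a option \<Rightarrow> ennreal) \<Rightarrow> ('x option \<Rightarrow> 'x option \<Rightarrow> ennreal) \<Rightarrow>
     (nat \<Rightarrow> 'x option \<Rightarrow> 'a option \<Rightarrow> ennreal) \<Rightarrow> (nat \<Rightarrow> 'x option \<Rightarrow> ennreal) \<Rightarrow> bool" where
  "cost_functions X A u c C G G0 \<longleftrightarrow>
     (let X' = adjoin_point X; A' = adjoin_point A;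
          rate_like = (\<lambda>f. case_prod f \<in> borel_measurable (X' \<Otimes>\<^sub>M A') \<and>
            (\<forall>a\<in>space A'. f None a = 0) \<and> (\<forall>z\<in>space X'. f z None = 0))
      in rate_like c \<and>
         case_prod C \<in> borel_measurable (X' \<Otimes>\<^sub>M X') \<and>
         (\<forall>z\<in>space X'. C None z = 0 \<and> C z None = 0) \<and>
         (\<forall>i. (u i \<noteq> 0 \<longrightarrow> rate_like (G i)) \<and>
              (u i = 0 \<longrightarrow> G0 i \<in> borel_measurable X' \<and> G0 i None = 0)))"

definition total_cost ::
    "('x \<Rightarrow> 'a set) \<Rightarrow> (nat \<Rightarrow> real) \<Rightarrow>
     ('x option \<Rightarrow> 'a option \<Rightarrow> ennreal) \<Rightarrow> ('x option \<Rightarrow> 'x option \<Rightarrow> ennreal) \<Rightarrow>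
     (nat \<Rightarrow> 'x option \<Rightarrow> 'a option \<Rightarrow> ennreal) \<Rightarrow> (nat \<Rightarrow> 'x option \<Rightarrow> ennreal) \<Rightarrow>
     real \<Rightarrow> ('x traj \<Rightarrow> real \<Rightarrow> 'a option measure) \<Rightarrow> 'x traj measure \<Rightarrow> ennreal" where
  "total_cost D u c C G G0 \<alpha> \<pi> P =
     (\<integral>\<^sup>+\<omega>.
        ((\<integral>\<^sup>+s\<in>{s. 0 < s \<and> ereal s < explosion_time \<omega>}.
            (ennreal (exp (- \<alpha> * s)) * action_average D c (state \<omega> s) (\<pi> \<omega> s)) \<partial>lborel)
         + (\<Sum>n. if jump_time \<omega> (Suc n) < \<infinity>
                then ennreal (exp (- \<alpha> * real_of_ereal (jump_time \<omega> (Suc n))))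
                     * C (jump_state \<omega> n) (jump_state \<omega> (Suc n))
                else 0)
         + (\<Sum>i. ennreal (exp (- \<alpha> * u i)) *
                (if u i = 0 then G0 i (state \<omega> 0)
                 else action_average D (G i) (state \<omega> (u i)) (\<pi> \<omega> (u i)))))
      \<partial>P)"

end

theory Submission
  imports Defs
begin

text \<open>The total cost depends on the process only through the laws of the state at the single times and
the kernel \<open>\<kappa>\<close>, monotonically (\<open>total_cost_eq_marginal_cost\<close>, \<open>marginal_cost_mono\<close>). It therefore
suffices to show that, at each time, the law of the state under the Markov policy is dominated by
its law under \<open>\<pi>\<close> (\<open>expect_on_le\<close>). If the dominated law has full mass on the state space, then the
two laws are equal (\<open>expect_on_eq\<close>).

The domination holds because both families of marginals solve the same forward equation and the
Markov policy produces the minimal solution. Write \<open>t\<^sub>j\<close> and \<open>x\<^sub>j\<close> for the jump epochs and the states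
after the jumps, \<open>r(x, s)\<close> for the total jump rate averaged over \<open>\<kappa> x s\<close>, and fix \<open>t\<close> and a function
\<open>g \<ge> 0\<close> of the state. The weight \<open>F(s, x) = g(x) exp (- \<integral>\<^sub>s\<^sup>t r(x, v) dv)\<close> grows at the rate \<open>r F\<close> during
a sojourn, and summation over the sojourns gives the exact identity
\<open>g(\<xi>\<^sub>t) + (\<Sum>j. F(t\<^sub>j\<^sub>+\<^sub>1, x\<^sub>j)) = F(0, x\<^sub>0) + (\<Sum>j. F(t\<^sub>j\<^sub>+\<^sub>1, x\<^sub>j\<^sub>+\<^sub>1)) + (\<integral>\<^sub>0\<^sup>t (r F)(s, \<xi>\<^sub>s) ds)\<close>,
with sums over the jumps up to time \<open>t\<close>. It holds for every trajectory, explosive ones included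
(\<open>path_identity\<close>). By the definition of the compensator and the conditional law of the action, the
sum on the left has the same expectation as the integral on the right. If \<open>g\<close> is bounded and
vanishes where \<open>r\<close> is large, this expectation is finite and cancels. There remains
\<open>E g(\<xi>\<^sub>t) = E F(0, x\<^sub>0) + (\<integral>\<^sub>0\<^sup>t E (R F)(s, \<xi>\<^sub>s) ds)\<close>, where \<open>R\<close> integrates against the jump rates
(\<open>forward_equation\<close>).

For the Markov policy the same reasoning applies on the event that at most \<open>n\<close> jumps have occurred:
the right-hand side then involves only the event that fewer than \<open>n\<close> jumps have occurred. For \<open>\<pi>\<close>
such a truncation is impossible, since \<open>\<kappa>\<close> is the conditional law of the action given the state
alone, but the equation without truncation is available. Induction on \<open>n\<close> compares the two
(\<open>expect_on_killed_le\<close>).\<close>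

section \<open>Adjoining an isolated point\<close>

lemma space_adjoin_point [simp]: "space (adjoin_point M) = insert None (Some ` space M)"
  unfolding adjoin_point_def by (rule space_measure_of) auto

lemma sets_adjoin_point:
  "sets (adjoin_point M) = {Z. Z \<subseteq> insert None (Some ` space M) \<and> Some -` Z \<in> sets M}"
    (is "_ = ?S")
proof -
  let ?\<Omega> = "insert None (Some ` space M)"
  have "sigma_algebra ?\<Omega> ?S"
    unfolding sigma_algebra_iff2
  proof (intro conjI ballI allI impI)
    fix Z assume "Z \<in> ?S"
    moreover have "Some -` (?\<Omega> - Z) = space M - Some -` Z" by auto
    ultimately show "?\<Omega> - Z \<in> ?S" by auto
  next
    fix Z :: "nat \<Rightarrow> _" assume "range Z \<subseteq> ?S"
    then show "\<Union> (range Z) \<in> ?S"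
      by (auto simp: vimage_UN)
  qed auto
  then show ?thesis
    unfolding adjoin_point_def by (subst sets_measure_of) (auto simp: sigma_algebra.sigma_sets_eq)
qed

lemma measurable_Some_adjoin [measurable]: "Some \<in> measurable M (adjoin_point M)"
proof (rule measurableI)
  fix Z assume "Z \<in> sets (adjoin_point M)"
  then have "Some -` Z \<in> sets M" by (simp add: sets_adjoin_point)
  then show "Some -` Z \<inter> space M \<in> sets M" by auto
qed simp

lemma Some_image_in_sets_adjoin: "Z \<in> sets M \<Longrightarrow> Some ` Z \<in> sets (adjoin_point M)"
  using sets.sets_into_space[of Z M] by (auto simp: sets_adjoin_point inj_vimage_image_eq)

lemma measurable_the_adjoin:
  "the \<in> measurable (restrict_space (adjoin_point M) (Some ` space M)) M"
proof (rule measurableI)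
  fix Z assume Z: "Z \<in> sets M"
  have "the -` Z \<inter> space (restrict_space (adjoin_point M) (Some ` space M)) = Some ` Z"
    using sets.sets_into_space[OF Z] by (auto simp: space_restrict_space)
  then show "the -` Z \<inter> space (restrict_space (adjoin_point M) (Some ` space M))
      \<in> sets (restrict_space (adjoin_point M) (Some ` space M))"
    using Z sets.sets_into_space[OF Z] Some_image_in_sets_adjoin[OF Z]
      Some_image_in_sets_adjoin[OF sets.top[of M]]
    by (auto simp: sets_restrict_space_iff)
qed (auto simp: space_restrict_space)

text \<open>Quantities defined on \<open>M\<close> are extended by zero to the adjoined point.\<close>

lemma borel_measurable_case_option:
  assumes g: "g \<in> measurable N (adjoin_point M)"
    and f: "(\<lambda>(w, x). f w x) \<in> borel_measurable (N \<Otimes>\<^sub>M M)"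
  shows "(\<lambda>w. case_option (0::ennreal) (f w) (g w)) \<in> borel_measurable N"
proof -
  have NS: "{w \<in> space N. g w \<in> Some ` space M} \<in> sets N"
    using measurable_sets[OF g Some_image_in_sets_adjoin[OF sets.top]]
    by (simp add: vimage_def Int_def conj_commute)
  have the_g: "(\<lambda>w. the (g w)) \<in> measurable (restrict_space N {w. g w \<in> Some ` space M}) M"
    by (rule measurable_compose[OF measurable_restrict_space3[OF g] measurable_the_adjoin]) auto
  have "(\<lambda>w. if g w \<in> Some ` space M then (\<lambda>(w, x). f w x) (w, the (g w)) else 0)
      \<in> borel_measurable N"
  proof (subst measurable_If_restrict_space_iff)
    have "(\<lambda>w. (w, the (g w)))
        \<in> measurable (restrict_space N {w. g w \<in> Some ` space M}) (N \<Otimes>\<^sub>M M)"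
      by (rule measurable_Pair) (rule measurable_restrict_space1, simp, rule the_g)
    from measurable_compose[OF this f]
    show "(\<lambda>w. (\<lambda>(w, x). f w x) (w, the (g w)))
          \<in> borel_measurable (restrict_space N {w. g w \<in> Some ` space M}) \<and>
        (\<lambda>w. 0) \<in> borel_measurable (restrict_space N {w. g w \<notin> Some ` space M})"
      by simp
  qed (use NS in simp)
  then show ?thesis
    by (rule measurable_cong[THEN iffD1, rotated])
      (auto split: option.split dest!: measurable_space[OF g])
qed

section \<open>Standard Borel spaces\<close>

text \<open>A countable base of a Hausdorff topology separates points, so the complement of the diagonal is a
countable union of measurable rectangles.\<close>

lemma standard_borel_diagonal:
  assumes "standard_borel M"
  shows "{z \<in> space (M \<Otimes>\<^sub>M M). fst z = snd z} \<in> sets (M \<Otimes>\<^sub>M M)"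
proof -
  obtain T where T: "completely_metrizable_space T" "second_countable T" "topspace T = space M"
    and sets_M: "sets M = sigma_sets (topspace T) {U. openin T U}"
    using assms by (auto simp: standard_borel_def)
  obtain B where B: "countable B" "\<And>V. V \<in> B \<Longrightarrow> openin T V"
    "\<And>U x. openin T U \<Longrightarrow> x \<in> U \<Longrightarrow> \<exists>V\<in>B. x \<in> V \<and> V \<subseteq> U"
    using T(2) unfolding second_countable_def by metis
  have B_sets: "V \<in> sets M" if "V \<in> B" for V
    using B(2)[OF that] by (auto simp: sets_M)
  have haus: "Hausdorff_space T"
    using T(1) completely_metrizable_imp_metrizable_space metrizable_imp_Hausdorff_space by blast
  have sep: "\<exists>V\<in>B. x \<in> V \<and> y \<notin> V" if "x \<in> space M" "y \<in> space M" "x \<noteq> y" for x y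
    using haus that B(3) T(3) unfolding Hausdorff_space_def disjnt_def by (metis IntI empty_iff subsetD)
  have "{z \<in> space (M \<Otimes>\<^sub>M M). fst z = snd z} =
      space (M \<Otimes>\<^sub>M M) - (\<Union>V\<in>B. V \<times> (space M - V))"
  proof (intro equalityI subsetI)
    fix z assume "z \<in> space (M \<Otimes>\<^sub>M M) - (\<Union>V\<in>B. V \<times> (space M - V))"
    then show "z \<in> {z \<in> space (M \<Otimes>\<^sub>M M). fst z = snd z}"
      using sep[of "fst z" "snd z"] by (cases z) (auto simp: space_pair_measure)
  qed auto
  moreover have "(\<Union>V\<in>B. V \<times> (space M - V)) \<in> sets (M \<Otimes>\<^sub>M M)"
    using B(1) B_sets by (intro sets.countable_UN') auto
  ultimately show ?thesis by auto
qed

lemma standard_borel_singleton: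
  assumes "standard_borel M" "x \<in> space M"
  shows "{x} \<in> sets M"
proof -
  have "Pair x -` {z \<in> space (M \<Otimes>\<^sub>M M). fst z = snd z} \<in> sets M"
    by (rule sets_Pair1[OF standard_borel_diagonal[OF assms(1)]])
  also have "Pair x -` {z \<in> space (M \<Otimes>\<^sub>M M). fst z = snd z} = {x}"
    using assms(2) by (auto simp: space_pair_measure)
  finally show ?thesis .
qed

section \<open>The jump kernel\<close>

context ctjmdp
begin

lemma singleton_sets [intro]: "x \<in> space X \<Longrightarrow> {x} \<in> sets X"
  by (rule standard_borel_singleton[OF X_standard])

lemma q_sums:
  assumes "x \<in> space X" "a \<in> D x" "range S \<subseteq> sets X" "disjoint_family S"
  shows "(\<lambda>i::nat. q x a (S i)) sums q x a (\<Union>i. S i)"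
  using q_signed[OF assms(1,2)] assms(3,4) by (auto simp: signed_measure_def)

lemma q_empty: "x \<in> space X \<Longrightarrow> a \<in> D x \<Longrightarrow> q x a {} = 0"
  using q_signed by (auto simp: signed_measure_def)

lemma q_Un:
  assumes "x \<in> space X" "a \<in> D x" "U \<in> sets X" "V \<in> sets X" "U \<inter> V = {}"
  shows "q x a (U \<union> V) = q x a U + q x a V"
proof -
  have "(\<lambda>i. q x a (binaryset U V i)) sums q x a (\<Union>i. binaryset U V i)"
    using assms by (intro q_sums) (auto simp: range_binaryset_eq disjoint_family_on_def binaryset_def)
  moreover have "(\<lambda>i. q x a (binaryset U V i)) sums (q x a U + q x a V)"
    using q_empty[OF assms(1,2)] by (intro binaryset_sums) auto
  ultimately show ?thesis
    by (metis UN_binaryset_eq sums_unique2)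
qed

lemma q_Diff:
  assumes "x \<in> space X" "a \<in> D x" "U \<in> sets X" "V \<in> sets X" "V \<subseteq> U"
  shows "q x a (U - V) = q x a U - q x a V"
proof -
  have "(U - V) \<union> V = U" "(U - V) \<inter> V = {}" using assms(5) by auto
  then show ?thesis
    using q_Un[OF assms(1,2), of "U - V" V] assms(3,4) by auto
qed

text \<open>The graph of \<open>D\<close> with its trace \<open>\<sigma>\<close>-algebra.\<close>

abbreviation "graph \<equiv> restrict_space (X \<Otimes>\<^sub>M A) (Sigma (space X) D)"

lemma space_graph: "space graph = Sigma (space X) D"
  using D_subset by (auto simp: space_restrict_space space_pair_measure)

text \<open>Measurability of \<open>q\<close> in the state and action persists when the set depends measurably on the
  state; for the complement of the diagonal this gives the measurability of \<open>q x a (Z - {x})\<close>.\<close>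

lemma q_section_measurable:
  assumes "E \<in> sets (X \<Otimes>\<^sub>M X)"
  shows "(\<lambda>(x, a). q x a (Pair x -` E)) \<in> borel_measurable graph"
proof -
  let ?G = "{U \<times> V |U V. U \<in> sets X \<and> V \<in> sets X}"
  have E: "E \<in> sigma_sets (space X \<times> space X) ?G"
    using assms by (simp add: sets_pair_measure)
  have G: "?G \<subseteq> Pow (space X \<times> space X)"
    using sets.sets_into_space by fastforce
  have sets_E: "Pair x -` E \<in> sets X" if "E \<in> sigma_sets (space X \<times> space X) ?G" for E x
    using that by (auto intro!: sets_Pair1 simp: sets_pair_measure)
  have fst_meas: "fst \<in> measurable graph X"
    by (rule measurable_restrict_space1) simp
  show ?thesis
    using Int_stable_pair_measure_generator G E
  proof (induction rule: sigma_sets_induct_disjoint)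
    case (basic E)
    then obtain U V where UV: "E = U \<times> V" "U \<in> sets X" "V \<in> sets X" by auto
    have "(\<lambda>p. indicator U (fst p) * (\<lambda>(x, a). q x a V) p) \<in> borel_measurable graph"
      by (intro borel_measurable_times q_measurable UV measurable_compose[OF fst_meas]
          borel_measurable_indicator)
    then show ?case
      by (rule measurable_cong[THEN iffD1, rotated])
        (auto simp: UV space_graph q_empty indicator_def)
  next
    case empty
    show ?case
      by (rule measurable_cong[THEN iffD1, OF _ borel_measurable_const[of 0]])
        (auto simp: space_graph q_empty)
  next
    case (compl E)
    have "(\<lambda>p. 0 - (\<lambda>(x, a). q x a (Pair x -` E)) p) \<in> borel_measurable graph"
      using compl.IH by (intro borel_measurable_diff) auto
    moreover have "q x a (Pair x -` (space X \<times> space X - E)) = 0 - q x a (Pair x -` E)"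
      if "x \<in> space X" "a \<in> D x" for x a
    proof -
      have "Pair x -` (space X \<times> space X - E) = space X - Pair x -` E"
        using that by auto
      then show ?thesis
        using q_Diff[OF that sets.top sets_E[OF compl.hyps]] q_total[OF that]
          sets.sets_into_space[OF sets_E[OF compl.hyps]] by simp
    qed
    ultimately show ?case
      by (elim measurable_cong[THEN iffD1, rotated]) (auto simp: space_graph)
  next
    case (union E)
    have sum: "(\<lambda>i. q x a (Pair x -` E i)) sums q x a (Pair x -` (\<Union>i. E i))"
      if "x \<in> space X" "a \<in> D x" for x a
    proof -
      have "disjoint_family (\<lambda>i. Pair x -` E i)"
        using union.hyps(1) by (auto simp: disjoint_family_on_def)
      moreover have "range (\<lambda>i. Pair x -` E i) \<subseteq> sets X"
        using union.hyps(2) sets_E by auto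
      ultimately show ?thesis
        using q_sums[OF that] by (simp add: vimage_UN)
    qed
    show ?case
    proof (rule borel_measurable_LIMSEQ_real)
      show "(\<lambda>n. \<Sum>i<n. (\<lambda>(x, a). q x a (Pair x -` E i)) p) \<longlonglongrightarrow>
          (\<lambda>(x, a). q x a (Pair x -` (\<Union>i. E i))) p" if "p \<in> space graph" for p
        using that sum by (auto simp: space_graph sums_def)
    qed (use union.IH in auto)
  qed
qed

lemma q_off_diagonal_measurable:
  assumes Z: "Z \<in> sets X"
  shows "(\<lambda>(x, a). q x a (Z - {x})) \<in> borel_measurable graph"
proof -
  let ?E = "(space X \<times> Z) - {z \<in> space (X \<Otimes>\<^sub>M X). fst z = snd z}"
  have "?E \<in> sets (X \<Otimes>\<^sub>M X)"
    using Z standard_borel_diagonal[OF X_standard] by auto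
  from q_section_measurable[OF this] show ?thesis
  proof (rule measurable_cong[THEN iffD1, rotated])
    fix p assume "p \<in> space graph"
    moreover have "Pair x -` ?E = Z - {x}" if "x \<in> space X" for x
      using that sets.sets_into_space[OF Z] by (auto simp: space_pair_measure)
    ultimately show "(\<lambda>(x, a). q x a (Pair x -` ?E)) p = (\<lambda>(x, a). q x a (Z - {x})) p"
      by (auto simp: space_graph)
  qed
qed

text \<open>The measure \<open>Z \<mapsto> q(x, a, Z - {x})\<close>, and the null measure off the graph of \<open>D\<close>.\<close>

definition jump_kernel :: "'x \<Rightarrow> 'a \<Rightarrow> 'x measure" where
  "jump_kernel x a = measure_of (space X) (sets X)
     (\<lambda>Z. if x \<in> space X \<and> a \<in> D x then ennreal (q x a (Z - {x})) else 0)"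

lemma sets_jump_kernel [simp, measurable_cong]: "sets (jump_kernel x a) = sets X"
  by (simp add: jump_kernel_def)

lemma space_jump_kernel [simp]: "space (jump_kernel x a) = space X"
  by (simp add: jump_kernel_def)

lemma emeasure_jump_kernel:
  assumes Z: "Z \<in> sets X"
  shows "emeasure (jump_kernel x a) Z =
    (if x \<in> space X \<and> a \<in> D x then ennreal (q x a (Z - {x})) else 0)"
proof (cases "x \<in> space X \<and> a \<in> D x")
  case True
  then have x: "x \<in> space X" and a: "a \<in> D x" by auto
  show ?thesis
    unfolding jump_kernel_def
  proof (rule emeasure_measure_of_sigma[OF sets.sigma_algebra_axioms _ _ Z])
    show "countably_additive (sets X)
        (\<lambda>Z. if x \<in> space X \<and> a \<in> D x then ennreal (q x a (Z - {x})) else 0)"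
      unfolding countably_additive_def
    proof (intro allI impI)
      fix S :: "nat \<Rightarrow> _" assume S: "range S \<subseteq> sets X" "disjoint_family S"
      have "(\<lambda>i. q x a (S i - {x})) sums q x a (\<Union>i. S i - {x})"
        using S x a by (intro q_sums) (auto simp: disjoint_family_on_def)
      moreover have "(\<Union>i. S i - {x}) = (\<Union>i. S i) - {x}" by auto
      ultimately have "(\<lambda>i. q x a (S i - {x})) sums q x a ((\<Union>i. S i) - {x})" by simp
      then have "(\<Sum>i. ennreal (q x a (S i - {x}))) = ennreal (q x a ((\<Union>i. S i) - {x}))"
        using S x a q_nonneg by (intro suminf_ennreal_eq) auto
      then show "(\<Sum>i. if x \<in> space X \<and> a \<in> D x then ennreal (q x a (S i - {x})) else 0) =
          (if x \<in> space X \<and> a \<in> D x then ennreal (q x a (\<Union> (range S) - {x})) else 0)"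
        using x a by simp
    qed
  qed (use x a in \<open>auto simp: positive_def q_empty\<close>)
next
  case False
  then show ?thesis
    by (subst jump_kernel_def, subst emeasure_measure_of_sigma[OF sets.sigma_algebra_axioms _ _ Z])
      (auto simp: positive_def countably_additive_def)
qed

lemma emeasure_jump_kernel_measurable:
  assumes Z: "Z \<in> sets X"
  shows "(\<lambda>(x, a). emeasure (jump_kernel x a) Z) \<in> borel_measurable (X \<Otimes>\<^sub>M A)"
proof -
  have "(\<lambda>p. if p \<in> Sigma (space X) D then ennreal ((\<lambda>(x, a). q x a (Z - {x})) p) else 0)
      \<in> borel_measurable (X \<Otimes>\<^sub>M A)"
  proof (subst measurable_If_restrict_space_iff)
    show "(\<lambda>p. ennreal ((\<lambda>(x, a). q x a (Z - {x})) p))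
          \<in> borel_measurable (restrict_space (X \<Otimes>\<^sub>M A) {p. p \<in> Sigma (space X) D}) \<and>
        (\<lambda>p. 0) \<in> borel_measurable (restrict_space (X \<Otimes>\<^sub>M A) {p. p \<notin> Sigma (space X) D})"
      using q_off_diagonal_measurable[OF Z] by auto
    have "{p \<in> space (X \<Otimes>\<^sub>M A). p \<in> Sigma (space X) D} = Sigma (space X) D"
      using D_subset by (auto simp: space_pair_measure)
    then show "{p \<in> space (X \<Otimes>\<^sub>M A). p \<in> Sigma (space X) D} \<in> sets (X \<Otimes>\<^sub>M A)"
      using graph_measurable by simp
  qed
  then show ?thesis
    by (rule measurable_cong[THEN iffD1, rotated]) (auto simp: emeasure_jump_kernel Z split: if_splits)
qed

text \<open>The jump kernel is finite but need not be bounded; its measurability is transferred from the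
  subprobability kernel obtained by dividing by \<open>1 + q(x, a)\<close>.\<close>

lemma nn_integral_jump_kernel_measurable [measurable]:
  assumes x [measurable]: "x \<in> measurable N X" and a [measurable]: "a \<in> measurable N A"
    and f [measurable]: "(\<lambda>(w, y). f w y) \<in> borel_measurable (N \<Otimes>\<^sub>M X)"
  shows "(\<lambda>w. \<integral>\<^sup>+y. f w y \<partial>jump_kernel (x w) (a w)) \<in> borel_measurable N"
proof -
  \<comment> \<open>Adding 1 keeps the divisor positive where no jump is possible.\<close>
  define d where "d w = 1 + emeasure (jump_kernel (x w) (a w)) (space X)" for w
  have em [measurable]: "(\<lambda>w. emeasure (jump_kernel (x w) (a w)) Z) \<in> borel_measurable N"
    if "Z \<in> sets X" for Z
    using measurable_compose[OF measurable_Pair[OF x a] emeasure_jump_kernel_measurable[OF that]]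
    by simp
  have d [measurable]: "d \<in> borel_measurable N"
    unfolding d_def by measurable
  have "d w \<noteq> \<top>" "d w \<noteq> 0" for w
    by (auto simp: d_def emeasure_jump_kernel)
  then have inv_d: "inverse (d w) * d w = 1" for w
    by (metis divide_ennreal_def ennreal_divide_self mult.commute top.not_eq_extremum zero_less_iff_neq_zero)
  define L where "L w = scale_measure (inverse (d w)) (jump_kernel (x w) (a w))" for w
  have L: "L \<in> measurable N (subprob_algebra X)"
  proof (rule measurable_subprob_algebra)
    fix w assume w: "w \<in> space N"
    show "subprob_space (L w)"
    proof
      have "emeasure (jump_kernel (x w) (a w)) (space X) \<le> d w" by (simp add: d_def)
      then have "inverse (d w) * emeasure (jump_kernel (x w) (a w)) (space X) \<le> inverse (d w) * d w"
        by (rule mult_left_mono) simp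
      then show "emeasure (L w) (space (L w)) \<le> 1"
        using inv_d[of w] by (simp add: L_def space_scale_measure)
      show "space (L w) \<noteq> {}"
        using measurable_space[OF x w] by (auto simp: L_def space_scale_measure)
    qed
  qed (auto simp: L_def)
  have "(\<lambda>w. d w * (\<integral>\<^sup>+y. f w y \<partial>L w)) \<in> borel_measurable N"
    using nn_integral_measurable_subprob_algebra2[OF f L] by measurable
  then show ?thesis
  proof (rule measurable_cong[THEN iffD1, rotated])
    fix w assume w: "w \<in> space N"
    have "(\<integral>\<^sup>+y. f w y \<partial>L w) = inverse (d w) * (\<integral>\<^sup>+y. f w y \<partial>jump_kernel (x w) (a w))"
      using measurable_Pair2[OF f w] unfolding L_def
      by (intro nn_integral_scale_measure) (simp cong: measurable_cong_sets)
    then have "d w * (\<integral>\<^sup>+y. f w y \<partial>L w) =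
        (d w * inverse (d w)) * (\<integral>\<^sup>+y. f w y \<partial>jump_kernel (x w) (a w))"
      by (simp add: mult.assoc)
    also have "d w * inverse (d w) = 1"
      using inv_d[of w] by (simp add: mult.commute)
    finally show "d w * (\<integral>\<^sup>+y. f w y \<partial>L w) = (\<integral>\<^sup>+y. f w y \<partial>jump_kernel (x w) (a w))"
      by simp
  qed
qed

end

section \<open>Trajectories\<close>

abbreviation "pos_time \<equiv> restrict_space borel {0<..} :: real measure"

lemma space_trajectories [simp]: "space (trajectories X) = sample_space X"
proof -
  have "\<omega> \<in> space (X \<Otimes>\<^sub>M PiM UNIV (\<lambda>_. borel \<Otimes>\<^sub>M adjoin_point X))" if "\<omega> \<in> sample_space X" for \<omega>
  proof -
    have "snd (snd \<omega> k) \<in> insert None (Some ` space X)" for k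
    proof -
      have "jump_state \<omega> (Suc k) \<in> insert None (Some ` space X)"
        using that by (cases "jump_time \<omega> (Suc k) = \<infinity>") (auto simp: sample_space_def)
      then show ?thesis by (simp add: jump_state_def)
    qed
    then show ?thesis
      using that by (cases \<omega>) (auto simp: space_pair_measure space_PiM sample_space_def
          PiE_def Pi_def mem_Times_iff)
  qed
  then show ?thesis by (auto simp: trajectories_def space_restrict_space)
qed

lemma measurable_jump_time [measurable]:
  "(\<lambda>\<omega>. jump_time \<omega> n) \<in> borel_measurable (trajectories X)"
  unfolding trajectories_def jump_time_def
  by (rule measurable_restrict_space1) (cases n; simp)

lemma measurable_jump_state [measurable]:
  "(\<lambda>\<omega>. jump_state \<omega> n) \<in> measurable (trajectories X) (adjoin_point X)"
  unfolding trajectories_def jump_state_def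
  by (rule measurable_restrict_space1) (cases n; simp)

lemma jump_time_0 [simp]: "jump_time \<omega> 0 = 0"
  by (simp add: jump_time_def)

lemma jump_state_0 [simp]: "jump_state \<omega> 0 = Some (fst \<omega>)"
  by (simp add: jump_state_def)

text \<open>At time \<open>s\<close>, respectively strictly before time \<open>s\<close>, exactly \<open>n\<close> jumps have occurred.\<close>

abbreviation sojourn :: "'x traj \<Rightarrow> nat \<Rightarrow> real \<Rightarrow> bool" where
  "sojourn \<omega> n s \<equiv> jump_time \<omega> n \<le> ereal s \<and> ereal s < jump_time \<omega> (Suc n)"

abbreviation sojourn_left :: "'x traj \<Rightarrow> nat \<Rightarrow> real \<Rightarrow> bool" where
  "sojourn_left \<omega> n s \<equiv> jump_time \<omega> n < ereal s \<and> ereal s \<le> jump_time \<omega> (Suc n)"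

context
  fixes X :: "'x measure" and \<omega> :: "'x traj"
  assumes \<omega>: "\<omega> \<in> sample_space X"
begin

lemma jump_time_less: "jump_time \<omega> n < \<infinity> \<Longrightarrow> jump_time \<omega> n < jump_time \<omega> (Suc n)"
  using \<omega> by (cases n) (auto simp: sample_space_def)

lemma jump_time_Suc_pos: "0 < jump_time \<omega> (Suc n)"
  using \<omega> by (auto simp: sample_space_def)

lemma jump_time_incseq: "incseq (jump_time \<omega>)"
proof (rule incseq_SucI)
  fix n show "jump_time \<omega> n \<le> jump_time \<omega> (Suc n)"
    using \<omega> jump_time_less[of n]
    by (cases n; cases "jump_time \<omega> n = \<infinity>") (auto simp: sample_space_def)
qed

lemma jump_time_mono: "m \<le> n \<Longrightarrow> jump_time \<omega> m \<le> jump_time \<omega> n"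
  using jump_time_incseq by (auto simp: incseq_def)

lemma jump_time_nonneg: "0 \<le> jump_time \<omega> n"
  using jump_time_mono[of 0 n] by simp

lemma jump_state_finite:
  assumes "jump_time \<omega> n < \<infinity>"
  shows "\<exists>x\<in>space X. jump_state \<omega> n = Some x"
  using \<omega> assms by (cases n) (auto simp: sample_space_def)

lemma jump_time_real:
  assumes "jump_time \<omega> n < \<infinity>"
  shows "ereal (real_of_ereal (jump_time \<omega> n)) = jump_time \<omega> n"
  using assms jump_time_nonneg[of n] by (cases "jump_time \<omega> n") auto

lemma sojourn_unique:
  assumes "jump_time \<omega> n \<le> s" "s < jump_time \<omega> (Suc n)" "jump_time \<omega> m \<le> s" "s < jump_time \<omega> (Suc m)"
  shows "n = m"
proof (rule antisym; rule ccontr)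
  assume "\<not> n \<le> m" then show False
    using jump_time_mono[of "Suc m" n] assms by auto
next
  assume "\<not> m \<le> n" then show False
    using jump_time_mono[of "Suc n" m] assms by auto
qed

lemma sojourn_left_unique:
  assumes "jump_time \<omega> n < s" "s \<le> jump_time \<omega> (Suc n)" "jump_time \<omega> m < s" "s \<le> jump_time \<omega> (Suc m)"
  shows "n = m"
proof (rule antisym; rule ccontr)
  assume "\<not> n \<le> m" then show False
    using jump_time_mono[of "Suc m" n] assms by auto
next
  assume "\<not> m \<le> n" then show False
    using jump_time_mono[of "Suc n" m] assms by auto
qed

lemma state_eq:
  assumes "jump_time \<omega> n \<le> ereal s" "ereal s < jump_time \<omega> (Suc n)"
  shows "state \<omega> s = jump_state \<omega> n"
proof -
  have "(THE n. sojourn \<omega> n s) = n"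
    using assms sojourn_unique by (intro the_equality) blast+
  then show ?thesis using assms by (auto simp: state_def)
qed

lemma state_left_eq:
  assumes "jump_time \<omega> n < ereal s" "ereal s \<le> jump_time \<omega> (Suc n)"
  shows "state_left \<omega> s = jump_state \<omega> n"
proof -
  have "(THE n. sojourn_left \<omega> n s) = n"
    using assms sojourn_left_unique by (intro the_equality) blast+
  then show ?thesis using assms by (auto simp: state_left_def)
qed

lemma state_SomeD:
  assumes "state \<omega> s = Some x"
  obtains n where "jump_time \<omega> n \<le> ereal s" "ereal s < jump_time \<omega> (Suc n)"
    "jump_state \<omega> n = Some x" "x \<in> space X"
proof -
  obtain n where n: "jump_time \<omega> n \<le> ereal s" "ereal s < jump_time \<omega> (Suc n)"
    using assms by (auto simp: state_def split: if_splits)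
  from n(1) have "jump_time \<omega> n < \<infinity>" by (rule le_less_trans) simp
  with n assms state_eq[OF n] show ?thesis
    using jump_state_finite[of n] by (auto intro!: that)
qed

lemma state_Some_less_explosion:
  assumes "state \<omega> s = Some x"
  shows "ereal s < explosion_time \<omega>"
proof -
  obtain n where "ereal s < jump_time \<omega> (Suc n)" using state_SomeD[OF assms] .
  also have "jump_time \<omega> (Suc n) \<le> (SUP n. jump_time \<omega> n)" by (rule SUP_upper) simp
  also have "\<dots> = explosion_time \<omega>"
    unfolding explosion_time_def using LIMSEQ_SUP[OF jump_time_incseq] by (simp add: limI)
  finally show ?thesis .
qed

lemma state_initial: "state \<omega> 0 = Some (fst \<omega>)"
  using state_eq[of 0 0] jump_time_Suc_pos[of 0] by (simp add: zero_ereal_def[symmetric])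

lemma jump_time_le_iff_count:
  "jump_time \<omega> n \<le> ereal r \<and> 0 \<le> r \<longleftrightarrow>
    of_nat n \<le> (\<Sum>j. if jump_time \<omega> (Suc j) \<le> ereal r then 1 else 0 :: ennreal) \<and> 0 \<le> r"
proof (cases "jump_time \<omega> n \<le> ereal r \<and> 0 \<le> r")
  case True
  have "(\<Sum>j<n. 1) = (\<Sum>j<n. if jump_time \<omega> (Suc j) \<le> ereal r then 1 else 0 :: ennreal)"
    using True jump_time_mono by (intro sum.cong) (auto intro: order_trans[of _ "jump_time \<omega> n"])
  also have "\<dots> \<le> (\<Sum>j. if jump_time \<omega> (Suc j) \<le> ereal r then 1 else 0 :: ennreal)"
    by (rule sum_le_suminf) auto
  finally show ?thesis using True by simp
next
  case False
  show ?thesis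
  proof (cases "0 \<le> r")
    case r: True
    then obtain m where n: "n = Suc m"
      using False by (cases n) (auto simp: zero_ereal_def)
    have *: "\<not> jump_time \<omega> (Suc j) \<le> ereal r" if "m \<le> j" for j
      using False r n jump_time_mono[of "Suc m" "Suc j"] that by (auto dest: order_trans)
    have "(\<Sum>j. if jump_time \<omega> (Suc j) \<le> ereal r then 1 else 0 :: ennreal) =
        (\<Sum>j<m. if jump_time \<omega> (Suc j) \<le> ereal r then 1 else 0)"
      using * by (intro suminf_finite) auto
    also have "\<dots> \<le> (\<Sum>j<m. 1)" by (rule sum_mono) auto
    also have "\<dots> < of_nat n" by (simp add: n of_nat_less_iff del: of_nat_Suc)
    finally show ?thesis using False by auto
  qed auto
qed

end

text \<open>The state process observed only while the number of past jumps lies in \<open>J\<close>, and its left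
  limits. For \<open>J = UNIV\<close> this is the state process; for \<open>J = {..<n}\<close> it is the process killed
  at its \<open>n\<close>-th jump.\<close>

definition state_on :: "nat set \<Rightarrow> 'x traj \<Rightarrow> real \<Rightarrow> 'x option" where
  "state_on J \<omega> s =
    (if \<exists>n\<in>J. sojourn \<omega> n s then state \<omega> s else None)"

definition state_left_on :: "nat set \<Rightarrow> 'x traj \<Rightarrow> real \<Rightarrow> 'x option" where
  "state_left_on J \<omega> s =
    (if \<exists>n\<in>J. sojourn_left \<omega> n s then state_left \<omega> s else None)"

lemma state_on_UNIV [simp]: "state_on UNIV \<omega> s = state \<omega> s"
  by (auto simp: state_on_def state_def)

lemma suminf_single_ennreal:
  fixes f :: "nat \<Rightarrow> ennreal"
  assumes "P k" "\<And>i. P i \<Longrightarrow> i = k"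
  shows "(\<Sum>i. if P i then f i else 0) = f k"
proof -
  have "(if P i then f i else 0) = 0" if "i \<notin> {k}" for i
    using assms(2)[of i] that by auto
  then have "(\<Sum>i. if P i then f i else 0) = (\<Sum>i\<in>{k}. if P i then f i else 0)"
    by (intro suminf_finite) simp_all
  then show ?thesis using assms(1) by simp
qed

lemma case_option_state_on:
  assumes \<omega>: "\<omega> \<in> sample_space X"
  shows "case_option (0::ennreal) f (state_on J \<omega> s) =
    (\<Sum>j. if j \<in> J \<and> sojourn \<omega> j s
      then case_option 0 f (jump_state \<omega> j) else 0)"
proof (cases "\<exists>n\<in>J. sojourn \<omega> n s")
  case True
  then obtain n where n: "n \<in> J" "jump_time \<omega> n \<le> ereal s" "ereal s < jump_time \<omega> (Suc n)" by auto
  have uniq: "i = n" if "i \<in> J \<and> sojourn \<omega> i s" for i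
    using sojourn_unique[OF \<omega>] n that by blast
  have "state_on J \<omega> s = jump_state \<omega> n"
    using True state_eq[OF \<omega> n(2,3)] by (simp add: state_on_def)
  then show ?thesis
    by (subst suminf_single_ennreal[of _ n, OF _ uniq]) (simp_all add: n)
next
  case False
  then have "(\<lambda>j. if j \<in> J \<and> sojourn \<omega> j s
      then case_option 0 f (jump_state \<omega> j) else (0::ennreal)) = (\<lambda>_. 0)"
    by (intro ext if_not_P) blast
  with False show ?thesis by (auto simp: state_on_def)
qed

lemma state_on_SomeD:
  "\<omega> \<in> sample_space X \<Longrightarrow> state_on J \<omega> s = Some x \<Longrightarrow> state \<omega> s = Some x \<and> x \<in> space X"
  unfolding state_on_def by (metis option.discI state_SomeD)

lemma state_on_in_iff:
  assumes \<omega>: "\<omega> \<in> sample_space X"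
  shows "state_on J \<omega> s \<in> Z \<longleftrightarrow>
    (\<exists>n. n \<in> J \<and> jump_time \<omega> n \<le> ereal s \<and> ereal s < jump_time \<omega> (Suc n) \<and> jump_state \<omega> n \<in> Z) \<or>
    (None \<in> Z \<and> \<not> (\<exists>n. n \<in> J \<and> sojourn \<omega> n s))"
proof (cases "\<exists>n\<in>J. sojourn \<omega> n s")
  case True
  then obtain n where n: "n \<in> J" "jump_time \<omega> n \<le> ereal s" "ereal s < jump_time \<omega> (Suc n)" by auto
  then have "m = n" if "jump_time \<omega> m \<le> ereal s" "ereal s < jump_time \<omega> (Suc m)" for m
    using sojourn_unique[OF \<omega>] that by blast
  moreover have "state_on J \<omega> s = jump_state \<omega> n"
    using True state_eq[OF \<omega> n(2,3)] by (simp add: state_on_def)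
  ultimately show ?thesis using n by metis
qed (auto simp: state_on_def)

lemma state_left_on_in_iff:
  assumes \<omega>: "\<omega> \<in> sample_space X"
  shows "state_left_on J \<omega> s \<in> Z \<longleftrightarrow>
    (\<exists>n. n \<in> J \<and> jump_time \<omega> n < ereal s \<and> ereal s \<le> jump_time \<omega> (Suc n) \<and> jump_state \<omega> n \<in> Z) \<or>
    (None \<in> Z \<and> \<not> (\<exists>n. n \<in> J \<and> sojourn_left \<omega> n s))"
proof (cases "\<exists>n\<in>J. sojourn_left \<omega> n s")
  case True
  then obtain n where n: "n \<in> J" "jump_time \<omega> n < ereal s" "ereal s \<le> jump_time \<omega> (Suc n)" by auto
  then have "m = n" if "jump_time \<omega> m < ereal s" "ereal s \<le> jump_time \<omega> (Suc m)" for m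
    using sojourn_left_unique[OF \<omega>] that by blast
  moreover have "state_left_on J \<omega> s = jump_state \<omega> n"
    using True state_left_eq[OF \<omega> n(2,3)] by (simp add: state_left_on_def)
  ultimately show ?thesis using n by metis
qed (auto simp: state_left_on_def)

lemma measurable_state_on [measurable]:
  "(\<lambda>(\<omega>, s). state_on J \<omega> s) \<in> measurable (trajectories X \<Otimes>\<^sub>M borel) (adjoin_point X)"
proof (rule measurableI)
  fix p assume p: "p \<in> space (trajectories X \<Otimes>\<^sub>M (borel::real measure))"
  then have "fst p \<in> sample_space X" by (auto simp: space_pair_measure)
  from state_on_SomeD[OF this, of J "snd p"]
  show "(case p of (\<omega>, s) \<Rightarrow> state_on J \<omega> s) \<in> space (adjoin_point X)"
    by (cases "state_on J (fst p) (snd p)") (simp_all add: case_prod_beta)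
next
  fix Z assume Z: "Z \<in> sets (adjoin_point X)"
  let ?M = "trajectories X \<Otimes>\<^sub>M (borel :: real measure)"
  let ?S = "\<lambda>n Z. {p \<in> space ?M. jump_time (fst p) n \<le> ereal (snd p) \<and>
      ereal (snd p) < jump_time (fst p) (Suc n) \<and> jump_state (fst p) n \<in> Z}"
  have S: "?S n Z \<in> sets ?M" if [measurable]: "Z \<in> sets (adjoin_point X)" for n Z
    by measurable
  have jump_state_space: "jump_state \<omega> n \<in> space (adjoin_point X)"
    if "\<omega> \<in> sample_space X" for \<omega> n
    using measurable_space[OF measurable_jump_state, of \<omega> X n] that by simp
  have "(\<lambda>(\<omega>, s). state_on J \<omega> s) -` Z \<inter> space ?M =
      (\<Union>n\<in>J. ?S n Z) \<union>
      (if None \<in> Z then space ?M - (\<Union>n\<in>J. ?S n (space (adjoin_point X))) else {})"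
    using jump_state_space
    by (auto simp: state_on_in_iff space_pair_measure simp del: space_adjoin_point split: if_splits)
  moreover have "(\<Union>n\<in>J. ?S n Z) \<in> sets ?M"
    by (rule sets.countable_UN'') (rule countableI_type, rule S[OF Z])
  moreover have "space ?M - (\<Union>n\<in>J. ?S n (space (adjoin_point X))) \<in> sets ?M"
    by (rule sets.Diff[OF sets.top sets.countable_UN'']) (rule countableI_type, rule S[OF sets.top])
  ultimately show "(\<lambda>(\<omega>, s). state_on J \<omega> s) -` Z \<inter> space ?M \<in> sets ?M"
    by (cases "None \<in> Z") (simp_all only: if_True if_False sets.Un Un_empty_right)
qed

lemma measurable_state_on_at [measurable]:
  "(\<lambda>\<omega>. state_on J \<omega> s) \<in> measurable (trajectories X) (adjoin_point X)"
proof -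
  have "(\<lambda>\<omega>. (\<omega>, s)) \<in> measurable (trajectories X) (trajectories X \<Otimes>\<^sub>M borel)"
    by (rule measurable_Pair[OF measurable_ident_sets[OF refl] measurable_const]) simp
  from measurable_compose[OF this measurable_state_on[of J]] show ?thesis by (simp only: prod.case)
qed

lemma measurable_state_at [measurable]:
  "(\<lambda>\<omega>. state \<omega> s) \<in> measurable (trajectories X) (adjoin_point X)"
  using measurable_state_on_at[of UNIV] by simp

section \<open>The jump measure, histories and predictability\<close>

lemma space_time_state: "space (time_state X) = {0<..} \<times> space X"
  by (simp add: time_state_def space_pair_measure space_restrict_space)

lemma nn_integral_jump_measure:
  assumes \<omega>: "\<omega> \<in> sample_space X" and f: "f \<in> borel_measurable (time_state X)"
  shows "(\<integral>\<^sup>+p. f p \<partial>jump_measure X \<omega>) =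
    (\<Sum>j. if jump_time \<omega> (Suc j) < \<infinity>
      then f (real_of_ereal (jump_time \<omega> (Suc j)), the (jump_state \<omega> (Suc j))) else 0)"
proof -
  let ?I = "{n. 1 \<le> n \<and> jump_time \<omega> n < \<infinity>}"
  let ?g = "\<lambda>n. (real_of_ereal (jump_time \<omega> n), the (jump_state \<omega> n))"
  have g: "?g \<in> measurable (count_space ?I) (time_state X)"
  proof -
    have "?g n \<in> {0<..} \<times> space X" if "n \<in> ?I" for n
    proof -
      obtain m where n: "n = Suc m" using \<open>n \<in> ?I\<close> by (cases n) auto
      obtain x where "x \<in> space X" "jump_state \<omega> n = Some x"
        using jump_state_finite[OF \<omega>, of n] \<open>n \<in> ?I\<close> by auto
      moreover have "0 < real_of_ereal (jump_time \<omega> n)"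
        using jump_time_Suc_pos[OF \<omega>, of m] \<open>n \<in> ?I\<close> unfolding n
        by (cases "jump_time \<omega> (Suc m)") simp_all
      ultimately show ?thesis by simp
    qed
    then show ?thesis by (auto simp only: measurable_count_space_eq1 space_time_state)
  qed
  have bij: "bij_betw Suc {j. jump_time \<omega> (Suc j) < \<infinity>} ?I"
    by (rule bij_betwI[where g="\<lambda>n. n - 1"]) auto
  have "(\<integral>\<^sup>+p. f p \<partial>jump_measure X \<omega>) = (\<integral>\<^sup>+n. f (?g n) \<partial>count_space ?I)"
    unfolding jump_measure_def using f by (subst nn_integral_distr[OF g]) auto
  also have "\<dots> = (\<integral>\<^sup>+j. f (?g (Suc j)) \<partial>count_space {j. jump_time \<omega> (Suc j) < \<infinity>})"
    using nn_integral_bij_count_space[OF bij, of "\<lambda>n. f (?g n)"] by simp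
  also have "\<dots> = (\<integral>\<^sup>+j. f (?g (Suc j)) * indicator {j. jump_time \<omega> (Suc j) < \<infinity>} j \<partial>count_space UNIV)"
    by (rule nn_integral_count_space_indicator) simp
  also have "\<dots> = (\<Sum>j. f (?g (Suc j)) * indicator {j. jump_time \<omega> (Suc j) < \<infinity>} j)"
    by (rule nn_integral_count_space_nat)
  also have "\<dots> = (\<Sum>j. if jump_time \<omega> (Suc j) < \<infinity> then f (?g (Suc j)) else 0)"
    by (rule suminf_cong) simp
  finally show ?thesis .
qed

lemma emeasure_jump_measure:
  assumes \<omega>: "\<omega> \<in> sample_space X" and Z: "Z \<in> sets X"
  shows "emeasure (jump_measure X \<omega>) ({0<..s} \<times> Z) =
    (\<Sum>j. if jump_time \<omega> (Suc j) \<le> ereal s \<and> jump_state \<omega> (Suc j) \<in> Some ` Z then 1 else 0)"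
proof -
  have S: "{0<..s} \<times> Z \<in> sets (time_state X)"
    using Z unfolding time_state_def by (intro pair_measureI) (auto simp: sets_restrict_space_iff)
  have "emeasure (jump_measure X \<omega>) ({0<..s} \<times> Z) = (\<integral>\<^sup>+p. indicator ({0<..s} \<times> Z) p \<partial>jump_measure X \<omega>)"
    using S by (simp add: jump_measure_def)
  also have "\<dots> = (\<Sum>j. if jump_time \<omega> (Suc j) < \<infinity>
      then indicator ({0<..s} \<times> Z) (real_of_ereal (jump_time \<omega> (Suc j)), the (jump_state \<omega> (Suc j))) else 0)"
    using S by (intro nn_integral_jump_measure[OF \<omega>]) simp
  also have "\<dots> = (\<Sum>j. if jump_time \<omega> (Suc j) \<le> ereal s \<and> jump_state \<omega> (Suc j) \<in> Some ` Z then 1 else 0)"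
  proof (rule suminf_cong)
    fix j
    show "(if jump_time \<omega> (Suc j) < \<infinity>
      then indicator ({0<..s} \<times> Z) (real_of_ereal (jump_time \<omega> (Suc j)), the (jump_state \<omega> (Suc j))) else 0)
      = (if jump_time \<omega> (Suc j) \<le> ereal s \<and> jump_state \<omega> (Suc j) \<in> Some ` Z then 1 else 0 :: ennreal)"
    proof (cases "jump_time \<omega> (Suc j)")
      case (real r)
      then obtain x where "jump_state \<omega> (Suc j) = Some x" using jump_state_finite[OF \<omega>, of "Suc j"] by auto
      then show ?thesis using real jump_time_Suc_pos[OF \<omega>, of j] by (auto simp: indicator_def)
    qed (use jump_time_Suc_pos[OF \<omega>, of j] in auto)
  qed
  finally show ?thesis .
qed

lemma space_history [simp]: "space (history X t) = sample_space X"
  unfolding history_def by (rule space_measure_of) auto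

lemma sets_history: "sets (history X t) = sigma_sets (sample_space X)
       ({{\<omega> \<in> sample_space X. state \<omega> s \<in> Z} |s Z.
            0 \<le> s \<and> s \<le> t \<and> Z \<in> sets (adjoin_point X)} \<union>
        {{\<omega> \<in> sample_space X. emeasure (jump_measure X \<omega>) ({0<..s} \<times> Z) \<in> K} |s Z K.
            0 \<le> s \<and> s \<le> t \<and> Z \<in> sets X \<and> K \<in> sets borel})"
  unfolding history_def by (rule sets_measure_of) auto

lemma sets_history_subset: "sets (history X t) \<subseteq> sets (trajectories X)"
proof -
  have "{\<omega> \<in> sample_space X. state \<omega> s \<in> Z} \<in> sets (trajectories X)"
    if "Z \<in> sets (adjoin_point X)" for s Z
    using measurable_sets[OF measurable_state_at that, of s] by (simp add: vimage_def Int_def conj_commute)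
  moreover have "{\<omega> \<in> sample_space X. emeasure (jump_measure X \<omega>) ({0<..s} \<times> Z) \<in> K} \<in> sets (trajectories X)"
    if Z: "Z \<in> sets X" and K: "K \<in> sets borel" for s Z K
  proof -
    have [measurable]: "Some ` Z \<in> sets (adjoin_point X)" by (rule Some_image_in_sets_adjoin[OF Z])
    have "(\<lambda>\<omega>. emeasure (jump_measure X \<omega>) ({0<..s} \<times> Z)) \<in> borel_measurable (trajectories X)"
      by (rule measurable_cong[THEN iffD2, OF emeasure_jump_measure]) (auto simp: Z)
    from measurable_sets[OF this K] show ?thesis by (simp add: vimage_def Int_def conj_commute)
  qed
  ultimately show ?thesis
    unfolding sets_history
    by (subst space_trajectories[symmetric], intro sets.sigma_sets_subset) blast
qed

text \<open>The epoch of the \<open>n\<close>-th jump is a stopping time of the history, because the jump measure counts the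
jumps up to each time.\<close>

lemma jump_time_le_in_history:
  assumes "0 \<le> r"
  shows "{\<omega> \<in> sample_space X. jump_time \<omega> n \<le> ereal r} \<in> sets (history X r)"
proof -
  have "{\<omega> \<in> sample_space X. jump_time \<omega> n \<le> ereal r} =
      {\<omega> \<in> sample_space X. emeasure (jump_measure X \<omega>) ({0<..r} \<times> space X) \<in> {of_nat n..}}"
  proof (intro Collect_cong conj_cong refl)
    fix \<omega> assume \<omega>: "\<omega> \<in> sample_space X"
    have "jump_state \<omega> (Suc j) \<in> Some ` space X" if "jump_time \<omega> (Suc j) \<le> ereal r" for j
      using jump_state_finite[OF \<omega>, of "Suc j"] that by force
    then have "emeasure (jump_measure X \<omega>) ({0<..r} \<times> space X) =
        (\<Sum>j. if jump_time \<omega> (Suc j) \<le> ereal r then 1 else 0)"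
      unfolding emeasure_jump_measure[OF \<omega> sets.top] by (intro suminf_cong) auto
    then show "jump_time \<omega> n \<le> ereal r \<longleftrightarrow> emeasure (jump_measure X \<omega>) ({0<..r} \<times> space X) \<in> {of_nat n..}"
      using jump_time_le_iff_count[OF \<omega>, of n r] assms by simp
  qed
  also have "\<dots> \<in> sets (history X r)"
    unfolding sets_history using assms
    by (intro sigma_sets.Basic UnI2 CollectI exI[of _ r] exI[of _ "space X"] exI[of _ "{of_nat n..}"]) auto
  finally show ?thesis .
qed

lemma state_in_history:
  assumes "0 \<le> r" "Z \<in> sets (adjoin_point X)"
  shows "{\<omega> \<in> sample_space X. state \<omega> r \<in> Z} \<in> sets (history X r)"
  unfolding sets_history using assms by (intro sigma_sets.Basic UnI1) auto

abbreviation "predictable_sets X \<equiv> predictable (sample_space X) (history X)"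

lemma history_subset: "C \<in> sets (history X s) \<Longrightarrow> C \<subseteq> sample_space X"
  using sets.sets_into_space by fastforce

lemma space_predictable [simp]: "space (predictable_sets X) = sample_space X \<times> {0<..}"
  unfolding predictable_def by (rule space_measure_of) (auto dest: history_subset)

lemma sets_predictable: "sets (predictable_sets X) =
    sigma_sets (sample_space X \<times> {0<..}) {C \<times> {s<..t} |C s t. 0 \<le> s \<and> s < t \<and> C \<in> sets (history X s)}"
  unfolding predictable_def by (rule sets_measure_of) (auto dest: history_subset)

text \<open>Predictable processes are jointly measurable.\<close>

lemma measurable_to_predictable:
  "(\<lambda>p. p) \<in> measurable (trajectories X \<Otimes>\<^sub>M pos_time) (predictable_sets X)"
  unfolding predictable_def
proof (rule measurable_measure_of)
  fix Y assume "Y \<in> {C \<times> {s<..t} |C s t. 0 \<le> s \<and> s < t \<and> C \<in> sets (history X s)}"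
  then obtain C s t where Y: "Y = C \<times> {s<..t}" "0 \<le> s" "C \<in> sets (history X s)" by auto
  then have "C \<in> sets (trajectories X)" "{s<..t} \<in> sets pos_time"
    using sets_history_subset by (auto simp: sets_restrict_space_iff)
  then have "Y \<in> sets (trajectories X \<Otimes>\<^sub>M pos_time)" using Y by auto
  then show "(\<lambda>p. p) -` Y \<inter> space (trajectories X \<Otimes>\<^sub>M pos_time) \<in> sets (trajectories X \<Otimes>\<^sub>M pos_time)"
    by auto
qed (auto simp: space_pair_measure space_restrict_space dest: history_subset)

lemma predictable_ray:
  assumes "C \<in> sets (history X r)" "0 \<le> r"
  shows "C \<times> {r<..} \<in> sets (predictable_sets X)"
proof -
  have "\<exists>k::nat. y \<le> r + Suc k" for y
  proof -
    obtain k :: nat where "y - r \<le> k" using real_arch_simple by blast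
    then show ?thesis by (intro exI[of _ k]) simp
  qed
  then have "C \<times> {r<..} = (\<Union>k::nat. C \<times> {r<..r + Suc k})" by fastforce
  moreover have "C \<times> {r<..r + Suc k} \<in> sets (predictable_sets X)" for k :: nat
    unfolding sets_predictable using assms
    by (intro sigma_sets.Basic CollectI exI[of _ C] exI[of _ r] exI[of _ "r + Suc k"]) auto
  ultimately show ?thesis by auto
qed

lemma rational_between:
  assumes "jump_time \<omega> n < ereal s" "\<omega> \<in> sample_space X"
  obtains r :: rat where "0 \<le> r" "jump_time \<omega> n \<le> ereal (of_rat r)" "of_rat r < s"
proof -
  have "0 \<le> jump_time \<omega> n" by (rule jump_time_nonneg[OF assms(2)])
  with assms(1) obtain a where a: "jump_time \<omega> n = ereal a" "0 \<le> a" "a < s"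
    by (cases "jump_time \<omega> n") auto
  then obtain r where "a < of_rat r" "of_rat r < s" using of_rat_dense by blast
  moreover from this have "0 \<le> r"
    using a(2) zero_le_of_rat_iff[where 'a=real, of r] by linarith
  ultimately show ?thesis using a by (intro that[of r]) auto
qed

lemma predictable_after_jump:
  "{(\<omega>, s). \<omega> \<in> sample_space X \<and> 0 < s \<and> jump_time \<omega> n < ereal s} \<in> sets (predictable_sets X)"
proof -
  have "{(\<omega>, s). \<omega> \<in> sample_space X \<and> 0 < s \<and> jump_time \<omega> n < ereal s} =
      (\<Union>r\<in>{r::rat. 0 \<le> r}. {\<omega> \<in> sample_space X. jump_time \<omega> n \<le> ereal (of_rat r)} \<times> {of_rat r<..})"
    (is "?L = ?R")
  proof (intro equalityI subsetI)
    fix p assume "p \<in> ?L"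
    then obtain \<omega> s where p: "p = (\<omega>, s)" "\<omega> \<in> sample_space X" "jump_time \<omega> n < ereal s" by auto
    obtain r :: rat where "0 \<le> r" "jump_time \<omega> n \<le> ereal (of_rat r)" "of_rat r < s"
      using rational_between[OF p(3,2)] .
    then show "p \<in> ?R" using p by auto
  next
    fix p assume "p \<in> ?R"
    then obtain r :: rat and \<omega> s where r: "0 \<le> r" "p = (\<omega>, s)" "\<omega> \<in> sample_space X"
      "jump_time \<omega> n \<le> ereal (of_rat r)" "of_rat r < s"
      by auto
    have "0 < s" using r(1,5) zero_le_of_rat_iff[where 'a=real, of r] by linarith
    moreover have "jump_time \<omega> n < ereal s" using r(4,5) by (intro le_less_trans[OF r(4)]) simp
    ultimately show "p \<in> ?L" using r(2,3) by simp
  qed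
  also have "\<dots> \<in> sets (predictable_sets X)"
    by (intro sets.countable_UN'' predictable_ray jump_time_le_in_history) auto
  finally show ?thesis .
qed

text \<open>In \<open>(t\<^sub>n, t\<^sub>n\<^sub>+\<^sub>1]\<close> the state \<open>x\<^sub>n\<close> can be read off at a rational time between \<open>t\<^sub>n\<close> and the present.\<close>

lemma predictable_sojourn:
  assumes Z: "Z \<in> sets (adjoin_point X)"
  shows "{(\<omega>, s). \<omega> \<in> sample_space X \<and> 0 < s \<and> jump_time \<omega> n < ereal s \<and>
      ereal s \<le> jump_time \<omega> (Suc n) \<and> jump_state \<omega> n \<in> Z} \<in> sets (predictable_sets X)"
proof -
  let ?C = "\<lambda>r. ({\<omega> \<in> sample_space X. jump_time \<omega> n \<le> ereal r} -
      {\<omega> \<in> sample_space X. jump_time \<omega> (Suc n) \<le> ereal r}) \<inter> {\<omega> \<in> sample_space X. state \<omega> r \<in> Z}"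
  let ?B = "{(\<omega>, s). \<omega> \<in> sample_space X \<and> 0 < s \<and> jump_time \<omega> (Suc n) < ereal s}"
  have "{(\<omega>, s). \<omega> \<in> sample_space X \<and> 0 < s \<and> jump_time \<omega> n < ereal s \<and>
      ereal s \<le> jump_time \<omega> (Suc n) \<and> jump_state \<omega> n \<in> Z} =
      (\<Union>r\<in>{r::rat. 0 \<le> r}. ?C (of_rat r) \<times> {of_rat r<..}) - ?B" (is "?L = ?R")
  proof (intro equalityI subsetI)
    fix p assume "p \<in> ?L"
    then obtain \<omega> s where p: "p = (\<omega>, s)" and \<omega>: "\<omega> \<in> sample_space X" and s: "0 < s"
      "jump_time \<omega> n < ereal s" "ereal s \<le> jump_time \<omega> (Suc n)" "jump_state \<omega> n \<in> Z" by auto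
    obtain r :: rat where r: "0 \<le> r" "jump_time \<omega> n \<le> ereal (of_rat r)" "of_rat r < s"
      using rational_between[OF s(2) \<omega>] .
    then have "ereal (of_rat r) < jump_time \<omega> (Suc n)"
      by (intro less_le_trans[OF _ s(3)]) simp
    then have "\<omega> \<in> ?C (of_rat r)" using r \<omega> s state_eq[OF \<omega> r(2)] by (simp add: not_le)
    then have "p \<in> ?C (of_rat r) \<times> {of_rat r<..}" using p r by simp
    moreover have "p \<notin> ?B" using p s by (simp add: not_less)
    ultimately show "p \<in> ?R" using r(1) by (intro DiffI UN_I[of r] CollectI)
  next
    fix p assume p: "p \<in> ?R"
    then obtain r :: rat where r1: "r \<in> {r. 0 \<le> r}" "p \<in> ?C (of_rat r) \<times> {of_rat r<..}" and B: "p \<notin> ?B"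
      by (elim DiffE UN_E)
    obtain \<omega> s where p_eq: "p = (\<omega>, s)" by (cases p)
    have r: "0 \<le> r" "p = (\<omega>, s)" "\<omega> \<in> ?C (of_rat r)" "of_rat r < s" "p \<notin> ?B"
      using r1 B p_eq by simp_all
    have s: "0 < s" using r(1,4) zero_le_of_rat_iff[where 'a=real, of r] by linarith
    have \<omega>: "\<omega> \<in> sample_space X" using r(3) by simp
    have "jump_time \<omega> n \<le> ereal (of_rat r)" using r(3) by simp
    then have "jump_time \<omega> n < ereal s" by (rule le_less_trans) (use r(4) in simp)
    moreover have "jump_state \<omega> n \<in> Z" using r(3) state_eq[OF \<omega>, of n "of_rat r"] by (simp add: not_le)
    ultimately show "p \<in> ?L" using r(2,5) \<omega> s by (simp add: not_less)
  qed
  also have "\<dots> \<in> sets (predictable_sets X)"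
  proof (rule sets.Diff[OF sets.countable_UN'' predictable_after_jump])
    fix r :: rat assume "r \<in> {r. 0 \<le> r}"
    then have r: "0 \<le> (of_rat r :: real)" by simp
    show "?C (of_rat r) \<times> {of_rat r<..} \<in> sets (predictable_sets X)"
      by (intro predictable_ray[OF _ r] sets.Int[OF sets.Diff] jump_time_le_in_history[OF r]
          state_in_history[OF r Z])
  qed (rule countableI_type)
  finally show ?thesis .
qed

lemma measurable_state_left_on:
  "(\<lambda>(\<omega>, s). state_left_on J \<omega> s) \<in> measurable (predictable_sets X) (adjoin_point X)"
proof (rule measurableI)
  fix p assume "p \<in> space (predictable_sets X)"
  then obtain \<omega> s where p: "p = (\<omega>, s)" and \<omega>: "\<omega> \<in> sample_space X" by auto
  show "(case p of (\<omega>, s) \<Rightarrow> state_left_on J \<omega> s) \<in> space (adjoin_point X)"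
  proof (cases "\<exists>n\<in>J. sojourn_left \<omega> n s")
    case True
    then obtain n where n: "jump_time \<omega> n < ereal s" "ereal s \<le> jump_time \<omega> (Suc n)" by auto
    moreover have "jump_time \<omega> n < \<infinity>" using n(1) by auto
    ultimately show ?thesis
      using state_left_eq[OF \<omega> n] jump_state_finite[OF \<omega>, of n] by (auto simp: state_left_on_def p)
  qed (auto simp: state_left_on_def p)
next
  fix Z assume Z: "Z \<in> sets (adjoin_point X)"
  let ?S = "\<lambda>n Z. {(\<omega>, s). \<omega> \<in> sample_space X \<and> 0 < s \<and> jump_time \<omega> n < ereal s \<and>
      ereal s \<le> jump_time \<omega> (Suc n) \<and> jump_state \<omega> n \<in> Z}"
  have jump_state_space: "jump_state \<omega> n \<in> space (adjoin_point X)"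
    if "\<omega> \<in> sample_space X" for \<omega> n
    using measurable_space[OF measurable_jump_state, of \<omega> X n] that by simp
  have "(\<lambda>(\<omega>, s). state_left_on J \<omega> s) -` Z \<inter> space (predictable_sets X) =
      (\<Union>n\<in>J. ?S n Z) \<union>
      (if None \<in> Z then sample_space X \<times> {0<..} - (\<Union>n\<in>J. ?S n (space (adjoin_point X))) else {})"
    using jump_state_space by (auto simp: state_left_on_in_iff simp del: space_adjoin_point split: if_splits)
  also have "\<dots> \<in> sets (predictable_sets X)"
    using sets.top[of "predictable_sets X"] predictable_sojourn[OF Z] predictable_sojourn[OF sets.top]
    by (auto intro!: sets.Un sets.countable_UN'' sets.Diff simp del: space_adjoin_point)
  finally show "(\<lambda>(\<omega>, s). state_left_on J \<omega> s) -` Z \<inter> space (predictable_sets X)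
      \<in> sets (predictable_sets X)" .
qed

section \<open>Controlled processes and their compensators\<close>

abbreviation "pos_lborel \<equiv> restrict_space lborel {0<..} :: real measure"

lemma sigma_finite_pos_lborel: "sigma_finite_measure pos_lborel"
  by (rule sigma_finite_measure_restrict_space[OF sigma_finite_lborel]) simp

lemma sets_pos_lborel [measurable_cong]: "sets pos_lborel = sets pos_time"
  by (rule sets_restrict_space_cong) simp

lemma space_pos_lborel [simp]: "space pos_lborel = {0<..}"
  by (simp add: space_restrict_space)

lemma space_pos_time [simp]: "space pos_time = {0<..}"
  by (simp add: space_restrict_space)

lemma nn_integral_pos_lborel: "(\<integral>\<^sup>+s. f s \<partial>pos_lborel) = (\<integral>\<^sup>+s\<in>{0<..}. f s \<partial>lborel)"
  by (rule nn_integral_restrict_space) simp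

lemma measurable_pos_time_real [measurable]: "(\<lambda>s. s) \<in> borel_measurable pos_time"
  by (rule measurable_restrict_space1) simp

text \<open>The restriction of a measure on the extended action space to the actions proper; the mass of
  the adjoined point is dropped.\<close>

definition action_part :: "'a measure \<Rightarrow> 'a option measure \<Rightarrow> 'a measure" where
  "action_part A p = distr (restrict_space p (Some ` space A)) A the"

lemma sets_action_part [simp, measurable_cong]: "sets (action_part A p) = sets A"
  by (simp add: action_part_def)

lemma space_action_part [simp]: "space (action_part A p) = space A"
  by (simp add: action_part_def)

context
  fixes A :: "'a measure" and p :: "'a option measure"
  assumes sets_p: "sets p = sets (adjoin_point A)"
begin

lemma the_measurable_restrict: "the \<in> measurable (restrict_space p (Some ` space A)) A"
  using measurable_the_adjoin[of A] sets_p
  by (simp cong: measurable_cong_sets sets_restrict_space_cong)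

lemma nn_integral_action_part:
  assumes f: "f \<in> borel_measurable A"
  shows "(\<integral>\<^sup>+b. f b \<partial>action_part A p) = (\<integral>\<^sup>+a. f (the a) * indicator (Some ` space A) a \<partial>p)"
proof -
  have "Some ` space A \<inter> space p \<in> sets p"
    using Some_image_in_sets_adjoin[OF sets.top, of A] sets_p by auto
  then show ?thesis
    unfolding action_part_def using f the_measurable_restrict
    by (subst nn_integral_distr) (auto simp: nn_integral_restrict_space)
qed

lemma emeasure_action_part:
  assumes B: "B \<in> sets A"
  shows "emeasure (action_part A p) B = emeasure p (Some ` B)"
proof -
  have SB: "Some ` B \<in> sets p"
    using Some_image_in_sets_adjoin[OF B] sets_p by simp
  have "emeasure (action_part A p) B = (\<integral>\<^sup>+b. indicator B b \<partial>action_part A p)"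
    using B by simp
  also have "\<dots> = (\<integral>\<^sup>+a. indicator (Some ` B) a \<partial>p)"
    unfolding nn_integral_action_part[OF borel_measurable_indicator[OF B]]
    using sets.sets_into_space[OF B] by (intro nn_integral_cong) (auto split: split_indicator)
  finally show ?thesis using SB by simp
qed

end

lemma action_part_distr_Some:
  assumes M: "sets M = sets A"
  shows "action_part A (distr M (adjoin_point A) Some) = M"
proof (rule measure_eqI)
  fix B assume "B \<in> sets (action_part A (distr M (adjoin_point A) Some))"
  then have B: "B \<in> sets A" by simp
  have Some_M: "Some \<in> measurable M (adjoin_point A)"
    using measurable_Some_adjoin[of A] M by (simp cong: measurable_cong_sets)
  have "emeasure (action_part A (distr M (adjoin_point A) Some)) B =
      emeasure M (Some -` (Some ` B) \<inter> space M)"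
    using B by (subst emeasure_action_part) (simp_all add: emeasure_distr[OF Some_M] Some_image_in_sets_adjoin)
  also have "Some -` (Some ` B) \<inter> space M = B"
    using B M sets.sets_into_space[of B M] by auto
  finally show "emeasure (action_part A (distr M (adjoin_point A) Some)) B = emeasure M B" .
qed (simp add: M)

context ctjmdp
begin

text \<open>The space of jumps: their epochs and the states before and after them.\<close>

abbreviation "step_space \<equiv> (pos_time \<Otimes>\<^sub>M X) \<Otimes>\<^sub>M X"

lemma D_indicator_measurable [measurable]:
  "(\<lambda>(x, b). indicator (D x) b :: ennreal) \<in> borel_measurable (X \<Otimes>\<^sub>M A)"
proof -
  have "(indicator (Sigma (space X) D) :: _ \<Rightarrow> ennreal) \<in> borel_measurable (X \<Otimes>\<^sub>M A)"
    using graph_measurable by simp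
  then show ?thesis
    by (rule measurable_cong[THEN iffD1, rotated]) (auto simp: space_pair_measure indicator_def)
qed

lemma action_average_Some:
  assumes p: "sets p = sets (adjoin_point A)" and x: "x \<in> space X"
    and f: "(\<lambda>b. f (Some x) (Some b) * indicator (D x) b) \<in> borel_measurable A"
  shows "action_average D f (Some x) p =
    (\<integral>\<^sup>+b. f (Some x) (Some b) * indicator (D x) b \<partial>action_part A p)"
proof -
  have "f (Some x) a * indicator (Some ` D x) a =
      f (Some x) (Some (the a)) * indicator (D x) (the a) * indicator (Some ` space A) a" for a
    using D_subset[OF x] by (cases a) (auto simp: indicator_def image_iff)
  then show ?thesis
    unfolding action_average_def admissible_def
    by (subst nn_integral_action_part[OF p f]) (simp add: mult.assoc)
qed

end

text \<open>A policy together with a law of the process that it controls.\<close>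

locale controlled_process = ctjmdp X A D q
  for X :: "'x measure" and A :: "'a measure" and D q +
  fixes \<gamma> :: "'x measure" and \<pi> :: "'x traj \<Rightarrow> real \<Rightarrow> 'a option measure" and P :: "'x traj measure"
  assumes is_policy: "policy X A D \<pi>" and law: "controlled_law X D q \<gamma> \<pi> P"
begin

abbreviation "traj_time \<equiv> trajectories X \<Otimes>\<^sub>M pos_time"

sublocale prob_space P
  using law by (simp add: controlled_law_def)

lemma sets_P [measurable_cong]: "sets P = sets (trajectories X)"
  using law by (simp add: controlled_law_def)

lemma space_P [simp]: "space P = sample_space X"
  using sets_eq_imp_space_eq[OF sets_P] by simp

lemma initial_law: "distr P X fst = \<gamma>"
  using law by (simp add: controlled_law_def)

lemma compensation:
  assumes "Y \<in> borel_measurable (predictable_sets X \<Otimes>\<^sub>M X)"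
  shows "(\<integral>\<^sup>+\<omega>. (\<integral>\<^sup>+(t, z). Y ((\<omega>, t), z) \<partial>jump_measure X \<omega>) \<partial>P) =
    (\<integral>\<^sup>+\<omega>. (\<integral>\<^sup>+(t, z). Y ((\<omega>, t), z) \<partial>jump_intensity X D q \<pi> \<omega>) \<partial>P)"
  using law assms unfolding controlled_law_def is_compensator_def by simp

text \<open>The law of the action chosen by the policy, a subprobability measure on the actions proper; it
  is null from the explosion time on.\<close>

definition act :: "'x traj \<Rightarrow> real \<Rightarrow> 'a measure" where
  "act \<omega> t = action_part A (\<pi> \<omega> t)"

lemma sets_act [simp, measurable_cong]: "sets (act \<omega> t) = sets A"
  by (simp add: act_def)

lemma sets_policy:
  "\<omega> \<in> sample_space X \<Longrightarrow> 0 < t \<Longrightarrow> sets (\<pi> \<omega> t) = sets (adjoin_point A)"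
  using is_policy by (auto simp: policy_def space_prob_algebra)

lemma emeasure_act:
  "\<omega> \<in> sample_space X \<Longrightarrow> 0 < t \<Longrightarrow> B \<in> sets A \<Longrightarrow> emeasure (act \<omega> t) B = emeasure (\<pi> \<omega> t) (Some ` B)"
  unfolding act_def by (rule emeasure_action_part[OF sets_policy])

lemma subprob_act:
  assumes "\<omega> \<in> sample_space X" "0 < t"
  shows "subprob_space (act \<omega> t)"
proof
  have "prob_space (\<pi> \<omega> t)"
    using is_policy assms by (auto simp: policy_def space_prob_algebra)
  then have "emeasure (\<pi> \<omega> t) (Some ` space A) \<le> 1"
    by (rule prob_space.measure_le_1)
  then show "emeasure (act \<omega> t) (space (act \<omega> t)) \<le> 1"
    using emeasure_act[OF assms sets.top] by (simp add: act_def)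
  have "fst \<omega> \<in> space X" using assms(1) by (simp add: sample_space_def)
  then show "space (act \<omega> t) \<noteq> {}"
    using D_nonempty[of "fst \<omega>"] D_subset[of "fst \<omega>"] by (auto simp: act_def)
qed

lemma measurable_act:
  "(\<lambda>w. act (fst w) (snd w)) \<in> measurable traj_time (subprob_algebra A)"
proof (rule measurable_subprob_algebra)
  fix w assume "w \<in> space traj_time"
  then show "subprob_space (act (fst w) (snd w))"
    by (intro subprob_act) (auto simp: space_pair_measure)
next
  fix B assume B: "B \<in> sets A"
  have "(\<lambda>(\<omega>, t). emeasure (\<pi> \<omega> t) (Some ` B)) \<in> borel_measurable (predictable_sets X)"
    using is_policy B by (simp add: policy_def)
  from measurable_compose[OF measurable_to_predictable this]
  show "(\<lambda>w. emeasure (act (fst w) (snd w)) B) \<in> borel_measurable traj_time"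
  proof (rule measurable_cong[THEN iffD1, rotated])
    fix w assume "w \<in> space traj_time"
    then show "(case w of (\<omega>, t) \<Rightarrow> emeasure (\<pi> \<omega> t) (Some ` B)) = emeasure (act (fst w) (snd w)) B"
      using emeasure_act[OF _ _ B] by (auto simp: space_pair_measure)
  qed
qed simp

lemma measurable_state_on_pair:
  "(\<lambda>w. state_on J (fst w) (snd w)) \<in> measurable traj_time (adjoin_point X)"
proof -
  have "(\<lambda>w. w) \<in> measurable traj_time (trajectories X \<Otimes>\<^sub>M borel)"
    by (rule measurable_pair) (simp_all add: comp_def)
  from measurable_compose[OF this measurable_state_on[of J]] show ?thesis
    by (simp only: case_prod_beta)
qed

lemma measurable_action_integral:
  assumes H: "(\<lambda>((w, x), b). H w x b) \<in> borel_measurable ((traj_time \<Otimes>\<^sub>M X) \<Otimes>\<^sub>M A)"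
  shows "(\<lambda>w. case_option (0::ennreal) (\<lambda>x. \<integral>\<^sup>+b. H w x b \<partial>act (fst w) (snd w)) (state_on J (fst w) (snd w)))
    \<in> borel_measurable traj_time"
proof (rule borel_measurable_case_option[OF measurable_state_on_pair])
  have "(\<lambda>v. act (fst (fst v)) (snd (fst v)))
      \<in> measurable (traj_time \<Otimes>\<^sub>M X) (subprob_algebra A)"
    by (rule measurable_compose[OF measurable_fst measurable_act])
  from nn_integral_measurable_subprob_algebra2[of "\<lambda>v b. H (fst v) (snd v) b", OF _ this] H
  show "(\<lambda>(w, x). \<integral>\<^sup>+b. H w x b \<partial>act (fst w) (snd w))
      \<in> borel_measurable (traj_time \<Otimes>\<^sub>M X)"
    by (simp add: case_prod_unfold)
qed

text \<open>The integral of \<open>f\<close> against the jump rates of the process at time \<open>s\<close>.\<close>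

lemma measurable_jump_rate_integral:
  assumes f: "(\<lambda>((w, x), y). f w x y) \<in> borel_measurable ((traj_time \<Otimes>\<^sub>M X) \<Otimes>\<^sub>M X)"
  shows "(\<lambda>w. case_option (0::ennreal) (\<lambda>x. \<integral>\<^sup>+b. (\<integral>\<^sup>+y. f w x y \<partial>jump_kernel x b) \<partial>act (fst w) (snd w))
      (state_on J (fst w) (snd w))) \<in> borel_measurable traj_time"
proof (rule measurable_action_integral)
  let ?N = "(traj_time \<Otimes>\<^sub>M X) \<Otimes>\<^sub>M A"
  have "(\<lambda>u. (fst (fst u), snd u)) \<in> measurable (?N \<Otimes>\<^sub>M X) ((traj_time \<Otimes>\<^sub>M X) \<Otimes>\<^sub>M X)"
    by (intro measurable_Pair measurable_snd measurable_compose[OF measurable_fst measurable_fst])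
  from measurable_compose[OF this f]
  have "(\<lambda>(v, y). f (fst (fst v)) (snd (fst v)) y) \<in> borel_measurable (?N \<Otimes>\<^sub>M X)"
    by (simp add: case_prod_unfold)
  from nn_integral_jump_kernel_measurable[OF _ _ this, of "\<lambda>v. snd (fst v)" "\<lambda>v. snd v"]
  show "(\<lambda>((w, x), b). \<integral>\<^sup>+y. f w x y \<partial>jump_kernel x b) \<in> borel_measurable ?N"
    by (simp add: case_prod_unfold)
qed

end

text \<open>A functional that is linear and monotonically continuous is the integral against the measure
  given by its values on indicators.\<close>

lemma nn_integral_measure_of_functional:
  fixes T :: "('s \<Rightarrow> ennreal) \<Rightarrow> ennreal"
  assumes cong: "\<And>f g. (\<And>x. x \<in> space M \<Longrightarrow> f x = g x) \<Longrightarrow> T f = T g"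
    and cmult: "\<And>f c. f \<in> borel_measurable M \<Longrightarrow> T (\<lambda>x. c * f x) = c * T f"
    and add: "\<And>f g. f \<in> borel_measurable M \<Longrightarrow> g \<in> borel_measurable M \<Longrightarrow> T (\<lambda>x. f x + g x) = T f + T g"
    and SUP: "\<And>F. (\<And>i. F i \<in> borel_measurable M) \<Longrightarrow> incseq F \<Longrightarrow>
        T (\<lambda>x. SUP i::nat. F i x) = (SUP i. T (F i))"
    and \<mu>: "\<And>S. S \<in> sets M \<Longrightarrow> \<mu> S = T (indicator S)"
    and f: "f \<in> borel_measurable M"
  shows "(\<integral>\<^sup>+x. f x \<partial>measure_of (space M) (sets M) \<mu>) = T f"
proof -
  have zero: "T (\<lambda>x. 0) = 0" using cmult[of "\<lambda>_. 0" 0] by simp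
  have sum: "T (\<lambda>x. \<Sum>i<n. F i x) = (\<Sum>i<n. T (F i))" if "\<And>i. F i \<in> borel_measurable M"
    for F and n :: nat
  proof (induction n)
    case (Suc n)
    then show ?case using add[of "\<lambda>x. \<Sum>i<n. F i x" "F n"] that by simp
  qed (simp add: zero)
  have emeasure: "emeasure (measure_of (space M) (sets M) \<mu>) S = T (indicator S)" if S: "S \<in> sets M" for S
  proof -
    have "countably_additive (sets M) \<mu>"
      unfolding countably_additive_def
    proof (intro allI impI)
      fix S :: "nat \<Rightarrow> 's set"
      assume S: "range S \<subseteq> sets M" "disjoint_family S" "(\<Union>i. S i) \<in> sets M"
      have Si: "S i \<in> sets M" for i using S(1) by auto
      have "\<mu> (\<Union>i. S i) = T (\<lambda>x. SUP n. \<Sum>i<n. indicator (S i) x)"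
        unfolding \<mu>[OF S(3)]
        by (rule cong) (simp add: suminf_indicator[OF S(2), symmetric] suminf_eq_SUP)
      also have "\<dots> = (SUP n. T (\<lambda>x. \<Sum>i<n. indicator (S i) x))"
        using Si by (intro SUP) (auto simp: incseq_def le_fun_def intro!: sum_mono2)
      also have "\<dots> = (SUP n. \<Sum>i<n. \<mu> (S i))"
        using Si by (subst sum) (auto simp: \<mu>)
      finally show "(\<Sum>i. \<mu> (S i)) = \<mu> (\<Union>i. S i)" by (simp add: suminf_eq_SUP)
    qed
    moreover have "positive (sets M) \<mu>"
      using \<mu>[of "{}"] zero cong[of "indicator {}" "\<lambda>_. 0"] by (simp add: positive_def)
    ultimately show ?thesis
      using \<mu>[OF S] S by (subst emeasure_measure_of_sigma[OF sets.sigma_algebra_axioms]) auto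
  qed
  let ?N = "measure_of (space M) (sets M) \<mu>"
  have [measurable_cong]: "sets ?N = sets M" by simp
  show ?thesis
    using f
  proof (induction rule: borel_measurable_induct)
    case (cong f g)
    have "(\<integral>\<^sup>+x. f x \<partial>?N) = (\<integral>\<^sup>+x. g x \<partial>?N)"
      using cong.hyps by (intro nn_integral_cong) simp
    moreover have "T f = T g" using cong.hyps by (intro assms(1)) simp
    ultimately show ?case using cong.IH by simp
  next
    case (set S)
    then show ?case using emeasure[OF set] by simp
  next
    case (mult u c)
    then show ?case using cmult[of u c] by (subst nn_integral_cmult) auto
  next
    case (add u v)
    then show ?case using assms(3)[of v u] by (subst nn_integral_add) auto
  next
    case (seq U)
    have "(\<integral>\<^sup>+x. (SUP i. U i) x \<partial>?N) = (\<integral>\<^sup>+x. (SUP i. U i x) \<partial>?N)"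
      by (simp add: SUP_apply[abs_def] image_comp)
    also have "\<dots> = (SUP i. \<integral>\<^sup>+x. U i x \<partial>?N)"
      using seq by (intro nn_integral_monotone_convergence_SUP) auto
    also have "\<dots> = T (\<lambda>x. SUP i. U i x)"
      using seq SUP[of U] by simp
    also have "\<dots> = T (SUP i. U i)"
      by (rule assms(1)) (simp add: SUP_apply image_comp)
    finally show ?case .
  qed
qed

context controlled_process
begin

lemma measurable_Pair_time:
  assumes "\<omega> \<in> sample_space X"
  shows "Pair \<omega> \<in> measurable pos_time traj_time"
  using assms by (intro measurable_Pair1') simp

lemma measurable_Pair_traj:
  assumes "0 < t"
  shows "(\<lambda>\<omega>. (\<omega>, t)) \<in> measurable (trajectories X) traj_time"
  using assms by (intro measurable_Pair2') simp

lemma borel_measurable_P_pos: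
  "f \<in> borel_measurable traj_time \<Longrightarrow> f \<in> borel_measurable (P \<Otimes>\<^sub>M pos_lborel)"
  by (simp cong: measurable_cong_sets add: sets_pair_measure_cong[OF sets_P sets_pos_lborel])

lemma borel_measurable_P: "f \<in> borel_measurable (trajectories X) \<Longrightarrow> f \<in> borel_measurable P"
  by (simp cong: measurable_cong_sets add: sets_P)

lemma nn_integral_time_swap:
  assumes f: "(\<lambda>w. f (fst w) (snd w)) \<in> borel_measurable traj_time"
  shows "(\<integral>\<^sup>+\<omega>. (\<integral>\<^sup>+s. f \<omega> s \<partial>pos_lborel) \<partial>P) = (\<integral>\<^sup>+s. (\<integral>\<^sup>+\<omega>. f \<omega> s \<partial>P) \<partial>pos_lborel)"
proof -
  interpret T: sigma_finite_measure pos_lborel by (rule sigma_finite_pos_lborel)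
  interpret pair_sigma_finite P pos_lborel ..
  show ?thesis
    using borel_measurable_P_pos[OF f] by (intro Fubini'[symmetric]) (simp add: case_prod_unfold)
qed

lemma measurable_jump_kernel_section:
  assumes f: "f \<in> borel_measurable (time_state X)" and s: "0 < s" and x: "x \<in> space X"
  shows "(\<lambda>y. f (s, y)) \<in> borel_measurable X"
    and "(\<lambda>b. \<integral>\<^sup>+y. f (s, y) \<partial>jump_kernel x b) \<in> borel_measurable A"
proof -
  have "Pair s \<in> measurable X (time_state X)"
    unfolding time_state_def using s by (intro measurable_Pair1') simp
  from measurable_compose[OF this f] show *: "(\<lambda>y. f (s, y)) \<in> borel_measurable X" .
  from measurable_compose[OF measurable_snd[of A X] this]
  have "(\<lambda>(b, y). f (s, y)) \<in> borel_measurable (A \<Otimes>\<^sub>M X)" by (simp add: case_prod_unfold)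
  from nn_integral_jump_kernel_measurable[OF _ _ this, of "\<lambda>_. x" "\<lambda>b. b"] x
  show "(\<lambda>b. \<integral>\<^sup>+y. f (s, y) \<partial>jump_kernel x b) \<in> borel_measurable A" by simp
qed

text \<open>The set function in the definition of the intensity is a measure, and integrals against it are
iterated integrals over time, actions and jumps.\<close>

lemma nn_integral_jump_intensity:
  assumes \<omega>: "\<omega> \<in> sample_space X" and f: "f \<in> borel_measurable (time_state X)"
  shows "(\<integral>\<^sup>+p. f p \<partial>jump_intensity X D q \<pi> \<omega>) =
    (\<integral>\<^sup>+s. case_option 0 (\<lambda>x. \<integral>\<^sup>+b. (\<integral>\<^sup>+y. f (s, y) \<partial>jump_kernel x b) \<partial>act \<omega> s) (state \<omega> s) \<partial>pos_lborel)"
    (is "_ = ?T f")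
proof -
  let ?I = "\<lambda>f s. case_option (0::ennreal)
    (\<lambda>x. \<integral>\<^sup>+b. (\<integral>\<^sup>+y. f (s, y) \<partial>jump_kernel x b) \<partial>act \<omega> s) (state \<omega> s)"
  have state_X: "x \<in> space X" if "state \<omega> s = Some x" for s x
    using state_SomeD[OF \<omega> that] by blast
  have I_meas: "?I f \<in> borel_measurable pos_lborel" if "f \<in> borel_measurable (time_state X)" for f
  proof -
    have "(\<lambda>((w, x), y). (snd w, y)) \<in> measurable ((traj_time \<Otimes>\<^sub>M X) \<Otimes>\<^sub>M X) (time_state X)"
      unfolding time_state_def case_prod_unfold
      by (intro measurable_Pair measurable_snd measurable_compose[OF measurable_fst]
          measurable_compose[OF measurable_fst measurable_snd])
    from measurable_compose[OF this that]
    have "(\<lambda>((w, x), y). f (snd w, y)) \<in> borel_measurable ((traj_time \<Otimes>\<^sub>M X) \<Otimes>\<^sub>M X)"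
      by (simp add: case_prod_unfold)
    from measurable_compose[OF measurable_Pair_time[OF \<omega>] measurable_jump_rate_integral[OF this, of UNIV]]
    have "?I f \<in> borel_measurable pos_time" by (simp cong: option.case_cong)
    then show ?thesis by (simp cong: measurable_cong_sets add: sets_pos_lborel)
  qed
  have act_meas: "g \<in> borel_measurable (act \<omega> s)" if "g \<in> borel_measurable A" for g :: "'a \<Rightarrow> ennreal" and s
    using that by (simp cong: measurable_cong_sets)
  have jk_meas: "g \<in> borel_measurable (jump_kernel x b)" if "g \<in> borel_measurable X"
    for g :: "'x \<Rightarrow> ennreal" and x b
    using that by (simp cong: measurable_cong_sets)
  note meas = act_meas[OF measurable_jump_kernel_section(2)] jk_meas[OF measurable_jump_kernel_section(1)]
  show ?thesis
    unfolding jump_intensity_def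
  proof (rule nn_integral_measure_of_functional[OF _ _ _ _ _ f])
    fix f g :: "real \<times> 'x \<Rightarrow> ennreal"
    assume eq: "\<And>p. p \<in> space (time_state X) \<Longrightarrow> f p = g p"
    show "?T f = ?T g"
      by (intro nn_integral_cong) (auto simp: space_time_state intro!: eq nn_integral_cong split: option.split)
  next
    fix f :: "real \<times> 'x \<Rightarrow> ennreal" and c
    assume f: "f \<in> borel_measurable (time_state X)"
    have "?I (\<lambda>p. c * f p) s = c * ?I f s" if "0 < s" for s
    proof (cases "state \<omega> s")
      case (Some x)
      note m = meas[OF f that state_X[OF Some]]
      show ?thesis using m by (simp add: Some nn_integral_cmult)
    qed simp
    then have "?T (\<lambda>p. c * f p) = (\<integral>\<^sup>+s. c * ?I f s \<partial>pos_lborel)"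
      by (intro nn_integral_cong) simp
    then show "?T (\<lambda>p. c * f p) = c * ?T f"
      using nn_integral_cmult[OF I_meas[OF f]] by simp
  next
    fix f g :: "real \<times> 'x \<Rightarrow> ennreal"
    assume f: "f \<in> borel_measurable (time_state X)" and g: "g \<in> borel_measurable (time_state X)"
    have "?I (\<lambda>p. f p + g p) s = ?I f s + ?I g s" if "0 < s" for s
    proof (cases "state \<omega> s")
      case (Some x)
      note m = meas[OF f that state_X[OF Some]] meas[OF g that state_X[OF Some]]
      show ?thesis using m by (simp add: Some nn_integral_add)
    qed simp
    then have "?T (\<lambda>p. f p + g p) = (\<integral>\<^sup>+s. ?I f s + ?I g s \<partial>pos_lborel)"
      by (intro nn_integral_cong) simp
    then show "?T (\<lambda>p. f p + g p) = ?T f + ?T g"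
      using nn_integral_add[OF I_meas[OF f] I_meas[OF g]] by simp
  next
    fix F :: "nat \<Rightarrow> real \<times> 'x \<Rightarrow> ennreal"
    assume F: "\<And>i. F i \<in> borel_measurable (time_state X)" and inc: "incseq F"
    have Fmono: "F i p \<le> F j p" if "i \<le> j" for i j p
      using inc that by (cases p) (auto simp: incseq_def le_fun_def)
    have I_mono: "?I (F i) s \<le> ?I (F j) s" if "i \<le> j" for i j s
      using Fmono[OF that] by (auto intro!: nn_integral_mono split: option.split)
    have "?I (\<lambda>p. SUP i. F i p) s = (SUP i. ?I (F i) s)" if s: "0 < s" for s
    proof (cases "state \<omega> s")
      case (Some x)
      note m = meas[OF F s state_X[OF Some]]
      have "(\<integral>\<^sup>+y. (SUP i. F i (s, y)) \<partial>jump_kernel x b) = (SUP i. \<integral>\<^sup>+y. F i (s, y) \<partial>jump_kernel x b)" for b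
        using Fmono m by (intro nn_integral_monotone_convergence_SUP) (auto simp: incseq_def le_fun_def)
      moreover have "(\<integral>\<^sup>+b. (SUP i. \<integral>\<^sup>+y. F i (s, y) \<partial>jump_kernel x b) \<partial>act \<omega> s) =
          (SUP i. \<integral>\<^sup>+b. (\<integral>\<^sup>+y. F i (s, y) \<partial>jump_kernel x b) \<partial>act \<omega> s)"
        using Fmono m by (intro nn_integral_monotone_convergence_SUP)
          (auto simp: incseq_def le_fun_def intro!: nn_integral_mono)
      ultimately show ?thesis by (simp add: Some)
    qed simp
    then have "?T (\<lambda>p. SUP i. F i p) = (\<integral>\<^sup>+s. (SUP i. ?I (F i) s) \<partial>pos_lborel)"
      by (intro nn_integral_cong) simp
    also have "\<dots> = (SUP i. ?T (F i))"
      using I_mono I_meas[OF F]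
      by (intro nn_integral_monotone_convergence_SUP) (auto simp: incseq_def le_fun_def)
    finally show "?T (\<lambda>p. SUP i. F i p) = (SUP i. ?T (F i))" .
  next
    fix S assume S: "S \<in> sets (time_state X)"
    have "action_average D (jump_rate q {z. (s, z) \<in> S}) (state \<omega> s) (\<pi> \<omega> s)
        * indicator (Some ` space X) (state \<omega> s) = ?I (indicator S) s" if s: "0 < s" for s
    proof (cases "state \<omega> s")
      case (Some x)
      note x = state_X[OF Some]
      have S_s: "{z. (s, z) \<in> S} \<in> sets X"
        using sets_Pair1[of S _ X s] S by (simp add: time_state_def vimage_def)
      have eq: "jump_rate q {z. (s, z) \<in> S} (Some x) (Some b) * indicator (D x) b =
          (\<integral>\<^sup>+y. indicator S (s, y) \<partial>jump_kernel x b)" for b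
      proof -
        have "(\<integral>\<^sup>+y. indicator S (s, y) \<partial>jump_kernel x b) =
            (\<integral>\<^sup>+y. indicator {z. (s, z) \<in> S} y \<partial>jump_kernel x b)"
          by (intro nn_integral_cong) (simp add: indicator_def)
        also have "\<dots> = emeasure (jump_kernel x b) {z. (s, z) \<in> S}"
          using S_s by (intro nn_integral_indicator) simp
        finally show ?thesis
          using x S_s by (simp add: jump_rate_def emeasure_jump_kernel split: split_indicator)
      qed
      show ?thesis
        using x measurable_jump_kernel_section(2)[OF borel_measurable_indicator[OF S] s x]
        by (simp add: Some action_average_Some[OF sets_policy[OF \<omega> s]] eq act_def[symmetric])
    qed simp
    then show "(\<integral>\<^sup>+s\<in>{0<..}. (action_average D (jump_rate q {z. (s, z) \<in> S}) (state \<omega> s) (\<pi> \<omega> s)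
           * indicator (Some ` space X) (state \<omega> s)) \<partial>lborel) = ?T (indicator S)"
      unfolding nn_integral_pos_lborel[symmetric] by (intro nn_integral_cong) simp
  qed
qed

end

lemma state_left_on_eq_state_on:
  assumes "0 < s" "\<And>j. jump_time \<omega> (Suc j) \<noteq> ereal s"
    and \<omega>: "\<omega> \<in> sample_space X"
  shows "state_left_on J \<omega> s = state_on J \<omega> s"
proof -
  have ne: "jump_time \<omega> n \<noteq> ereal s" for n
    using assms(1,2) by (cases n) (auto simp: zero_ereal_def)
  have eq: "sojourn_left \<omega> n s \<longleftrightarrow>
      sojourn \<omega> n s" for n
    using ne[of n] ne[of "Suc n"] by (auto simp: order.strict_iff_order)
  show ?thesis
  proof (cases "\<exists>n\<in>J. sojourn \<omega> n s")
    case True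
    then obtain n where n: "jump_time \<omega> n \<le> ereal s" "ereal s < jump_time \<omega> (Suc n)" by blast
    moreover have "jump_time \<omega> n < ereal s" "ereal s \<le> jump_time \<omega> (Suc n)"
      using n eq[of n] by auto
    ultimately show ?thesis
      using True state_eq[OF \<omega> n] state_left_eq[OF \<omega>, of n s]
      by (simp add: state_on_def state_left_on_def eq)
  qed (auto simp: state_on_def state_left_on_def eq)
qed

lemma AE_state_left_on_eq_state_on:
  assumes \<omega>: "\<omega> \<in> sample_space X"
  shows "AE s in pos_lborel. state_left_on J \<omega> s = state_on J \<omega> s"
proof -
  let ?N = "range (\<lambda>j. real_of_ereal (jump_time \<omega> (Suc j)))"
  have "AE s in lborel. s \<notin> ?N"
    by (intro AE_not_in countable_imp_null_set_lborel) simp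
  then have "AE s in lborel. s \<in> {0<..} \<longrightarrow> state_left_on J \<omega> s = state_on J \<omega> s"
  proof (rule AE_mp, intro AE_I2 impI)
    fix s :: real assume s: "s \<notin> ?N" "s \<in> {0<..}"
    have "jump_time \<omega> (Suc j) \<noteq> ereal s" for j
      using s(1) by (metis rangeI real_of_ereal.simps(1))
    then show "state_left_on J \<omega> s = state_on J \<omega> s"
      using s by (intro state_left_on_eq_state_on[OF _ _ \<omega>]) auto
  qed
  then show ?thesis by (subst AE_restrict_space_iff) auto
qed

lemma measurable_predictable_time: "snd \<in> measurable (predictable_sets X) pos_time"
proof (rule measurable_restrict_space2)
  show "snd \<in> borel_measurable (predictable_sets X)"
  proof (subst borel_measurable_iff_greater, intro allI)
    fix a :: real
    have "{w \<in> space (predictable_sets X). a < snd w} = sample_space X \<times> {max a 0<..}" by auto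
    also have "\<dots> \<in> sets (predictable_sets X)"
      using sets.top[of "history X (max a 0)"] by (intro predictable_ray) simp_all
    finally show "{w \<in> space (predictable_sets X). a < snd w} \<in> sets (predictable_sets X)" .
  qed
qed auto

text \<open>The sum of \<open>h\<close> over the jumps number \<open>j + 1\<close> with \<open>j \<in> J\<close>; the arguments of \<open>h\<close> are the jump
  epoch and the states before and after the jump.\<close>

abbreviation jump_sum :: "nat set \<Rightarrow> (real \<Rightarrow> 'x \<Rightarrow> 'x \<Rightarrow> ennreal) \<Rightarrow> 'x traj \<Rightarrow> ennreal" where
  "jump_sum J h \<omega> \<equiv> \<Sum>j. if j \<in> J \<and> jump_time \<omega> (Suc j) < \<infinity>
    then h (real_of_ereal (jump_time \<omega> (Suc j))) (the (jump_state \<omega> j)) (the (jump_state \<omega> (Suc j)))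
    else 0"

context controlled_process
begin

text \<open>The compensator evaluated on functions of the jump epoch and of the states before and after
  the jump, restricted to the jumps whose number lies in \<open>Suc ` J\<close>.\<close>

lemma jump_sum_expectation:
  assumes h: "(\<lambda>((s, x), y). h s x y) \<in> borel_measurable step_space"
  shows "(\<integral>\<^sup>+\<omega>. jump_sum J h \<omega> \<partial>P) =
    (\<integral>\<^sup>+\<omega>. (\<integral>\<^sup>+s. case_option 0 (\<lambda>x. \<integral>\<^sup>+b. (\<integral>\<^sup>+y. h s x y \<partial>jump_kernel x b) \<partial>act \<omega> s) (state_on J \<omega> s) \<partial>pos_lborel) \<partial>P)"
proof -
  let ?Y = "\<lambda>w. case_option (0::ennreal) (\<lambda>x. h (snd (fst w)) x (snd w)) (state_left_on J (fst (fst w)) (snd (fst w)))"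
  have Y: "?Y \<in> borel_measurable (predictable_sets X \<Otimes>\<^sub>M X)"
  proof (rule borel_measurable_case_option)
    show "(\<lambda>w. state_left_on J (fst (fst w)) (snd (fst w)))
        \<in> measurable (predictable_sets X \<Otimes>\<^sub>M X) (adjoin_point X)"
      using measurable_compose[OF measurable_fst measurable_state_left_on[of J X]]
      by (simp only: case_prod_unfold)
    have "(\<lambda>v. ((snd (fst (fst v)), snd v), snd (fst v)))
        \<in> measurable ((predictable_sets X \<Otimes>\<^sub>M X) \<Otimes>\<^sub>M X) step_space"
      by (intro measurable_Pair measurable_snd measurable_compose[OF measurable_fst measurable_snd]
          measurable_compose[OF measurable_compose[OF measurable_fst measurable_fst] measurable_predictable_time])
    from measurable_compose[OF this h]
    show "(\<lambda>(w, x). h (snd (fst w)) x (snd w)) \<in> borel_measurable ((predictable_sets X \<Otimes>\<^sub>M X) \<Otimes>\<^sub>M X)"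
      by (simp add: case_prod_unfold)
  qed
  have Y_section: "(\<lambda>(t, z). ?Y ((\<omega>, t), z)) \<in> borel_measurable (time_state X)"
    if \<omega>: "\<omega> \<in> sample_space X" for \<omega>
  proof -
    have "(\<lambda>(t, z). ((\<omega>, t), z)) \<in> measurable (time_state X) (predictable_sets X \<Otimes>\<^sub>M X)"
      unfolding time_state_def case_prod_unfold
      by (intro measurable_Pair measurable_snd measurable_compose[OF measurable_fst]
          measurable_compose[OF measurable_Pair_time[OF \<omega>] measurable_to_predictable])
    from measurable_compose[OF this Y] show ?thesis
      by (simp add: case_prod_unfold cong: option.case_cong)
  qed
  have "(\<integral>\<^sup>+(t, z). ?Y ((\<omega>, t), z) \<partial>jump_measure X \<omega>) =
      jump_sum J h \<omega>"
    if \<omega>: "\<omega> \<in> sample_space X" for \<omega>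
  proof -
    have left: "state_left_on J \<omega> (real_of_ereal (jump_time \<omega> (Suc j))) =
        (if j \<in> J then jump_state \<omega> j else None)" if fin: "jump_time \<omega> (Suc j) < \<infinity>" for j
    proof -
      let ?s = "real_of_ereal (jump_time \<omega> (Suc j))"
      have s: "ereal ?s = jump_time \<omega> (Suc j)" by (rule jump_time_real[OF \<omega> fin])
      have "jump_time \<omega> j \<le> jump_time \<omega> (Suc j)" by (rule jump_time_mono[OF \<omega>]) simp
      then have "jump_time \<omega> j < \<infinity>" using fin by (rule le_less_trans)
      then have j: "jump_time \<omega> j < ereal ?s" "ereal ?s \<le> jump_time \<omega> (Suc j)"
        using jump_time_less[OF \<omega>, of j] s by simp_all
      have "n = j" if "jump_time \<omega> n < ereal ?s" "ereal ?s \<le> jump_time \<omega> (Suc n)" for n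
        using sojourn_left_unique[OF \<omega> that j] .
      then have "(\<exists>n\<in>J. sojourn_left \<omega> n ?s) \<longleftrightarrow> j \<in> J"
        using j by blast
      then show ?thesis using state_left_eq[OF \<omega> j] by (simp only: state_left_on_def)
    qed
    have "jump_time \<omega> j < \<infinity>" if "jump_time \<omega> (Suc j) < \<infinity>" for j
      using jump_time_mono[OF \<omega>, of j "Suc j"] that by (auto intro: le_less_trans)
    then have js: "jump_state \<omega> j \<noteq> None" if "jump_time \<omega> (Suc j) < \<infinity>" for j
      using jump_state_finite[OF \<omega>, of j] that by auto
    show ?thesis
      unfolding nn_integral_jump_measure[OF \<omega> Y_section[OF \<omega>]]
    proof (rule suminf_cong)
      fix j
      show "(if jump_time \<omega> (Suc j) < \<infinity>
          then case (real_of_ereal (jump_time \<omega> (Suc j)), the (jump_state \<omega> (Suc j))) of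
            (t, z) \<Rightarrow> ?Y ((\<omega>, t), z) else 0) =
        (if j \<in> J \<and> jump_time \<omega> (Suc j) < \<infinity>
          then h (real_of_ereal (jump_time \<omega> (Suc j))) (the (jump_state \<omega> j)) (the (jump_state \<omega> (Suc j))) else 0)"
        using js[of j] left[of j] by (cases "jump_state \<omega> j") auto
    qed
  qed
  then have lhs: "(\<integral>\<^sup>+\<omega>. (\<integral>\<^sup>+(t, z). ?Y ((\<omega>, t), z) \<partial>jump_measure X \<omega>) \<partial>P) =
      (\<integral>\<^sup>+\<omega>. jump_sum J h \<omega> \<partial>P)"
    by (intro nn_integral_cong) simp
  have "(\<integral>\<^sup>+(t, z). ?Y ((\<omega>, t), z) \<partial>jump_intensity X D q \<pi> \<omega>) =
      (\<integral>\<^sup>+s. case_option 0 (\<lambda>x. \<integral>\<^sup>+b. (\<integral>\<^sup>+y. h s x y \<partial>jump_kernel x b) \<partial>act \<omega> s) (state_on J \<omega> s) \<partial>pos_lborel)"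
    if \<omega>: "\<omega> \<in> sample_space X" for \<omega>
    unfolding nn_integral_jump_intensity[OF \<omega> Y_section[OF \<omega>]] case_prod_conv
  proof (rule nn_integral_cong_AE, rule AE_mp[OF AE_state_left_on_eq_state_on[OF \<omega>, of J]], intro AE_I2 impI)
    fix s assume eq: "state_left_on J \<omega> s = state_on J \<omega> s"
    show "case_option 0 (\<lambda>x. \<integral>\<^sup>+b. (\<integral>\<^sup>+y. ?Y ((\<omega>, s), y) \<partial>jump_kernel x b) \<partial>act \<omega> s) (state \<omega> s) =
        case_option 0 (\<lambda>x. \<integral>\<^sup>+b. (\<integral>\<^sup>+y. h s x y \<partial>jump_kernel x b) \<partial>act \<omega> s) (state_on J \<omega> s)"
      using state_on_SomeD[OF \<omega>, of J s]
      by (cases "state_on J \<omega> s"; cases "state \<omega> s") (simp_all add: eq)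
  qed
  then have "(\<integral>\<^sup>+\<omega>. (\<integral>\<^sup>+(t, z). ?Y ((\<omega>, t), z) \<partial>jump_intensity X D q \<pi> \<omega>) \<partial>P) =
    (\<integral>\<^sup>+\<omega>. (\<integral>\<^sup>+s. case_option 0 (\<lambda>x. \<integral>\<^sup>+b. (\<integral>\<^sup>+y. h s x y \<partial>jump_kernel x b) \<partial>act \<omega> s) (state_on J \<omega> s) \<partial>pos_lborel) \<partial>P)"
    by (intro nn_integral_cong) simp
  with lhs compensation[OF Y] show ?thesis by simp
qed

text \<open>The intensity being absolutely continuous in time, no jump occurs at a fixed time.\<close>

lemma AE_no_jump_at:
  assumes t: "0 < t"
  shows "AE \<omega> in P. \<forall>j. jump_time \<omega> (Suc j) \<noteq> ereal t"
proof -
  let ?h = "\<lambda>(s::real) (x::'x) (y::'x). indicator {t} s :: ennreal"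
  let ?S = "\<lambda>\<omega>. jump_sum UNIV ?h \<omega>"
  have ind: "(indicator {t} :: real \<Rightarrow> ennreal) \<in> borel_measurable pos_time"
    by (rule measurable_restrict_space1) simp
  have h: "(\<lambda>((s, x), y). ?h s x y) \<in> borel_measurable step_space"
    using measurable_compose[OF measurable_compose[OF measurable_fst measurable_fst] ind, of X X]
    by (simp add: case_prod_unfold)
  have zero: "case_option (0::ennreal) (\<lambda>x. \<integral>\<^sup>+b. (\<integral>\<^sup>+y. ?h s x y \<partial>jump_kernel x b) \<partial>act \<omega> s) (state_on UNIV \<omega> s) = 0"
    if "s \<noteq> t" for s \<omega>
    using that by (simp split: option.split)
  have "AE s in lborel. s \<noteq> t" by (rule AE_lborel_singleton)
  then have "AE s in pos_lborel. s \<noteq> t"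
    by (subst AE_restrict_space_iff) (auto elim: eventually_mono)
  then have "(\<integral>\<^sup>+s. case_option 0 (\<lambda>x. \<integral>\<^sup>+b. (\<integral>\<^sup>+y. ?h s x y \<partial>jump_kernel x b) \<partial>act \<omega> s) (state_on UNIV \<omega> s) \<partial>pos_lborel)
      = (\<integral>\<^sup>+s. 0 \<partial>pos_lborel)" for \<omega>
    by (intro nn_integral_cong_AE) (auto elim!: eventually_mono simp del: state_on_UNIV intro!: zero)
  then have "(\<integral>\<^sup>+\<omega>. ?S \<omega> \<partial>P) = 0"
    unfolding jump_sum_expectation[OF h, of UNIV] by simp
  moreover have "?S \<in> borel_measurable P"
    by (intro borel_measurable_P) measurable
  ultimately have "AE \<omega> in P. ?S \<omega> = 0"
    by (simp add: nn_integral_0_iff_AE)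
  then show ?thesis
  proof (rule AE_mp, intro AE_I2 impI allI notI)
    fix \<omega> j assume S: "?S \<omega> = 0" and j: "jump_time \<omega> (Suc j) = ereal t"
    have "(\<Sum>i\<in>{j}. if i \<in> UNIV \<and> jump_time \<omega> (Suc i) < \<infinity>
        then ?h (real_of_ereal (jump_time \<omega> (Suc i))) (the (jump_state \<omega> i)) (the (jump_state \<omega> (Suc i))) else 0) \<le> ?S \<omega>"
      by (rule sum_le_suminf) auto
    then show False using S j by simp
  qed
qed

end

section \<open>Survival weights\<close>

lemma constant_if_quadratic_increments:
  fixes d :: "real \<Rightarrow> real"
  assumes quad: "\<And>u v. a \<le> u \<Longrightarrow> u \<le> v \<Longrightarrow> v \<le> b \<Longrightarrow> \<bar>d v - d u\<bar> \<le> K * (v - u)\<^sup>2"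
    and ab: "a \<le> b"
  shows "d a = d b"
proof -
  have bound: "real n * \<bar>d b - d a\<bar> \<le> K * (b - a)\<^sup>2" if n: "0 < n" for n :: nat
  proof -
    define h where "h = (b - a) / n"
    define p where "p i = a + real i * h" for i :: nat
    have h: "0 \<le> h" "real n * h = b - a" using ab n by (auto simp: h_def)
    have p_le: "p i \<le> b" if "i \<le> n" for i
    proof -
      have "real i * h \<le> real n * h" using that h by (intro mult_right_mono) auto
      then show ?thesis using h by (simp add: p_def)
    qed
    have "\<bar>d b - d a\<bar> = \<bar>\<Sum>i<n. d (p (Suc i)) - d (p i)\<bar>"
      using h by (subst sum_lessThan_telescope) (simp add: p_def)
    also have "\<dots> \<le> (\<Sum>i<n. \<bar>d (p (Suc i)) - d (p i)\<bar>)" by (rule sum_abs)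
    also have "\<dots> \<le> (\<Sum>i<n. K * h\<^sup>2)"
    proof (rule sum_mono)
      fix i assume "i \<in> {..<n}"
      then have "\<bar>d (p (Suc i)) - d (p i)\<bar> \<le> K * (p (Suc i) - p i)\<^sup>2"
        using h p_le[of "Suc i"] by (intro quad) (auto simp: p_def algebra_simps)
      then show "\<bar>d (p (Suc i)) - d (p i)\<bar> \<le> K * h\<^sup>2" by (simp add: p_def algebra_simps)
    qed
    finally have "real n * \<bar>d b - d a\<bar> \<le> real n * (real n * (K * h\<^sup>2))"
      by (intro mult_left_mono) auto
    also have "\<dots> = K * (real n * h)\<^sup>2" by (simp add: power2_eq_square)
    finally show ?thesis using h by simp
  qed
  show ?thesis
  proof (rule ccontr)
    assume "d a \<noteq> d b"
    then have pos: "0 < \<bar>d b - d a\<bar>" by simp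
    obtain n :: nat where n: "K * (b - a)\<^sup>2 < real n * \<bar>d b - d a\<bar>"
      using reals_Archimedean3[OF pos] by blast
    moreover have "0 \<le> K * (b - a)\<^sup>2"
      using quad[of a b] ab by (meson abs_ge_zero order_refl order_trans)
    ultimately have "0 < n" by (cases n) auto
    with bound[of n] n show False by simp
  qed
qed

text \<open>The function \<open>s \<mapsto> exp (- \<integral>\<^sub>s\<^sup>t r)\<close> satisfies the integrated form of \<open>E' = r E\<close> for every bounded
  measurable rate \<open>r\<close>: the defect is additive over intervals and quadratically small.\<close>

lemma exp_integral_equation:
  fixes r :: "real \<Rightarrow> ennreal"
  assumes r: "r \<in> borel_measurable pos_lborel" and M: "\<And>s. 0 < s \<Longrightarrow> r s \<le> ennreal M"
    and ab: "0 \<le> a" "a \<le> b" "b \<le> t"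
  defines "E \<equiv> \<lambda>s. exp (- enn2real (\<integral>\<^sup>+v\<in>{s<..t}. r v \<partial>pos_lborel))"
  shows "ennreal (E a) + (\<integral>\<^sup>+s\<in>{a<..b}. r s * ennreal (E s) \<partial>pos_lborel) = ennreal (E b)"
proof -
  define M' where "M' = max M 0"
  have M': "r s \<le> ennreal M'" if "0 < s" for s
    using M[OF that] by (simp add: M'_def ennreal_max_0 max.commute)
  have M'0: "0 \<le> M'" by (simp add: M'_def)
  have ivl [measurable]: "{u<..v} \<in> sets pos_lborel" if "0 \<le> u" for u v :: real
    using that by (auto simp: sets_restrict_space_iff)
  have emeasure_ivl: "emeasure pos_lborel {u<..v} = ennreal (v - u)" if "0 \<le> u" "u \<le> v" for u v :: real
    using that by (subst emeasure_restrict_space) auto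
  define I where "I u v = enn2real (\<integral>\<^sup>+s\<in>{u<..v}. r s \<partial>pos_lborel)" for u v
  have I_le: "(\<integral>\<^sup>+s\<in>{u<..v}. f s \<partial>pos_lborel) \<le> ennreal c * ennreal (v - u)"
    if "0 \<le> u" "u \<le> v" "\<And>s. s \<in> {u<..v} \<Longrightarrow> f s \<le> ennreal c" for u v c and f :: "real \<Rightarrow> ennreal"
  proof -
    have "(\<integral>\<^sup>+s\<in>{u<..v}. f s \<partial>pos_lborel) \<le> (\<integral>\<^sup>+s. ennreal c * indicator {u<..v} s \<partial>pos_lborel)"
      using that by (intro nn_integral_mono) (auto split: split_indicator)
    then show ?thesis
      using that by (simp add: nn_integral_cmult_indicator emeasure_ivl)
  qed
  have I_fin: "(\<integral>\<^sup>+s\<in>{u<..v}. r s \<partial>pos_lborel) = ennreal (I u v)" if "0 \<le> u" "u \<le> v" for u v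
    using I_le[OF that, of r M'] M' that unfolding I_def
    by (intro ennreal_enn2real[symmetric]) (auto simp: ennreal_mult_less_top intro: le_less_trans)
  have I_nonneg: "0 \<le> I u v" for u v by (simp add: I_def)
  have I_bound: "I u v \<le> M' * (v - u)" if "0 \<le> u" "u \<le> v" for u v
  proof -
    have "ennreal (I u v) \<le> ennreal (M' * (v - u))"
      using I_le[OF that, of r M'] M' that I_fin[OF that] M'0 by (simp add: ennreal_mult)
    then show ?thesis using M'0 that by (simp add: ennreal_le_iff)
  qed
  have split: "(\<integral>\<^sup>+s\<in>{u<..w}. f s \<partial>pos_lborel) =
      (\<integral>\<^sup>+s\<in>{u<..v}. f s \<partial>pos_lborel) + (\<integral>\<^sup>+s\<in>{v<..w}. f s \<partial>pos_lborel)"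
    if "0 \<le> u" "u \<le> v" "v \<le> w" and [measurable]: "f \<in> borel_measurable pos_lborel"
    for u v w and f :: "real \<Rightarrow> ennreal"
  proof -
    have "f s * indicator {u<..w} s = f s * indicator {u<..v} s + f s * indicator {v<..w} s" for s
      using that by (auto split: split_indicator)
    then show ?thesis using that by (simp add: nn_integral_add)
  qed
  have I_add: "I u w = I u v + I v w" if "0 \<le> u" "u \<le> v" "v \<le> w" for u v w
  proof -
    have "ennreal (I u w) = ennreal (I u v + I v w)"
      using split[OF that r] I_fin[of u w] I_fin[of u v] I_fin[of v w] that I_nonneg
      by (simp add: ennreal_plus)
    then show ?thesis using I_nonneg by (metis add_nonneg_nonneg ennreal_inj)
  qed
  have E_I: "E s = exp (- I s t)" for s by (simp add: E_def I_def)
  have E_mult: "E u = E v * exp (- I u v)" if "0 \<le> u" "u \<le> v" "v \<le> t" for u v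
    using I_add[OF that] by (simp add: E_I exp_add[symmetric])
  have E_pos: "0 < E s" and E_le1: "E s \<le> 1" for s
    using I_nonneg by (simp_all add: E_I)
  have E_mono: "E u \<le> E v" if "0 \<le> u" "u \<le> v" "v \<le> t" for u v
    using E_mult[OF that] E_pos[of v] I_nonneg[of u v] by (simp add: mult_le_cancel_left1)
  have [measurable]: "(\<lambda>s. \<integral>\<^sup>+v\<in>{s<..t}. r v \<partial>pos_lborel) \<in> borel_measurable pos_lborel"
  proof -
    interpret T: sigma_finite_measure pos_lborel by (rule sigma_finite_pos_lborel)
    have [measurable]: "(\<lambda>s. s) \<in> borel_measurable pos_lborel"
      using measurable_pos_time_real by (simp cong: measurable_cong_sets add: sets_pos_lborel)
    have [measurable]: "Measurable.pred (pos_lborel \<Otimes>\<^sub>M pos_lborel) (\<lambda>w. snd w \<in> {fst w<..t})"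
      by (simp add: greaterThanAtMost_iff)
    have "(\<lambda>(s, v). r v * indicator {s<..t} v) \<in> borel_measurable (pos_lborel \<Otimes>\<^sub>M pos_lborel)"
      using r by measurable
    then show ?thesis by (rule T.borel_measurable_nn_integral)
  qed
  have [measurable]: "E \<in> borel_measurable pos_lborel"
    unfolding E_def by measurable
  define g where "g s = r s * ennreal (E s)" for s
  have g [measurable]: "g \<in> borel_measurable pos_lborel"
    using r unfolding g_def by measurable
  define G where "G u v = enn2real (\<integral>\<^sup>+s\<in>{u<..v}. g s \<partial>pos_lborel)" for u v
  have g_le: "g s \<le> ennreal M'" if "0 < s" for s
  proof -
    have "r s * ennreal (E s) \<le> ennreal M' * 1"
      using M'[OF that] E_le1[of s] by (intro mult_mono) auto
    then show ?thesis by (simp add: g_def)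
  qed
  have G_fin: "(\<integral>\<^sup>+s\<in>{u<..v}. g s \<partial>pos_lborel) = ennreal (G u v)" if "0 \<le> u" "u \<le> v" for u v
    using I_le[OF that, of g M'] g_le that unfolding G_def
    by (intro ennreal_enn2real[symmetric]) (auto simp: ennreal_mult_less_top intro: le_less_trans)
  have G_nonneg: "0 \<le> G u v" for u v by (simp add: G_def)
  have G_add: "G u w = G u v + G v w" if "0 \<le> u" "u \<le> v" "v \<le> w" for u v w
  proof -
    have "ennreal (G u w) = ennreal (G u v + G v w)"
      using split[OF that g] G_fin[of u w] G_fin[of u v] G_fin[of v w] that G_nonneg
      by (simp add: ennreal_plus)
    then show ?thesis using G_nonneg by (metis add_nonneg_nonneg ennreal_inj)
  qed
  have G_upper: "G u v \<le> E v * I u v" if "0 \<le> u" "u \<le> v" "v \<le> t" for u v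
  proof -
    have "(\<integral>\<^sup>+s\<in>{u<..v}. g s \<partial>pos_lborel) \<le> (\<integral>\<^sup>+s. ennreal (E v) * (r s * indicator {u<..v} s) \<partial>pos_lborel)"
      using that E_mono by (intro nn_integral_mono)
        (auto split: split_indicator simp: g_def mult.commute intro!: mult_left_mono ennreal_leI)
    also have "\<dots> = ennreal (E v) * ennreal (I u v)"
      using r that I_fin[of u v] by (subst nn_integral_cmult) auto
    finally show ?thesis
      using G_fin[of u v] that E_pos[of v] I_nonneg[of u v] by (simp add: ennreal_mult[symmetric] ennreal_le_iff)
  qed
  have G_lower: "E u * I u v \<le> G u v" if "0 \<le> u" "u \<le> v" "v \<le> t" for u v
  proof -
    have "ennreal (E u) * ennreal (I u v) = (\<integral>\<^sup>+s. ennreal (E u) * (r s * indicator {u<..v} s) \<partial>pos_lborel)"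
      using r that I_fin[of u v] by (subst nn_integral_cmult) auto
    also have "\<dots> \<le> (\<integral>\<^sup>+s\<in>{u<..v}. g s \<partial>pos_lborel)"
      using that E_mono by (intro nn_integral_mono)
        (auto split: split_indicator simp: g_def mult.commute intro!: mult_left_mono ennreal_leI)
    finally show ?thesis
      using G_fin[of u v] that E_pos[of u] I_nonneg[of u v] G_nonneg[of u v]
      by (simp add: ennreal_mult[symmetric] ennreal_le_iff)
  qed
  \<comment> \<open>\<open>E u = E v * exp (- i)\<close> with \<open>i = I u v\<close>, and \<open>G u v\<close> lies between \<open>E u * i\<close> and \<open>E v * i\<close>;
    hence \<open>E v - E u\<close> and \<open>G u v\<close> differ by at most \<open>i\<^sup>2\<close>.\<close>
  have quad: "\<bar>(E v - G a v) - (E u - G a u)\<bar> \<le> M'\<^sup>2 * (v - u)\<^sup>2"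
    if uv: "a \<le> u" "u \<le> v" "v \<le> b" for u v
  proof -
    have u0: "0 \<le> u" "v \<le> t" using uv ab by auto
    define i where "i = I u v"
    have i: "0 \<le> i" "i \<le> M' * (v - u)"
      using I_nonneg I_bound[OF u0(1) uv(2)] by (auto simp: i_def)
    have Eu: "E u = E v * exp (- i)"
      using E_mult[OF u0(1) uv(2) u0(2)] by (simp add: i_def)
    have Gb: "E v * exp (- i) * i \<le> G u v" "G u v \<le> E v * i"
      using G_lower[OF u0(1) uv(2) u0(2)] G_upper[OF u0(1) uv(2) u0(2)] Eu by (auto simp: i_def)
    have e1: "1 - exp (- i) \<le> i" using exp_ge_add_one_self[of "- i"] by simp
    have "exp (- i) * (1 + i) \<le> exp (- i) * exp i"
      using exp_ge_add_one_self[of i] by (intro mult_left_mono) (auto simp: add.commute)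
    then have e2: "exp (- i) * i \<le> 1 - exp (- i)"
      by (simp add: exp_minus_inverse algebra_simps mult_exp_exp)
    have e3: "i - exp (- i) * i \<le> i * i"
      using mult_right_mono[OF e1 i(1)] by (simp add: algebra_simps)
    have "E v - E u - G u v \<le> i * i"
    proof -
      have "E v - E u - G u v \<le> E v * (1 - exp (- i) - exp (- i) * i)"
        using Gb(1) Eu by (simp add: algebra_simps)
      also have "\<dots> \<le> E v * (i * i)"
        using e1 e3 E_pos[of v] by (intro mult_left_mono) auto
      also have "\<dots> \<le> 1 * (i * i)"
        using E_le1[of v] by (intro mult_right_mono) auto
      finally show ?thesis by simp
    qed
    moreover have "- (i * i) \<le> E v - E u - G u v"
    proof -
      have "E v * (i - (1 - exp (- i))) \<le> E v * (i * i)"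
        using e2 e3 E_pos[of v] by (intro mult_left_mono) auto
      also have "\<dots> \<le> 1 * (i * i)"
        using E_le1[of v] by (intro mult_right_mono) auto
      finally show ?thesis using Gb(2) Eu by (simp add: algebra_simps)
    qed
    moreover have "G a v = G a u + G u v" using uv ab by (intro G_add) auto
    moreover have "i * i \<le> M'\<^sup>2 * (v - u)\<^sup>2"
      using power_mono[OF i(2,1), of 2] by (simp only: power_mult_distrib power2_eq_square[of i])
    ultimately show ?thesis by (simp add: abs_le_iff)
  qed
  have "E a - G a a = E b - G a b"
    by (rule constant_if_quadratic_increments[OF quad ab(2)])
  moreover have "G a a = 0" by (simp add: G_def)
  ultimately have "E b = E a + G a b" by simp
  then have "ennreal (E b) = ennreal (E a) + ennreal (G a b)"
    using E_pos[of a] G_nonneg[of a b] by (simp add: ennreal_plus)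
  then show ?thesis using G_fin[OF ab(1,2)] by (simp add: g_def)
qed

section \<open>Rates averaged over a Markov kernel\<close>

text \<open>A transition probability \<open>\<kappa>\<close> from states and times to actions, in a model where the rates out of
each state are bounded over the actions.\<close>

locale markov_rates = ctjmdp X A D q
  for X :: "'x measure" and A :: "'a measure" and D q +
  fixes \<kappa> :: "'x \<Rightarrow> real \<Rightarrow> 'a measure"
  assumes kernel: "(\<lambda>(z, t). \<kappa> z t) \<in> measurable (X \<Otimes>\<^sub>M pos_time) (prob_algebra A)"
    and rate_finite: "\<And>x. x \<in> space X \<Longrightarrow> max_jump_rate X D q x < \<infinity>"
begin

lemma kernel_in_prob_algebra: "x \<in> space X \<Longrightarrow> 0 < t \<Longrightarrow> \<kappa> x t \<in> space (prob_algebra A)"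
  using measurable_space[OF kernel, of "(x, t)"] by (simp add: space_pair_measure)

lemma sets_kernel_at: "x \<in> space X \<Longrightarrow> 0 < t \<Longrightarrow> sets (\<kappa> x t) = sets A"
  using kernel_in_prob_algebra by (simp add: space_prob_algebra)

lemma prob_space_kernel_at: "x \<in> space X \<Longrightarrow> 0 < t \<Longrightarrow> prob_space (\<kappa> x t)"
  using kernel_in_prob_algebra by (simp add: space_prob_algebra)

lemma measurable_kernel_integral:
  assumes H: "(\<lambda>((s, x), b). H s x b) \<in> borel_measurable ((pos_time \<Otimes>\<^sub>M X) \<Otimes>\<^sub>M A)"
  shows "(\<lambda>(s, x). \<integral>\<^sup>+b. (H s x b :: ennreal) \<partial>\<kappa> x s) \<in> borel_measurable (pos_time \<Otimes>\<^sub>M X)"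
proof -
  have "(\<lambda>v. (snd v, fst v)) \<in> measurable (pos_time \<Otimes>\<^sub>M X) (X \<Otimes>\<^sub>M pos_time)"
    by (intro measurable_Pair measurable_snd measurable_fst)
  from measurable_compose[OF this measurable_prob_algebraD[OF kernel]]
  have "(\<lambda>v. \<kappa> (snd v) (fst v)) \<in> measurable (pos_time \<Otimes>\<^sub>M X) (subprob_algebra A)"
    by (simp add: case_prod_unfold)
  from nn_integral_measurable_subprob_algebra2[of "\<lambda>v b. H (fst v) (snd v) b", OF _ this] H
  show ?thesis by (simp add: case_prod_unfold)
qed

text \<open>The integral of \<open>h s x\<close> against the jump rates from \<open>x\<close> at time \<open>s\<close> when actions are drawn
  from \<open>\<kappa> x s\<close>, and the total rate.\<close>

definition rate_op :: "(real \<Rightarrow> 'x \<Rightarrow> 'x \<Rightarrow> ennreal) \<Rightarrow> real \<Rightarrow> 'x \<Rightarrow> ennreal" where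
  "rate_op h s x = (\<integral>\<^sup>+b. (\<integral>\<^sup>+y. h s x y \<partial>jump_kernel x b) \<partial>\<kappa> x s)"

definition rate :: "real \<Rightarrow> 'x \<Rightarrow> ennreal" where
  "rate s x = (\<integral>\<^sup>+b. emeasure (jump_kernel x b) (space X) \<partial>\<kappa> x s)"

lemma measurable_jump_integral:
  assumes h: "(\<lambda>((s, x), y). h s x y) \<in> borel_measurable step_space"
  shows "(\<lambda>((s, x), b). \<integral>\<^sup>+y. h s x y \<partial>jump_kernel x b) \<in> borel_measurable ((pos_time \<Otimes>\<^sub>M X) \<Otimes>\<^sub>M A)"
proof -
  let ?N = "(pos_time \<Otimes>\<^sub>M X) \<Otimes>\<^sub>M A"
  have "(\<lambda>u. (fst (fst u), snd u)) \<in> measurable (?N \<Otimes>\<^sub>M X) step_space"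
    by (intro measurable_Pair measurable_snd measurable_compose[OF measurable_fst measurable_fst])
  from measurable_compose[OF this h]
  have "(\<lambda>(v, y). h (fst (fst v)) (snd (fst v)) y) \<in> borel_measurable (?N \<Otimes>\<^sub>M X)"
    by (simp add: case_prod_unfold)
  from nn_integral_jump_kernel_measurable[OF _ _ this, of "\<lambda>v. snd (fst v)" "\<lambda>v. snd v"]
  show ?thesis by (simp add: case_prod_unfold)
qed

lemma measurable_rate_op:
  assumes "(\<lambda>((s, x), y). h s x y) \<in> borel_measurable step_space"
  shows "(\<lambda>(s, x). rate_op h s x) \<in> borel_measurable (pos_time \<Otimes>\<^sub>M X)"
  unfolding rate_op_def by (rule measurable_kernel_integral[OF measurable_jump_integral[OF assms]])

lemma measurable_total_jump: "(\<lambda>(x, b). emeasure (jump_kernel x b) (space X)) \<in> borel_measurable (X \<Otimes>\<^sub>M A)"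
  by (rule emeasure_jump_kernel_measurable) simp

lemma measurable_rate [measurable]: "(\<lambda>(s, x). rate s x) \<in> borel_measurable (pos_time \<Otimes>\<^sub>M X)"
proof -
  have "(\<lambda>u. (snd (fst u), snd u)) \<in> measurable ((pos_time \<Otimes>\<^sub>M X) \<Otimes>\<^sub>M A) (X \<Otimes>\<^sub>M A)"
    by (intro measurable_Pair measurable_snd measurable_compose[OF measurable_fst measurable_snd])
  from measurable_compose[OF this measurable_total_jump] show ?thesis
    unfolding rate_def by (intro measurable_kernel_integral) (simp add: case_prod_unfold)
qed

lemma rate_op_const:
  assumes "x \<in> space X" "0 < s"
  shows "rate_op (\<lambda>s x y. g s x) s x = g s x * rate s x"
proof -
  have "(\<lambda>b. emeasure (jump_kernel x b) (space X)) \<in> borel_measurable A"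
    using measurable_Pair2[OF measurable_total_jump assms(1)] by simp
  then have "(\<lambda>b. emeasure (jump_kernel x b) (space X)) \<in> borel_measurable (\<kappa> x s)"
    using sets_kernel_at[OF assms] by (simp cong: measurable_cong_sets)
  then show ?thesis
    by (simp add: rate_op_def rate_def nn_integral_cmult)
qed

lemma rate_le_constant:
  assumes x: "x \<in> space X"
  obtains M where "\<And>s. 0 < s \<Longrightarrow> rate s x \<le> ennreal M"
proof -
  have le: "ereal (q x b (space X - {x})) \<le> max_jump_rate X D q x" if "b \<in> D x" for b
    using that by (auto simp: max_jump_rate_def intro: SUP_upper)
  obtain b where "b \<in> D x" using D_nonempty[OF x] by auto
  with le[of b] rate_finite[OF x] obtain M where M: "max_jump_rate X D q x = ereal M"
    by (cases "max_jump_rate X D q x") auto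
  have jk: "emeasure (jump_kernel x b) (space X) \<le> ennreal M" for b
    using le[of b] x by (auto simp: emeasure_jump_kernel M intro: ennreal_leI)
  have "rate s x \<le> ennreal M" if "0 < s" for s
  proof -
    interpret prob_space "\<kappa> x s" by (rule prob_space_kernel_at[OF x that])
    have "rate s x \<le> (\<integral>\<^sup>+b. ennreal M \<partial>\<kappa> x s)"
      unfolding rate_def by (intro nn_integral_mono jk)
    then show ?thesis by (simp add: emeasure_space_1)
  qed
  then show ?thesis by (rule that)
qed

lemma measurable_rate_at:
  assumes "x \<in> space X"
  shows "(\<lambda>s. rate s x) \<in> borel_measurable pos_lborel"
  using measurable_compose[OF measurable_Pair2'[OF assms] measurable_rate]
  by (simp cong: measurable_cong_sets add: sets_pos_lborel)

text \<open>The probability that, under the rates \<open>rate\<close>, no jump occurs from the state \<open>x\<close> in \<open>(s, t]\<close>.\<close>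

definition survival :: "real \<Rightarrow> real \<Rightarrow> 'x \<Rightarrow> ennreal" where
  "survival t s x = ennreal (exp (- enn2real (\<integral>\<^sup>+v\<in>{s<..t}. rate v x \<partial>pos_lborel)))"

lemma survival_self [simp]: "survival t t x = 1"
  by (simp add: survival_def)

lemma survival_le_1: "survival t s x \<le> 1"
  by (simp add: survival_def)

lemma measurable_survival: "(\<lambda>(s, x). survival t s x) \<in> borel_measurable (borel \<Otimes>\<^sub>M X)"
proof -
  interpret T: sigma_finite_measure pos_lborel by (rule sigma_finite_pos_lborel)
  have "(\<lambda>u. (snd u, snd (fst u))) \<in> measurable ((borel \<Otimes>\<^sub>M X) \<Otimes>\<^sub>M pos_time) (pos_time \<Otimes>\<^sub>M X)"
    by (intro measurable_Pair measurable_snd measurable_compose[OF measurable_fst measurable_snd])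
  from measurable_compose[OF this measurable_rate]
  have [measurable]: "(\<lambda>u. rate (snd u) (snd (fst u))) \<in> borel_measurable ((borel \<Otimes>\<^sub>M X) \<Otimes>\<^sub>M pos_time)"
    by simp
  have [measurable]: "(\<lambda>u. fst (fst u)) \<in> borel_measurable ((borel \<Otimes>\<^sub>M X) \<Otimes>\<^sub>M pos_time)"
    by (rule measurable_compose[OF measurable_fst measurable_fst])
  have [measurable]: "(\<lambda>u. snd u) \<in> borel_measurable ((borel \<Otimes>\<^sub>M X) \<Otimes>\<^sub>M pos_time)"
    by (rule measurable_compose[OF measurable_snd measurable_pos_time_real])
  have "(\<lambda>u. if fst (fst u) < snd u \<and> snd u \<le> t then rate (snd u) (snd (fst u)) else 0)
      \<in> borel_measurable ((borel \<Otimes>\<^sub>M X) \<Otimes>\<^sub>M pos_time)"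
    by measurable
  then have "(\<lambda>(w, v). rate v (snd w) * indicator {fst w<..t} v)
      \<in> borel_measurable ((borel \<Otimes>\<^sub>M X) \<Otimes>\<^sub>M pos_time)"
    by (rule measurable_cong[THEN iffD1, rotated]) (auto split: split_indicator)
  then have "(\<lambda>(w, v). rate v (snd w) * indicator {fst w<..t} v)
      \<in> borel_measurable ((borel \<Otimes>\<^sub>M X) \<Otimes>\<^sub>M pos_lborel)"
    by (simp cong: measurable_cong_sets sets_pair_measure_cong add: sets_pair_measure_cong[OF refl sets_pos_lborel])
  from T.borel_measurable_nn_integral[OF this] show ?thesis
    by (simp add: survival_def case_prod_unfold)
qed

lemma survival_equation:
  assumes x: "x \<in> space X" and ab: "0 \<le> a" "a \<le> b" "b \<le> t"
  shows "survival t a x + (\<integral>\<^sup>+s\<in>{a<..b}. rate s x * survival t s x \<partial>pos_lborel) = survival t b x"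
proof -
  obtain M where M: "\<And>s. 0 < s \<Longrightarrow> rate s x \<le> ennreal M" using rate_le_constant[OF x] by blast
  show ?thesis
    unfolding survival_def by (rule exp_integral_equation[OF measurable_rate_at[OF x] M ab])
qed

end

section \<open>The forward equation\<close>

text \<open>A controlled process and a transition probability \<open>\<kappa>\<close>. No relation between the policy and \<open>\<kappa>\<close> is
assumed here; it is expressed by \<open>conditional_action\<close> below.\<close>

locale kernel_process = controlled_process X A D q \<gamma> \<pi> P + markov_rates X A D q \<kappa>
  for X :: "'x measure" and A :: "'a measure" and D q \<gamma> \<pi> P \<kappa>
begin

text \<open>The expectation of \<open>f\<close> at the state occupied at time \<open>t\<close>, on the event that this state exists
  and that the number of past jumps lies in \<open>J\<close>.\<close>

definition expect_on :: "nat set \<Rightarrow> real \<Rightarrow> ('x \<Rightarrow> ennreal) \<Rightarrow> ennreal" where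
  "expect_on J t f = (\<integral>\<^sup>+\<omega>. case_option 0 f (state_on J \<omega> t) \<partial>P)"

text \<open>At all times, \<open>\<kappa>\<close> is a conditional law of the action given the state, on the event that the
  number of past jumps lies in \<open>J\<close>.\<close>

definition conditional_action :: "nat set \<Rightarrow> bool" where
  "conditional_action J \<longleftrightarrow> (\<forall>t>0. \<forall>H\<in>borel_measurable (X \<Otimes>\<^sub>M A).
    (\<integral>\<^sup>+\<omega>. case_option 0 (\<lambda>x. \<integral>\<^sup>+b. H (x, b) \<partial>act \<omega> t) (state_on J \<omega> t) \<partial>P) =
    expect_on J t (\<lambda>x. \<integral>\<^sup>+b. H (x, b) \<partial>\<kappa> x t))"

lemma measurable_expect_integrand:
  assumes f: "(\<lambda>(s, x). f s x) \<in> borel_measurable (pos_time \<Otimes>\<^sub>M X)"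
  shows "(\<lambda>w. case_option (0::ennreal) (f (snd w)) (state_on J (fst w) (snd w)))
    \<in> borel_measurable traj_time"
proof (rule borel_measurable_case_option[OF measurable_state_on_pair])
  have "(\<lambda>v. (snd (fst v), snd v)) \<in> measurable (traj_time \<Otimes>\<^sub>M X) (pos_time \<Otimes>\<^sub>M X)"
    by (intro measurable_Pair measurable_snd measurable_compose[OF measurable_fst measurable_snd])
  from measurable_compose[OF this f]
  show "(\<lambda>(w, x). f (snd w) x) \<in> borel_measurable (traj_time \<Otimes>\<^sub>M X)"
    by (simp add: case_prod_unfold)
qed

lemma measurable_expect_at:
  assumes f: "f \<in> borel_measurable X"
  shows "(\<lambda>\<omega>. case_option (0::ennreal) f (state_on J \<omega> t)) \<in> borel_measurable P"
proof (intro borel_measurable_P borel_measurable_case_option[OF measurable_state_on_at])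
  show "(\<lambda>(w, x). f x) \<in> borel_measurable (trajectories X \<Otimes>\<^sub>M X)"
    using measurable_compose[OF measurable_snd f] by (simp add: case_prod_unfold)
qed

lemma expect_on_mono:
  "(\<And>x. x \<in> space X \<Longrightarrow> f x \<le> g x) \<Longrightarrow> expect_on J t f \<le> expect_on J t g"
  unfolding expect_on_def
  by (intro nn_integral_mono) (auto split: option.split dest: state_on_SomeD)

lemma expect_on_cong:
  "(\<And>x. x \<in> space X \<Longrightarrow> f x = g x) \<Longrightarrow> expect_on J t f = expect_on J t g"
  by (intro antisym expect_on_mono) auto

lemma expect_on_SUP:
  assumes "\<And>i. f i \<in> borel_measurable X" "\<And>i j x. i \<le> j \<Longrightarrow> f i x \<le> f j x"
  shows "expect_on J t (\<lambda>x. SUP i::nat. f i x) = (SUP i. expect_on J t (f i))"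
proof -
  have "expect_on J t (\<lambda>x. SUP i::nat. f i x) =
      (\<integral>\<^sup>+\<omega>. (SUP i. case_option 0 (f i) (state_on J \<omega> t)) \<partial>P)"
    unfolding expect_on_def by (intro nn_integral_cong) (simp split: option.split)
  also have "\<dots> = (SUP i. expect_on J t (f i))"
    unfolding expect_on_def using assms measurable_expect_at[OF assms(1)]
    by (intro nn_integral_monotone_convergence_SUP) (auto simp: incseq_def le_fun_def split: option.split)
  finally show ?thesis .
qed

text \<open>Expected sums over jumps depend on the policy only through the conditional law of the action.\<close>

lemma jump_formula:
  assumes h: "(\<lambda>((s, x), y). h s x y) \<in> borel_measurable step_space"
    and J: "conditional_action J"
  shows "(\<integral>\<^sup>+\<omega>. jump_sum J h \<omega> \<partial>P) =
    (\<integral>\<^sup>+s. expect_on J s (rate_op h s) \<partial>pos_lborel)"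
proof -
  let ?f = "\<lambda>\<omega> s. case_option (0::ennreal) (\<lambda>x. \<integral>\<^sup>+b. (\<integral>\<^sup>+y. h s x y \<partial>jump_kernel x b) \<partial>act \<omega> s) (state_on J \<omega> s)"
  have "(\<lambda>u. ((snd (fst (fst u)), snd (fst u)), snd u))
      \<in> measurable ((traj_time \<Otimes>\<^sub>M X) \<Otimes>\<^sub>M X) step_space"
    by (intro measurable_Pair measurable_snd measurable_compose[OF measurable_fst measurable_snd]
        measurable_compose[OF measurable_compose[OF measurable_fst measurable_fst] measurable_snd])
  from measurable_compose[OF this h]
  have "(\<lambda>((w, x), y). h (snd w) x y) \<in> borel_measurable ((traj_time \<Otimes>\<^sub>M X) \<Otimes>\<^sub>M X)"
    by (simp add: case_prod_unfold)
  note swap = nn_integral_time_swap[OF measurable_jump_rate_integral[OF this, of J]]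
  have "(\<integral>\<^sup>+\<omega>. ?f \<omega> s \<partial>P) = expect_on J s (rate_op h s)" if s: "0 < s" for s
  proof -
    have "(\<lambda>(x, b). \<integral>\<^sup>+y. h s x y \<partial>jump_kernel x b) \<in> borel_measurable (X \<Otimes>\<^sub>M A)"
    proof -
      have "(\<lambda>v. ((s, fst v), snd v)) \<in> measurable (X \<Otimes>\<^sub>M A) ((pos_time \<Otimes>\<^sub>M X) \<Otimes>\<^sub>M A)"
        using s by (intro measurable_Pair measurable_fst measurable_snd measurable_const) simp
      from measurable_compose[OF this measurable_jump_integral[OF h]] show ?thesis
        by (simp add: case_prod_unfold)
    qed
    then show ?thesis using J s unfolding conditional_action_def
      by (auto simp: rate_op_def[abs_def] dest!: bspec[of _ _ "\<lambda>(x, b). \<integral>\<^sup>+y. h s x y \<partial>jump_kernel x b"])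
  qed
  then have "(\<integral>\<^sup>+s. (\<integral>\<^sup>+\<omega>. ?f \<omega> s \<partial>P) \<partial>pos_lborel) = (\<integral>\<^sup>+s. expect_on J s (rate_op h s) \<partial>pos_lborel)"
    by (intro nn_integral_cong) simp
  then show ?thesis
    unfolding jump_sum_expectation[OF h] using swap by simp
qed

text \<open>The weight \<open>g x * survival t s x\<close> for \<open>s\<close> the epoch of jump \<open>i\<close> and \<open>x\<close> the state after jump \<open>j\<close>;
jump 0 is the start of the process.\<close>

abbreviation weight_at :: "('x \<Rightarrow> ennreal) \<Rightarrow> real \<Rightarrow> 'x traj \<Rightarrow> nat \<Rightarrow> nat \<Rightarrow> ennreal" where
  "weight_at g t \<omega> i j \<equiv>
    case_option 0 (\<lambda>x. g x * survival t (real_of_ereal (jump_time \<omega> i)) x) (jump_state \<omega> j)"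

text \<open>The change of \<open>g x * survival t s x\<close> along one sojourn.\<close>

lemma sojourn_identity:
  assumes \<omega>: "\<omega> \<in> sample_space X" and t: "0 < t"
  shows "(if sojourn \<omega> j t
        then case_option 0 g (jump_state \<omega> j) else 0) +
      (if jump_time \<omega> (Suc j) \<le> ereal t
        then weight_at g t \<omega> (Suc j) j else 0) =
      (if jump_time \<omega> j \<le> ereal t
        then weight_at g t \<omega> j j else 0) +
      (\<integral>\<^sup>+s\<in>{..t}. (if sojourn \<omega> j s
        then case_option 0 (\<lambda>x. g x * survival t s x * rate s x) (jump_state \<omega> j) else 0) \<partial>pos_lborel)"
    (is "?A + ?B = ?C + ?I")
proof (cases "jump_time \<omega> j \<le> ereal t")
  case False
  moreover have "jump_time \<omega> j \<le> jump_time \<omega> (Suc j)" by (rule jump_time_mono[OF \<omega>]) simp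
  ultimately have not_le: "\<not> jump_time \<omega> (Suc j) \<le> ereal t" by auto
  have "\<not> jump_time \<omega> j \<le> ereal s" if "s \<le> t" for s
    using False that by (meson ereal_less_eq(3) order_trans)
  then have "?I = (\<integral>\<^sup>+s. 0 \<partial>pos_lborel)"
    by (intro nn_integral_cong) (auto split: split_indicator)
  then show ?thesis using False not_le by simp
next
  case True
  define a where "a = real_of_ereal (jump_time \<omega> j)"
  define b where "b = (if ereal t < jump_time \<omega> (Suc j) then t else real_of_ereal (jump_time \<omega> (Suc j)))"
  have fin: "jump_time \<omega> j < \<infinity>" using True by (rule le_less_trans) simp
  have a: "jump_time \<omega> j = ereal a" using jump_time_real[OF \<omega> fin] by (simp add: a_def)
  have b_cases: "(ereal t < jump_time \<omega> (Suc j) \<and> b = t) \<or> (jump_time \<omega> (Suc j) = ereal b \<and> b \<le> t)"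
  proof (cases "ereal t < jump_time \<omega> (Suc j)")
    case False
    then have "jump_time \<omega> (Suc j) \<le> ereal t" by simp
    moreover from this have "jump_time \<omega> (Suc j) < \<infinity>" by (rule le_less_trans) simp
    ultimately show ?thesis using jump_time_real[OF \<omega>, of "Suc j"] False
      by (metis b_def ereal_less_eq(3))
  qed (simp add: b_def)
  obtain x where x: "x \<in> space X" "jump_state \<omega> j = Some x" using jump_state_finite[OF \<omega> fin] by blast
  have ab: "0 \<le> a" "a \<le> b" "b \<le> t"
    using jump_time_nonneg[OF \<omega>, of j] jump_time_less[OF \<omega> fin] True b_cases by (auto simp: a)
  have before_next: "ereal s < jump_time \<omega> (Suc j)" if "s \<le> t" "ereal t < jump_time \<omega> (Suc j)" for s
    using that by (intro le_less_trans[OF _ that(2)]) simp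
  have "AE s in lborel. s \<notin> {a, b}"
    by (intro AE_not_in finite_imp_null_set_lborel) simp
  then have "AE s in pos_lborel. s \<notin> {a, b}"
    by (subst AE_restrict_space_iff) (auto elim: eventually_mono)
  then have "?I = (\<integral>\<^sup>+s. g x * (rate s x * survival t s x * indicator {a<..b} s) \<partial>pos_lborel)"
  proof (intro nn_integral_cong_AE, elim AE_mp, intro AE_I2 impI)
    fix s assume "s \<notin> {a, b}"
    then have "jump_time \<omega> j \<le> ereal s \<and> ereal s < jump_time \<omega> (Suc j) \<and> s \<le> t \<longleftrightarrow> s \<in> {a<..b}"
      using b_cases ab(3) before_next[of s] by (auto simp: a)
    then show "(if sojourn \<omega> j s
        then case_option 0 (\<lambda>x. g x * survival t s x * rate s x) (jump_state \<omega> j) else 0) * indicator {..t} s =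
        g x * (rate s x * survival t s x * indicator {a<..b} s)"
      by (auto simp: x mult_ac split: split_indicator)
  qed
  also have "\<dots> = g x * (\<integral>\<^sup>+s\<in>{a<..b}. rate s x * survival t s x \<partial>pos_lborel)"
  proof (rule nn_integral_cmult)
    have "(\<lambda>s. survival t s x) \<in> borel_measurable borel"
      using measurable_compose[OF measurable_Pair2'[OF x(1)] measurable_survival[of t]] by simp
    then have "(\<lambda>s. survival t s x) \<in> borel_measurable pos_lborel"
      by (intro measurable_restrict_space1) (simp cong: measurable_cong_sets)
    moreover have "{a<..b} \<in> sets pos_lborel" using ab by (auto simp: sets_restrict_space_iff)
    ultimately show "(\<lambda>s. rate s x * survival t s x * indicator {a<..b} s) \<in> borel_measurable pos_lborel"
      using measurable_rate_at[OF x(1)] by measurable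
  qed
  finally have "?C + ?I = g x * survival t b x"
    using survival_equation[OF x(1) ab] True
    by (simp add: x a distrib_left[symmetric])
  moreover have "?A + ?B = g x * survival t b x"
    using b_cases True by (auto simp: x)
  ultimately show ?thesis by simp
qed

text \<open>The sum of the previous identity over the sojourns. It needs no assumption of non-explosion, since
the first term vanishes after the explosion time.\<close>

lemma path_identity:
  assumes \<omega>: "\<omega> \<in> sample_space X" and t: "0 < t"
  shows "case_option 0 g (state_on J \<omega> t) +
      (\<Sum>j. if j \<in> J \<and> jump_time \<omega> (Suc j) \<le> ereal t
        then weight_at g t \<omega> (Suc j) j else 0) =
      (\<Sum>j. if j \<in> J \<and> jump_time \<omega> j \<le> ereal t
        then weight_at g t \<omega> j j else 0) +
      (\<integral>\<^sup>+s\<in>{..t}. case_option 0 (\<lambda>x. g x * survival t s x * rate s x) (state_on J \<omega> s) \<partial>pos_lborel)"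
proof -
  let ?B = "\<lambda>j. if j \<in> J \<and> jump_time \<omega> (Suc j) \<le> ereal t
        then weight_at g t \<omega> (Suc j) j else 0"
  let ?C = "\<lambda>j. if j \<in> J \<and> jump_time \<omega> j \<le> ereal t
        then weight_at g t \<omega> j j else 0"
  let ?k = "\<lambda>j s. if j \<in> J \<and> sojourn \<omega> j s
        then case_option 0 (\<lambda>x. g x * survival t s x * rate s x) (jump_state \<omega> j) else 0"
  have k_meas: "(\<lambda>s. ?k j s * indicator {..t} s) \<in> borel_measurable pos_lborel" for j
  proof (cases "jump_time \<omega> j < \<infinity>")
    case True
    from jump_state_finite[OF \<omega> True]
    obtain x where x: "x \<in> space X" "jump_state \<omega> j = Some x" by blast
    have [measurable]: "(\<lambda>s. s) \<in> borel_measurable pos_lborel"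
      using measurable_pos_time_real by (simp cong: measurable_cong_sets add: sets_pos_lborel)
    have "(\<lambda>s. survival t s x) \<in> borel_measurable borel"
      using measurable_compose[OF measurable_Pair2'[OF x(1)] measurable_survival[of t]] by simp
    then have [measurable]: "(\<lambda>s. survival t s x) \<in> borel_measurable pos_lborel"
      by (intro measurable_restrict_space1) (simp cong: measurable_cong_sets)
    note [measurable] = measurable_rate_at[OF x(1)]
    have "(\<lambda>s. if jump_time \<omega> j \<le> ereal s \<and> ereal s < jump_time \<omega> (Suc j) \<and> s \<le> t
        then g x * survival t s x * rate s x else 0) \<in> borel_measurable pos_lborel"
      by measurable
    moreover have "?k j s * indicator {..t} s =
        (if j \<in> J then if jump_time \<omega> j \<le> ereal s \<and> ereal s < jump_time \<omega> (Suc j) \<and> s \<le> t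
          then g x * survival t s x * rate s x else 0 else 0)" for s
      by (simp add: x split: split_indicator)
    ultimately show ?thesis by (cases "j \<in> J") simp_all
  next
    case False
    then have "\<not> jump_time \<omega> j \<le> ereal s" for s by auto
    then show ?thesis by simp
  qed
  have "(\<integral>\<^sup>+s\<in>{..t}. case_option 0 (\<lambda>x. g x * survival t s x * rate s x) (state_on J \<omega> s) \<partial>pos_lborel) =
      (\<integral>\<^sup>+s. (\<Sum>j. ?k j s * indicator {..t} s) \<partial>pos_lborel)"
    by (simp only: case_option_state_on[OF \<omega>] ennreal_suminf_multc)
  also have "\<dots> = (\<Sum>j. \<integral>\<^sup>+s\<in>{..t}. ?k j s \<partial>pos_lborel)"
    by (rule nn_integral_suminf[OF k_meas])
  finally have I: "(\<integral>\<^sup>+s\<in>{..t}. case_option 0 (\<lambda>x. g x * survival t s x * rate s x) (state_on J \<omega> s) \<partial>pos_lborel) =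
      (\<Sum>j. \<integral>\<^sup>+s\<in>{..t}. ?k j s \<partial>pos_lborel)" .
  let ?A = "\<lambda>j. if j \<in> J \<and> sojourn \<omega> j t
        then case_option 0 g (jump_state \<omega> j) else 0"
  have "?A j + ?B j = ?C j + (\<integral>\<^sup>+s\<in>{..t}. ?k j s \<partial>pos_lborel)" for j
    using sojourn_identity[OF \<omega> t, of j g] by (cases "j \<in> J") simp_all
  then have "(\<Sum>j. ?A j) + (\<Sum>j. ?B j) = (\<Sum>j. ?C j) + (\<Sum>j. \<integral>\<^sup>+s\<in>{..t}. ?k j s \<partial>pos_lborel)"
    by (simp add: suminf_add)
  then show ?thesis
    unfolding I unfolding case_option_state_on[OF \<omega>, of g] .
qed

lemma ennreal_add_right_cancel_finite:
  fixes a b c :: ennreal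
  shows "a + c = b + c \<Longrightarrow> c \<noteq> \<top> \<Longrightarrow> a = b"
  using ennreal_add_left_cancel[of c a b] by (simp add: add.commute)

text \<open>The weights \<open>g x * survival t s x\<close> of the states left at the jumps have the same expected sum as
  the growth of the weight during the sojourns; for \<open>g\<close> as below both are finite and cancel. With
  \<open>J = J' = UNIV\<close> the equation concerns the whole process; with \<open>J = {..<Suc n}\<close> and \<open>J' = {..<n}\<close> it
  expresses the event of at most \<open>n\<close> jumps through that of fewer than \<open>n\<close> jumps.\<close>

lemma forward_equation:
  assumes t: "0 < t" and J: "J = insert 0 (Suc ` J')"
    and cond: "conditional_action J" "conditional_action J'"
    and g: "g \<in> borel_measurable X" "\<And>x. g x \<le> ennreal B"
    and supp: "\<And>x. x \<in> space X \<Longrightarrow> g x \<noteq> 0 \<Longrightarrow> AE v in pos_lborel. v \<le> t \<longrightarrow> rate v x \<le> ennreal m"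
  shows "expect_on J t g = (\<integral>\<^sup>+x. g x * survival t 0 x \<partial>\<gamma>) +
    (\<integral>\<^sup>+s. expect_on J' s (rate_op (\<lambda>s x y. if s \<le> t then g y * survival t s y else 0) s) \<partial>pos_lborel)"
proof -
  let ?F = "\<lambda>s x. if s \<le> t then g x * survival t s x else 0"
  let ?i = "\<lambda>\<omega> s. case_option (0::ennreal) (\<lambda>x. ?F s x * rate s x) (state_on J \<omega> s)"
  let ?B = "\<lambda>\<omega>. \<Sum>j. if j \<in> J \<and> jump_time \<omega> (Suc j) < \<infinity>
        then ?F (real_of_ereal (jump_time \<omega> (Suc j))) (the (jump_state \<omega> j)) else 0"
  let ?C' = "\<lambda>\<omega>. \<Sum>j. if j \<in> J' \<and> jump_time \<omega> (Suc j) < \<infinity>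
        then ?F (real_of_ereal (jump_time \<omega> (Suc j))) (the (jump_state \<omega> (Suc j))) else 0"
  have F_borel: "(\<lambda>(s, x). ?F s x) \<in> borel_measurable (borel \<Otimes>\<^sub>M X)"
  proof -
    have [measurable]: "(\<lambda>w. survival t (fst w) (snd w)) \<in> borel_measurable (borel \<Otimes>\<^sub>M X)"
      using measurable_survival[of t] by (simp add: case_prod_unfold)
    have [measurable]: "(\<lambda>w. g (snd w)) \<in> borel_measurable (borel \<Otimes>\<^sub>M X)"
      by (rule measurable_compose[OF measurable_snd g(1)])
    have "(\<lambda>w. if fst w \<le> t then g (snd w) * survival t (fst w) (snd w) else 0) \<in> borel_measurable (borel \<Otimes>\<^sub>M X)"
      by measurable
    then show ?thesis by (simp add: case_prod_unfold)
  qed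
  have F: "(\<lambda>(s, x). ?F s x) \<in> borel_measurable (pos_time \<Otimes>\<^sub>M X)"
  proof -
    have "(\<lambda>w. (fst w, snd w)) \<in> measurable (pos_time \<Otimes>\<^sub>M X) (borel \<Otimes>\<^sub>M X)"
      by (intro measurable_Pair measurable_snd measurable_compose[OF measurable_fst measurable_pos_time_real])
    from measurable_compose[OF this F_borel] show ?thesis by (simp add: case_prod_unfold)
  qed
  have hx: "(\<lambda>((s, x), y). ?F s x) \<in> borel_measurable step_space"
    using measurable_compose[OF measurable_fst F] by (simp add: case_prod_unfold)
  have hy: "(\<lambda>((s, x), y). ?F s y) \<in> borel_measurable step_space"
  proof -
    have "(\<lambda>v. (fst (fst v), snd v)) \<in> measurable step_space (pos_time \<Otimes>\<^sub>M X)"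
      by (intro measurable_Pair measurable_snd measurable_compose[OF measurable_fst measurable_fst])
    from measurable_compose[OF this F] show ?thesis
      by (simp only: case_prod_unfold fst_conv snd_conv)
  qed
  have i_meas: "(\<lambda>w. ?i (fst w) (snd w)) \<in> borel_measurable traj_time"
    using measurable_expect_integrand[of "\<lambda>s x. ?F s x * rate s x" J]
      borel_measurable_times_ennreal[OF F[unfolded case_prod_unfold] measurable_rate[unfolded case_prod_unfold]]
    by (simp add: case_prod_unfold)
  have I: "(\<integral>\<^sup>+\<omega>. ?B \<omega> \<partial>P) = (\<integral>\<^sup>+\<omega>. (\<integral>\<^sup>+s. ?i \<omega> s \<partial>pos_lborel) \<partial>P)"
    unfolding jump_formula[OF hx cond(1)] nn_integral_time_swap[OF i_meas]
    unfolding expect_on_def[symmetric]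
    by (intro nn_integral_cong expect_on_cong) (simp add: rate_op_const)
  have I_le: "(\<integral>\<^sup>+s. ?i \<omega> s \<partial>pos_lborel) \<le> ennreal B * ennreal m * ennreal t" if \<omega>: "\<omega> \<in> sample_space X" for \<omega>
  proof -
    have "AE s in pos_lborel. \<forall>j. \<forall>x\<in>space X. jump_state \<omega> j = Some x \<longrightarrow> g x \<noteq> 0 \<longrightarrow> s \<le> t \<longrightarrow> rate s x \<le> ennreal m"
    proof (subst AE_all_countable, intro allI)
      fix j
      show "AE s in pos_lborel. \<forall>x\<in>space X. jump_state \<omega> j = Some x \<longrightarrow> g x \<noteq> 0 \<longrightarrow> s \<le> t \<longrightarrow> rate s x \<le> ennreal m"
      proof (cases "\<exists>x\<in>space X. jump_state \<omega> j = Some x \<and> g x \<noteq> 0")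
        case True
        then obtain x where "x \<in> space X" "jump_state \<omega> j = Some x" "g x \<noteq> 0" by blast
        with supp[of x] show ?thesis by (auto elim!: eventually_mono)
      qed auto
    qed
    then have "(\<integral>\<^sup>+s. ?i \<omega> s \<partial>pos_lborel) \<le> (\<integral>\<^sup>+s. ennreal B * ennreal m * indicator {0<..t} s \<partial>pos_lborel)"
    proof (intro nn_integral_mono_AE, elim AE_mp, intro AE_I2 impI)
      fix s assume s: "s \<in> space pos_lborel"
        and le: "\<forall>j. \<forall>x\<in>space X. jump_state \<omega> j = Some x \<longrightarrow> g x \<noteq> 0 \<longrightarrow> s \<le> t \<longrightarrow> rate s x \<le> ennreal m"
      show "?i \<omega> s \<le> ennreal B * ennreal m * indicator {0<..t} s"
      proof (cases "state_on J \<omega> s")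
        case (Some x)
        then have "state \<omega> s = Some x" using state_on_SomeD[OF \<omega>] by blast
        then obtain n where n: "jump_state \<omega> n = Some x" "x \<in> space X" by (rule state_SomeD[OF \<omega>])
        have "g x * survival t s x * rate s x \<le> ennreal B * ennreal m" if "s \<le> t"
        proof (cases "g x = 0")
          case False
          have "g x * survival t s x * rate s x \<le> ennreal B * 1 * ennreal m"
            using le n False that g(2)[of x] survival_le_1[of t s x] by (intro mult_mono) auto
          then show ?thesis by simp
        qed simp
        then show ?thesis using s by (auto simp: Some split: split_indicator)
      qed simp
    qed
    also have "\<dots> = ennreal B * ennreal m * emeasure pos_lborel {0<..t}"
      by (intro nn_integral_cmult_indicator) (auto simp: sets_restrict_space_iff)
    also have "emeasure pos_lborel {0<..t} = ennreal t"
      using t by (subst emeasure_restrict_space) auto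
    finally show ?thesis .
  qed
  have "(\<integral>\<^sup>+\<omega>. (\<integral>\<^sup>+s. ?i \<omega> s \<partial>pos_lborel) \<partial>P) \<le> (\<integral>\<^sup>+\<omega>. ennreal B * ennreal m * ennreal t \<partial>P)"
    using I_le by (intro nn_integral_mono) simp
  also have "\<dots> < \<top>"
    by (simp add: emeasure_space_1[unfolded space_P] ennreal_mult_less_top)
  finally have fin: "(\<integral>\<^sup>+\<omega>. (\<integral>\<^sup>+s. ?i \<omega> s \<partial>pos_lborel) \<partial>P) \<noteq> \<top>" by simp
  have path: "case_option 0 g (state_on J \<omega> t) + ?B \<omega> =
      (g (fst \<omega>) * survival t 0 (fst \<omega>) + ?C' \<omega>) + (\<integral>\<^sup>+s. ?i \<omega> s \<partial>pos_lborel)"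
    if \<omega>: "\<omega> \<in> sample_space X" for \<omega>
  proof -
    have real_le: "real_of_ereal (jump_time \<omega> j) \<le> t \<longleftrightarrow> jump_time \<omega> j \<le> ereal t" if "jump_time \<omega> j < \<infinity>" for j
      using jump_time_real[OF \<omega> that] by (metis ereal_less_eq(3))
    have le_fin: "jump_time \<omega> j < \<infinity>" if "jump_time \<omega> j \<le> ereal t" for j
      using that by (rule le_less_trans) simp
    have fin_pred: "jump_time \<omega> j < \<infinity>" if "jump_time \<omega> (Suc j) < \<infinity>" for j
      using jump_time_mono[OF \<omega>, of j "Suc j"] that by (auto intro: le_less_trans)
    have some: "jump_state \<omega> j = Some (the (jump_state \<omega> j))" if "jump_time \<omega> j < \<infinity>" for j
      using jump_state_finite[OF \<omega> that] by auto
    have B_eq: "(\<Sum>j. if j \<in> J \<and> jump_time \<omega> (Suc j) \<le> ereal t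
        then weight_at g t \<omega> (Suc j) j else 0) = ?B \<omega>"
    proof (rule suminf_cong)
      fix j
      show "(if j \<in> J \<and> jump_time \<omega> (Suc j) \<le> ereal t
        then weight_at g t \<omega> (Suc j) j else 0) =
        (if j \<in> J \<and> jump_time \<omega> (Suc j) < \<infinity>
        then ?F (real_of_ereal (jump_time \<omega> (Suc j))) (the (jump_state \<omega> j)) else 0)"
        using real_le[of "Suc j"] le_fin[of "Suc j"] fin_pred[of j] some[of j]
        by (cases "jump_state \<omega> j") auto
    qed
    let ?c = "\<lambda>j. if j \<in> J \<and> jump_time \<omega> j \<le> ereal t
        then weight_at g t \<omega> j j else 0"
    \<comment> \<open>The term \<open>j = 0\<close> is the initial weight; the others are the weights entered at the jumps.\<close>
    have "(\<Sum>j. ?c j) = (\<Sum>j. ?c (j + 1)) + (\<Sum>j<1. ?c j)"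
      by (rule suminf_offset) simp
    also have "(\<Sum>j<1. ?c j) = g (fst \<omega>) * survival t 0 (fst \<omega>)"
      using t by (simp add: J)
    also have "(\<Sum>j. ?c (j + 1)) = ?C' \<omega>"
    proof (rule suminf_cong)
      fix j
      have "Suc j \<in> J \<longleftrightarrow> j \<in> J'" by (auto simp: J)
      then show "?c (j + 1) = (if j \<in> J' \<and> jump_time \<omega> (Suc j) < \<infinity>
        then ?F (real_of_ereal (jump_time \<omega> (Suc j))) (the (jump_state \<omega> (Suc j))) else 0)"
        using real_le[of "Suc j"] le_fin[of "Suc j"] some[of "Suc j"]
        by (cases "jump_state \<omega> (Suc j)") auto
    qed
    finally have C_eq: "(\<Sum>j. ?c j) = g (fst \<omega>) * survival t 0 (fst \<omega>) + ?C' \<omega>"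
      by (simp only: add.commute)
    have "(\<integral>\<^sup>+s\<in>{..t}. case_option 0 (\<lambda>x. g x * survival t s x * rate s x) (state_on J \<omega> s) \<partial>pos_lborel) =
        (\<integral>\<^sup>+s. ?i \<omega> s \<partial>pos_lborel)"
      by (intro nn_integral_cong) (auto split: option.split split_indicator)
    then show ?thesis
      using path_identity[OF \<omega> t, of g J] by (simp only: B_eq C_eq)
  qed
  have term_meas: "(\<lambda>\<omega>. if j \<in> K \<and> jump_time \<omega> (Suc j) < \<infinity>
      then ?F (real_of_ereal (jump_time \<omega> (Suc j))) (the (jump_state \<omega> k)) else 0) \<in> borel_measurable P"
    if k: "k \<le> Suc j" for j k K
  proof (rule borel_measurable_P)
    have "(\<lambda>v. (real_of_ereal (jump_time (fst v) (Suc j)), snd v))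
        \<in> measurable (trajectories X \<Otimes>\<^sub>M X) (borel \<Otimes>\<^sub>M X)"
      by (intro measurable_Pair measurable_snd borel_measurable_real_of_ereal
          measurable_compose[OF measurable_fst measurable_jump_time])
    from measurable_compose[OF this F_borel]
    have [measurable]: "(\<lambda>\<omega>. case_option (0::ennreal) (\<lambda>x. ?F (real_of_ereal (jump_time \<omega> (Suc j))) x) (jump_state \<omega> k))
        \<in> borel_measurable (trajectories X)"
      by (intro borel_measurable_case_option[OF measurable_jump_state])
        (simp only: case_prod_unfold fst_conv snd_conv)
    have "(\<lambda>\<omega>. if j \<in> K \<and> jump_time \<omega> (Suc j) < \<infinity>
        then case_option (0::ennreal) (\<lambda>x. ?F (real_of_ereal (jump_time \<omega> (Suc j))) x) (jump_state \<omega> k) else 0)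
        \<in> borel_measurable (trajectories X)"
      by measurable
    then show "(\<lambda>\<omega>. if j \<in> K \<and> jump_time \<omega> (Suc j) < \<infinity>
      then ?F (real_of_ereal (jump_time \<omega> (Suc j))) (the (jump_state \<omega> k)) else 0)
        \<in> borel_measurable (trajectories X)"
    proof (rule measurable_cong[THEN iffD1, rotated])
      fix \<omega> assume "\<omega> \<in> space (trajectories X)"
      then have \<omega>: "\<omega> \<in> sample_space X" by simp
      have "jump_state \<omega> k \<noteq> None" if "jump_time \<omega> (Suc j) < \<infinity>"
        using jump_state_finite[OF \<omega> le_less_trans[OF jump_time_mono[OF \<omega> k] that]] by auto
      then show "(if j \<in> K \<and> jump_time \<omega> (Suc j) < \<infinity>
        then case_option (0::ennreal) (\<lambda>x. ?F (real_of_ereal (jump_time \<omega> (Suc j))) x) (jump_state \<omega> k) else 0) =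
        (if j \<in> K \<and> jump_time \<omega> (Suc j) < \<infinity>
        then ?F (real_of_ereal (jump_time \<omega> (Suc j))) (the (jump_state \<omega> k)) else 0)"
        by (cases "jump_state \<omega> k") auto
    qed
  qed
  have B_meas: "?B \<in> borel_measurable P"
    by (rule borel_measurable_suminf_order) (rule term_meas, simp)
  have C_meas: "?C' \<in> borel_measurable P"
    by (rule borel_measurable_suminf_order) (rule term_meas, simp)
  have fst_meas: "fst \<in> measurable P X"
    unfolding measurable_cong_sets[OF sets_P refl] trajectories_def
    by (rule measurable_restrict_space1) simp
  have F0: "(\<lambda>x. g x * survival t 0 x) \<in> borel_measurable X"
    using measurable_compose[OF measurable_Pair1'[of 0 borel X] F_borel] t by simp
  have F0_meas: "(\<lambda>\<omega>. g (fst \<omega>) * survival t 0 (fst \<omega>)) \<in> borel_measurable P"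
    by (rule measurable_compose[OF fst_meas F0])
  have I_meas: "(\<lambda>\<omega>. \<integral>\<^sup>+s. ?i \<omega> s \<partial>pos_lborel) \<in> borel_measurable P"
  proof -
    interpret T: sigma_finite_measure pos_lborel by (rule sigma_finite_pos_lborel)
    show ?thesis
      using borel_measurable_P_pos[OF i_meas] by (intro T.borel_measurable_nn_integral) (simp add: case_prod_unfold)
  qed
  have "(\<integral>\<^sup>+\<omega>. case_option 0 g (state_on J \<omega> t) + ?B \<omega> \<partial>P) =
      (\<integral>\<^sup>+\<omega>. (g (fst \<omega>) * survival t 0 (fst \<omega>) + ?C' \<omega>) + (\<integral>\<^sup>+s. ?i \<omega> s \<partial>pos_lborel) \<partial>P)"
    by (intro nn_integral_cong path) simp
  then have "expect_on J t g + (\<integral>\<^sup>+\<omega>. ?B \<omega> \<partial>P) =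
      ((\<integral>\<^sup>+\<omega>. g (fst \<omega>) * survival t 0 (fst \<omega>) \<partial>P) + (\<integral>\<^sup>+\<omega>. ?C' \<omega> \<partial>P)) +
      (\<integral>\<^sup>+\<omega>. (\<integral>\<^sup>+s. ?i \<omega> s \<partial>pos_lborel) \<partial>P)"
    unfolding expect_on_def
    by (simp only: nn_integral_add measurable_expect_at[OF g(1)] B_meas C_meas F0_meas I_meas
        borel_measurable_add)
  then have "expect_on J t g = (\<integral>\<^sup>+\<omega>. g (fst \<omega>) * survival t 0 (fst \<omega>) \<partial>P) + (\<integral>\<^sup>+\<omega>. ?C' \<omega> \<partial>P)"
    unfolding I by (rule ennreal_add_right_cancel_finite[OF _ fin])
  moreover have "(\<integral>\<^sup>+\<omega>. g (fst \<omega>) * survival t 0 (fst \<omega>) \<partial>P) = (\<integral>\<^sup>+x. g x * survival t 0 x \<partial>\<gamma>)"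
    unfolding initial_law[symmetric] by (rule nn_integral_distr[OF fst_meas, symmetric]) (use F0 in simp)
  ultimately show ?thesis
    using jump_formula[OF hy cond(2)] by simp
qed

end

section \<open>Conditional laws of the actions\<close>

lemma state_left_on_UNIV [simp]: "state_left_on UNIV \<omega> s = state_left \<omega> s"
  by (auto simp: state_left_on_def state_left_def)

context kernel_process
begin

text \<open>A Markov policy acts on the left limit of the state, which at a fixed time is almost surely the
state itself.\<close>

lemma conditional_action_markov:
  assumes markov: "markov_policy X A D \<pi> \<kappa>"
  shows "conditional_action J"
  unfolding conditional_action_def expect_on_def
proof (intro allI impI ballI nn_integral_cong_AE)
  fix t :: real and H :: "'x \<times> 'a \<Rightarrow> ennreal"
  assume t: "0 < t"
  show "AE \<omega> in P. case_option 0 (\<lambda>x. \<integral>\<^sup>+b. H (x, b) \<partial>act \<omega> t) (state_on J \<omega> t) =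
      case_option 0 (\<lambda>x. \<integral>\<^sup>+b. H (x, b) \<partial>\<kappa> x t) (state_on J \<omega> t)"
  proof (rule AE_mp[OF AE_no_jump_at[OF t]], intro AE_I2 impI)
    fix \<omega> assume "\<omega> \<in> space P" and no_jump: "\<forall>j. jump_time \<omega> (Suc j) \<noteq> ereal t"
    then have \<omega>: "\<omega> \<in> sample_space X" by simp
    show "case_option 0 (\<lambda>x. \<integral>\<^sup>+b. H (x, b) \<partial>act \<omega> t) (state_on J \<omega> t) =
        case_option 0 (\<lambda>x. \<integral>\<^sup>+b. H (x, b) \<partial>\<kappa> x t) (state_on J \<omega> t)"
    proof (cases "state_on J \<omega> t")
      case (Some x)
      then have x: "state \<omega> t = Some x" "x \<in> space X" using state_on_SomeD[OF \<omega>] by blast+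
      then have "state_left \<omega> t = Some x"
        using state_left_on_eq_state_on[OF t _ \<omega>, of UNIV] no_jump by simp
      then have "\<pi> \<omega> t = distr (\<kappa> x t) (adjoin_point A) Some"
        using markov \<omega> t state_Some_less_explosion[OF \<omega> x(1)] by (simp add: markov_policy_def)
      then have "act \<omega> t = \<kappa> x t"
        using action_part_distr_Some[OF sets_kernel_at[OF x(2) t]] by (simp add: act_def)
      then show ?thesis by (simp add: Some)
    qed simp
  qed
qed

text \<open>An identity between the state-action marginals on rectangles determines the joint law of the
  state and the action at each time.\<close>

lemma conditional_action_from_marginals:
  assumes marginals: "\<And>t Z B. 0 < t \<Longrightarrow> Z \<in> sets X \<Longrightarrow> B \<in> sets A \<Longrightarrow>
      state_action_marginal P \<pi> t (Some ` Z) (Some ` B) =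
      (\<integral>\<^sup>+z\<in>Some ` Z. emeasure (\<kappa> (the z) t) B \<partial>state_marginal X P t)"
  shows "conditional_action UNIV"
  unfolding conditional_action_def expect_on_def
proof (intro allI impI ballI)
  fix t :: real and H :: "'x \<times> 'a \<Rightarrow> ennreal"
  assume t: "0 < t" and H: "H \<in> borel_measurable (X \<Otimes>\<^sub>M A)"
  define joint :: "('x \<Rightarrow> 'a measure) \<Rightarrow> 'x option \<Rightarrow> ('x \<times> 'a) measure" where
    "joint p z = (case z of None \<Rightarrow> null_measure (X \<Otimes>\<^sub>M A) | Some x \<Rightarrow> distr (p x) (X \<Otimes>\<^sub>M A) (Pair x))" for p z
  have joint_int: "(\<integral>\<^sup>+w. f w \<partial>joint p z) = case_option 0 (\<lambda>x. \<integral>\<^sup>+b. f (x, b) \<partial>p x) z"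
    if f: "f \<in> borel_measurable (X \<Otimes>\<^sub>M A)" and z: "\<And>x. z = Some x \<Longrightarrow> x \<in> space X \<and> sets (p x) = sets A"
    for f :: "'x \<times> 'a \<Rightarrow> ennreal" and p z
  proof (cases z)
    case None
    then show ?thesis by (simp add: joint_def)
  next
    case (Some x)
    then have "Pair x \<in> measurable (p x) (X \<Otimes>\<^sub>M A)"
      using z[of x] measurable_Pair1'[of x X A] by (simp cong: measurable_cong_sets)
    then show ?thesis using f by (simp add: joint_def Some nn_integral_distr)
  qed
  have act_z: "x \<in> space X \<and> sets (act \<omega> t) = sets A" if "\<omega> \<in> space P" "state \<omega> t = Some x" for \<omega> x
    using that state_on_SomeD[of \<omega> X UNIV t x] by simp
  have \<kappa>_z: "x \<in> space X \<and> sets (\<kappa> x t) = sets A" if "\<omega> \<in> space P" "state \<omega> t = Some x" for \<omega> x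
    using act_z[OF that] sets_kernel_at t by blast
  have m1: "(\<lambda>\<omega>. case_option 0 (\<lambda>x. \<integral>\<^sup>+b. f (x, b) \<partial>act \<omega> t) (state \<omega> t)) \<in> borel_measurable P"
    if f: "f \<in> borel_measurable (X \<Otimes>\<^sub>M A)" for f :: "'x \<times> 'a \<Rightarrow> ennreal"
  proof -
    have "(\<lambda>u. (snd (fst u), snd u)) \<in> measurable ((traj_time \<Otimes>\<^sub>M X) \<Otimes>\<^sub>M A) (X \<Otimes>\<^sub>M A)"
      by (intro measurable_Pair measurable_snd measurable_compose[OF measurable_fst measurable_snd])
    from measurable_compose[OF this f]
    have "(\<lambda>((w, x), b). f (x, b)) \<in> borel_measurable ((traj_time \<Otimes>\<^sub>M X) \<Otimes>\<^sub>M A)"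
      by (simp add: case_prod_unfold)
    from measurable_compose[OF measurable_Pair_traj[OF t] measurable_action_integral[OF this, of UNIV]]
    show ?thesis by (intro borel_measurable_P) (simp cong: option.case_cong)
  qed
  have kernel_at: "(\<lambda>x. \<integral>\<^sup>+b. f (x, b) \<partial>\<kappa> x t) \<in> borel_measurable X"
    if f: "f \<in> borel_measurable (X \<Otimes>\<^sub>M A)" for f :: "'x \<times> 'a \<Rightarrow> ennreal"
  proof -
    have "(\<lambda>u. (snd (fst u), snd u)) \<in> measurable ((pos_time \<Otimes>\<^sub>M X) \<Otimes>\<^sub>M A) (X \<Otimes>\<^sub>M A)"
      by (intro measurable_Pair measurable_snd measurable_compose[OF measurable_fst measurable_snd])
    from measurable_compose[OF this f]
    have "(\<lambda>((s, x), b). f (x, b)) \<in> borel_measurable ((pos_time \<Otimes>\<^sub>M X) \<Otimes>\<^sub>M A)"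
      by (simp add: case_prod_unfold)
    from measurable_compose[OF measurable_Pair1' measurable_kernel_integral[OF this], of t]
    show ?thesis using t by simp
  qed
  have m2: "(\<lambda>\<omega>. case_option 0 (\<lambda>x. \<integral>\<^sup>+b. f (x, b) \<partial>\<kappa> x t) (state \<omega> t)) \<in> borel_measurable P"
    if f: "f \<in> borel_measurable (X \<Otimes>\<^sub>M A)" for f :: "'x \<times> 'a \<Rightarrow> ennreal"
    using measurable_expect_at[OF kernel_at[OF f], of UNIV t] by simp
  have nonempty: "space (X \<Otimes>\<^sub>M A) \<noteq> {}" if "\<omega> \<in> space P" for \<omega>
  proof -
    have x: "fst \<omega> \<in> space X" using that by (simp add: sample_space_def)
    then show ?thesis
      using D_nonempty[OF x] D_subset[OF x] by (auto simp: space_pair_measure)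
  qed
  have sets_joint: "sets (joint p z) = sets (X \<Otimes>\<^sub>M A)" for p z
    by (simp add: joint_def split: option.split)
  have emeasure_joint: "emeasure (joint p z) S = case_option 0 (\<lambda>x. \<integral>\<^sup>+b. indicator S (x, b) \<partial>p x) z"
    if "S \<in> sets (X \<Otimes>\<^sub>M A)" "\<And>x. z = Some x \<Longrightarrow> x \<in> space X \<and> sets (p x) = sets A" for p z S
    using joint_int[of "indicator S" z p] that by (simp add: sets_joint)
  have kernel: "(\<lambda>\<omega>. joint (p \<omega>) (state \<omega> t)) \<in> measurable P (subprob_algebra (X \<Otimes>\<^sub>M A))"
    if p: "\<And>\<omega> x. \<omega> \<in> space P \<Longrightarrow> state \<omega> t = Some x \<Longrightarrow> x \<in> space X \<and> sets (p \<omega> x) = sets A"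
      and sub: "\<And>\<omega> x. \<omega> \<in> space P \<Longrightarrow> state \<omega> t = Some x \<Longrightarrow> subprob_space (p \<omega> x)"
      and meas: "\<And>f. f \<in> borel_measurable (X \<Otimes>\<^sub>M A) \<Longrightarrow>
        (\<lambda>\<omega>. case_option (0::ennreal) (\<lambda>x. \<integral>\<^sup>+b. f (x, b) \<partial>p \<omega> x) (state \<omega> t)) \<in> borel_measurable P"
    for p
  proof (rule measurable_subprob_algebra)
    fix \<omega> assume \<omega>: "\<omega> \<in> space P"
    have "emeasure (joint (p \<omega>) (state \<omega> t)) (space (X \<Otimes>\<^sub>M A)) \<le> 1"
    proof (cases "state \<omega> t")
      case (Some x)
      have "emeasure (joint (p \<omega>) (state \<omega> t)) (space (X \<Otimes>\<^sub>M A)) =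
          (\<integral>\<^sup>+b. indicator (space (X \<Otimes>\<^sub>M A)) (x, b) \<partial>p \<omega> x)"
        using p[OF \<omega>] by (subst emeasure_joint) (simp_all add: Some)
      also have "\<dots> \<le> (\<integral>\<^sup>+b. 1 \<partial>p \<omega> x)"
        by (intro nn_integral_mono) (simp add: indicator_def)
      finally show ?thesis using subprob_space.emeasure_space_le_1[OF sub[OF \<omega> Some]] by simp
    qed (simp add: joint_def)
    then show "subprob_space (joint (p \<omega>) (state \<omega> t))"
      using nonempty[OF \<omega>] by (intro subprob_spaceI) (simp_all add: sets_eq_imp_space_eq[OF sets_joint])
  next
    fix S assume S: "S \<in> sets (X \<Otimes>\<^sub>M A)"
    show "(\<lambda>\<omega>. emeasure (joint (p \<omega>) (state \<omega> t)) S) \<in> borel_measurable P"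
      by (rule measurable_cong[THEN iffD1, OF _ meas[OF borel_measurable_indicator[OF S]]])
        (use p in \<open>simp add: emeasure_joint[OF S]\<close>)
  qed (rule sets_joint)
  have kernel1: "(\<lambda>\<omega>. joint (\<lambda>x. act \<omega> t) (state \<omega> t)) \<in> measurable P (subprob_algebra (X \<Otimes>\<^sub>M A))"
    using t by (intro kernel act_z subprob_act m1) simp_all
  have kernel2: "(\<lambda>\<omega>. joint (\<lambda>x. \<kappa> x t) (state \<omega> t)) \<in> measurable P (subprob_algebra (X \<Otimes>\<^sub>M A))"
    using t \<kappa>_z by (intro kernel \<kappa>_z prob_space_imp_subprob_space prob_space_kernel_at m2) blast+
  let ?M1 = "P \<bind> (\<lambda>\<omega>. joint (\<lambda>x. act \<omega> t) (state \<omega> t))"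
  let ?M2 = "P \<bind> (\<lambda>\<omega>. joint (\<lambda>x. \<kappa> x t) (state \<omega> t))"
  have int1: "(\<integral>\<^sup>+w. f w \<partial>?M1) = (\<integral>\<^sup>+\<omega>. case_option 0 (\<lambda>x. \<integral>\<^sup>+b. f (x, b) \<partial>act \<omega> t) (state \<omega> t) \<partial>P)"
    if f: "f \<in> borel_measurable (X \<Otimes>\<^sub>M A)" for f :: "'x \<times> 'a \<Rightarrow> ennreal"
    unfolding nn_integral_bind[OF f kernel1]
    by (intro nn_integral_cong joint_int[OF f]) (use act_z in simp)
  have int2: "(\<integral>\<^sup>+w. f w \<partial>?M2) = (\<integral>\<^sup>+\<omega>. case_option 0 (\<lambda>x. \<integral>\<^sup>+b. f (x, b) \<partial>\<kappa> x t) (state \<omega> t) \<partial>P)"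
    if f: "f \<in> borel_measurable (X \<Otimes>\<^sub>M A)" for f :: "'x \<times> 'a \<Rightarrow> ennreal"
    unfolding nn_integral_bind[OF f kernel2]
    by (intro nn_integral_cong joint_int[OF f]) (use \<kappa>_z in simp)
  have sets_M: "sets ?M1 = sets (X \<Otimes>\<^sub>M A)" "sets ?M2 = sets (X \<Otimes>\<^sub>M A)"
    using not_empty by (simp_all add: sets_bind[OF sets_joint])
  have rect: "(\<integral>\<^sup>+b. indicator (Z \<times> B) (x, b) \<partial>p) = indicator Z x * emeasure p B"
    if "B \<in> sets p" for p :: "'a measure" and Z B x
    using that by (simp add: indicator_times nn_integral_cmult)
  have ind: "indicator (Some ` Z) (Some x) = (indicator Z x :: ennreal)" for Z and x :: 'x
    by (auto simp: indicator_def)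
  have "?M1 = ?M2"
  proof (rule measure_eqI_generator_eq[where A="\<lambda>_. space X \<times> space A" and \<Omega>="space X \<times> space A"
        and E="{Z \<times> B |Z B. Z \<in> sets X \<and> B \<in> sets A}"])
    show "Int_stable {Z \<times> B |Z B. Z \<in> sets X \<and> B \<in> sets A}"
      by (rule Int_stable_pair_measure_generator)
    show "{Z \<times> B |Z B. Z \<in> sets X \<and> B \<in> sets A} \<subseteq> Pow (space X \<times> space A)"
      by (rule pair_measure_closed)
    show "sets ?M1 = sigma_sets (space X \<times> space A) {Z \<times> B |Z B. Z \<in> sets X \<and> B \<in> sets A}"
      and "sets ?M2 = sigma_sets (space X \<times> space A) {Z \<times> B |Z B. Z \<in> sets X \<and> B \<in> sets A}"
      unfolding sets_M by (simp_all add: sets_pair_measure)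
    show "emeasure ?M1 (space X \<times> space A) \<noteq> \<infinity>" for i :: nat
    proof -
      have "subprob_space ?M1"
        by (rule subprob_space_bind[OF prob_space_imp_subprob_space[OF prob_space_axioms] kernel1])
      then have "emeasure ?M1 (space X \<times> space A) \<le> 1"
        by (rule subprob_space.subprob_emeasure_le_1)
      then show ?thesis by (auto simp: top_unique)
    qed
  next
    fix S assume "S \<in> {Z \<times> B |Z B. Z \<in> sets X \<and> B \<in> sets A}"
    then obtain Z B where S: "S = Z \<times> B" and Z: "Z \<in> sets X" and B: "B \<in> sets A" by blast
    then have S_sets: "S \<in> sets (X \<Otimes>\<^sub>M A)" by simp
    have "emeasure ?M1 S = (\<integral>\<^sup>+\<omega>. case_option 0 (\<lambda>x. \<integral>\<^sup>+b. indicator S (x, b) \<partial>act \<omega> t) (state \<omega> t) \<partial>P)"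
      using int1[OF borel_measurable_indicator[OF S_sets]] S_sets sets_M by simp
    also have "\<dots> = state_action_marginal P \<pi> t (Some ` Z) (Some ` B)"
      unfolding state_action_marginal_def
    proof (rule nn_integral_cong)
      fix \<omega> assume \<omega>: "\<omega> \<in> space P"
      show "case_option 0 (\<lambda>x. \<integral>\<^sup>+b. indicator S (x, b) \<partial>act \<omega> t) (state \<omega> t) =
          indicator (Some ` Z) (state \<omega> t) * emeasure (\<pi> \<omega> t) (Some ` B)"
      proof (cases "state \<omega> t")
        case (Some x)
        have "B \<in> sets (act \<omega> t)" using B by simp
        moreover have "emeasure (act \<omega> t) B = emeasure (\<pi> \<omega> t) (Some ` B)"
          using \<omega> t B by (intro emeasure_act) simp_all
        ultimately show ?thesis by (simp only: Some option.case S rect ind)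
      qed auto
    qed
    also have "\<dots> = (\<integral>\<^sup>+z\<in>Some ` Z. emeasure (\<kappa> (the z) t) B \<partial>state_marginal X P t)"
      by (rule marginals[OF t Z B])
    also have "\<dots> = (\<integral>\<^sup>+z. case_option 0 (\<lambda>x. \<integral>\<^sup>+b. indicator S (x, b) \<partial>\<kappa> x t) z \<partial>state_marginal X P t)"
    proof (rule nn_integral_cong)
      fix z assume z: "z \<in> space (state_marginal X P t)"
      show "emeasure (\<kappa> (the z) t) B * indicator (Some ` Z) z =
          case_option 0 (\<lambda>x. \<integral>\<^sup>+b. indicator S (x, b) \<partial>\<kappa> x t) z"
      proof (cases z)
        case (Some x)
        then have "x \<in> space X" using z by (auto simp: state_marginal_def)
        then have "B \<in> sets (\<kappa> x t)" using B sets_kernel_at[OF _ t] by simp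
        then show ?thesis by (simp only: Some option.case option.sel S rect ind mult.commute)
      qed auto
    qed
    also have "\<dots> = (\<integral>\<^sup>+\<omega>. case_option 0 (\<lambda>x. \<integral>\<^sup>+b. indicator S (x, b) \<partial>\<kappa> x t) (state \<omega> t) \<partial>P)"
      unfolding state_marginal_def
    proof (rule nn_integral_distr)
      show "(\<lambda>\<omega>. state \<omega> t) \<in> measurable P (adjoin_point X)"
        using measurable_state_at by (simp cong: measurable_cong_sets add: sets_P)
      have "(\<lambda>z. case_option 0 (\<lambda>x. \<integral>\<^sup>+b. indicator S (x, b) \<partial>\<kappa> x t) z) \<in> borel_measurable (adjoin_point X)"
      proof (rule borel_measurable_case_option)
        show "(\<lambda>(w, x). \<integral>\<^sup>+b. indicator S (x, b) \<partial>\<kappa> x t) \<in> borel_measurable (adjoin_point X \<Otimes>\<^sub>M X)"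
          using measurable_compose[OF measurable_snd kernel_at[OF borel_measurable_indicator[OF S_sets]]]
          by (simp add: case_prod_unfold)
      qed (rule measurable_ident_sets[OF refl])
      then show "(\<lambda>z. case_option 0 (\<lambda>x. \<integral>\<^sup>+b. indicator S (x, b) \<partial>\<kappa> x t) z)
          \<in> borel_measurable (distr P (adjoin_point X) (\<lambda>\<omega>. state \<omega> t))"
        by (simp cong: measurable_cong_sets)
    qed
    also have "\<dots> = emeasure ?M2 S"
      using int2[OF borel_measurable_indicator[OF S_sets]] S_sets sets_M by simp
    finally show "emeasure ?M1 S = emeasure ?M2 S" .
  qed auto
  then show "(\<integral>\<^sup>+\<omega>. case_option 0 (\<lambda>x. \<integral>\<^sup>+b. H (x, b) \<partial>act \<omega> t) (state_on UNIV \<omega> t) \<partial>P) =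
      (\<integral>\<^sup>+\<omega>. case_option 0 (\<lambda>x. \<integral>\<^sup>+b. H (x, b) \<partial>\<kappa> x t) (state_on UNIV \<omega> t) \<partial>P)"
    using int1[OF H] int2[OF H] by simp
qed

end

section \<open>Minimality of the Markov marginals\<close>

lemma SUP_min_nat: "(SUP m. min (a::ennreal) (ennreal (real m))) = a"
proof -
  have "(SUP m. inf a (ennreal (real m))) = inf a (SUP m. ennreal (real m))"
    by (rule inf_SUP[symmetric])
  also have "(SUP m. ennreal (real m)) = \<top>"
    using ennreal_SUP_of_nat_eq_top by (simp add: ennreal_of_nat_eq_real_of_nat)
  finally show ?thesis by (simp add: inf_min)
qed

context markov_rates
begin

text \<open>The states whose rates are bounded by \<open>m\<close> at almost all times up to \<open>t\<close>. These sets are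
  measurable, whereas the supremum of the rates over all actions need not be a Borel function of the
  state.\<close>

definition bounded_rate :: "real \<Rightarrow> nat \<Rightarrow> 'x set" where
  "bounded_rate t m = {x \<in> space X. AE v in pos_lborel. v \<le> t \<longrightarrow> rate v x \<le> ennreal (real m)}"

lemma sets_bounded_rate: "bounded_rate t m \<in> sets X"
proof -
  interpret T: sigma_finite_measure pos_lborel by (rule sigma_finite_pos_lborel)
  let ?f = "\<lambda>x v. if v \<le> t \<and> \<not> rate v x \<le> ennreal (real m) then 1 else 0 :: ennreal"
  have "(\<lambda>w. (snd w, fst w)) \<in> measurable (X \<Otimes>\<^sub>M pos_time) (pos_time \<Otimes>\<^sub>M X)"
    by (intro measurable_Pair measurable_snd measurable_fst)
  from measurable_compose[OF this measurable_rate]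
  have [measurable]: "(\<lambda>w. rate (snd w) (fst w)) \<in> borel_measurable (X \<Otimes>\<^sub>M pos_time)" by simp
  have [measurable]: "(\<lambda>w. snd w) \<in> borel_measurable (X \<Otimes>\<^sub>M pos_time)"
    by (rule measurable_compose[OF measurable_snd measurable_pos_time_real])
  have "(\<lambda>w. ?f (fst w) (snd w)) \<in> borel_measurable (X \<Otimes>\<^sub>M pos_time)"
    by measurable
  then have f: "case_prod ?f \<in> borel_measurable (X \<Otimes>\<^sub>M pos_lborel)"
    by (simp add: case_prod_unfold cong: measurable_cong_sets sets_pair_measure_cong
        add: sets_pair_measure_cong[OF refl sets_pos_lborel])
  have [measurable]: "(\<lambda>x. \<integral>\<^sup>+v. ?f x v \<partial>pos_lborel) \<in> borel_measurable X"
    by (rule T.borel_measurable_nn_integral[OF f])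
  have "(\<integral>\<^sup>+v. ?f x v \<partial>pos_lborel) = 0 \<longleftrightarrow> (AE v in pos_lborel. v \<le> t \<longrightarrow> rate v x \<le> ennreal (real m))"
    if x: "x \<in> space X" for x
  proof -
    have "?f x \<in> borel_measurable pos_lborel"
      using measurable_Pair2[OF f x] by simp
    then have "(\<integral>\<^sup>+v. ?f x v \<partial>pos_lborel) = 0 \<longleftrightarrow> (AE v in pos_lborel. ?f x v = 0)"
      by (rule nn_integral_0_iff_AE)
    also have "\<dots> \<longleftrightarrow> (AE v in pos_lborel. v \<le> t \<longrightarrow> rate v x \<le> ennreal (real m))"
      by (intro AE_cong) simp
    finally show ?thesis .
  qed
  then have "bounded_rate t m = {x \<in> space X. (\<integral>\<^sup>+v. ?f x v \<partial>pos_lborel) = 0}"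
    by (auto simp: bounded_rate_def)
  also have "\<dots> \<in> sets X" by measurable
  finally show ?thesis .
qed

lemma bounded_rate_mono:
  assumes "m \<le> n"
  shows "bounded_rate t m \<subseteq> bounded_rate t n"
proof -
  have "ennreal (real m) \<le> ennreal (real n)" using assms by (intro ennreal_leI) simp
  then show ?thesis
    by (auto simp: bounded_rate_def elim!: eventually_mono intro: order_trans)
qed

lemma bounded_rate_exhausts:
  assumes x: "x \<in> space X"
  shows "\<exists>m. x \<in> bounded_rate t m"
proof -
  obtain M where M: "\<And>s. 0 < s \<Longrightarrow> rate s x \<le> ennreal M" using rate_le_constant[OF x] by blast
  obtain m :: nat where m: "M \<le> real m" using real_arch_simple by blast
  have "rate v x \<le> ennreal (real m)" if "0 < v" for v
    using order_trans[OF M[OF that] ennreal_leI[OF m]] .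
  then have "AE v in pos_lborel. v \<le> t \<longrightarrow> rate v x \<le> ennreal (real m)"
    by (intro AE_I2) simp
  then show ?thesis using x by (auto simp: bounded_rate_def)
qed

text \<open>Every measurable function is an increasing limit of functions to which the forward equation
  applies.\<close>

definition trunc :: "('x \<Rightarrow> ennreal) \<Rightarrow> real \<Rightarrow> nat \<Rightarrow> 'x \<Rightarrow> ennreal" where
  "trunc f t m x = min (f x) (ennreal (real m)) * indicator (bounded_rate t m) x"

lemma trunc_measurable: "f \<in> borel_measurable X \<Longrightarrow> trunc f t m \<in> borel_measurable X"
  unfolding trunc_def[abs_def]
  by (intro borel_measurable_times_ennreal borel_measurable_min borel_measurable_const
      borel_measurable_indicator sets_bounded_rate)

lemma trunc_le: "trunc f t m x \<le> ennreal (real m)" "trunc f t m x \<le> f x"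
  by (auto simp: trunc_def split: split_indicator)

lemma trunc_mono:
  assumes "m \<le> n"
  shows "trunc f t m x \<le> trunc f t n x"
proof -
  have "min (f x) (ennreal (real m)) \<le> min (f x) (ennreal (real n))"
    using assms by (intro min.mono ennreal_leI) auto
  then show ?thesis
    using bounded_rate_mono[OF assms, of t] by (auto simp: trunc_def split: split_indicator)
qed

lemma SUP_trunc:
  assumes x: "x \<in> space X"
  shows "(SUP m. trunc f t m x) = f x"
proof (rule antisym)
  show "(SUP m. trunc f t m x) \<le> f x" by (intro SUP_least trunc_le)
  obtain m0 where m0: "x \<in> bounded_rate t m0" using bounded_rate_exhausts[OF x] by blast
  have "min (f x) (ennreal (real m)) \<le> (SUP m. trunc f t m x)" for m
  proof -
    have "x \<in> bounded_rate t (max m m0)" using bounded_rate_mono[of m0 "max m m0" t] m0 by auto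
    moreover have "min (f x) (ennreal (real m)) \<le> min (f x) (ennreal (real (max m m0)))"
      by (intro min.mono ennreal_leI) auto
    ultimately have "min (f x) (ennreal (real m)) \<le> trunc f t (max m m0) x"
      by (simp add: trunc_def)
    also have "\<dots> \<le> (SUP m. trunc f t m x)" by (rule SUP_upper) simp
    finally show ?thesis .
  qed
  then have "(SUP m. min (f x) (ennreal (real m))) \<le> (SUP m. trunc f t m x)"
    by (rule SUP_least)
  then show "f x \<le> (SUP m. trunc f t m x)" by (simp only: SUP_min_nat)
qed

end

context kernel_process
begin

lemma forward_equation_trunc:
  assumes t: "0 < t" and J: "J = insert 0 (Suc ` J')"
    and cond: "conditional_action J" "conditional_action J'" and f: "f \<in> borel_measurable X"
  shows "expect_on J t (trunc f t m) = (\<integral>\<^sup>+x. trunc f t m x * survival t 0 x \<partial>\<gamma>) +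
    (\<integral>\<^sup>+s. expect_on J' s (rate_op (\<lambda>s x y. if s \<le> t then trunc f t m y * survival t s y else 0) s) \<partial>pos_lborel)"
proof (rule forward_equation[OF t J cond trunc_measurable[OF f] trunc_le(1)])
  fix x assume "x \<in> space X" "trunc f t m x \<noteq> 0"
  then show "AE v in pos_lborel. v \<le> t \<longrightarrow> rate v x \<le> ennreal (real m)"
    by (auto simp: trunc_def bounded_rate_def indicator_def split: if_splits)
qed

lemma expect_on_trunc:
  assumes f: "f \<in> borel_measurable X"
  shows "expect_on J t f = (SUP m. expect_on J t (trunc f t m))"
proof -
  have "expect_on J t f = expect_on J t (\<lambda>x. SUP m. trunc f t m x)"
    by (rule expect_on_cong) (simp add: SUP_trunc)
  also have "\<dots> = (SUP m. expect_on J t (trunc f t m))"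
    by (rule expect_on_SUP[OF trunc_measurable[OF f] trunc_mono])
  finally show ?thesis .
qed

lemma expect_on_UNIV_SUP:
  assumes f: "f \<in> borel_measurable X"
  shows "expect_on UNIV t f = (SUP n. expect_on {..<n} t f)"
proof -
  have mono: "case_option 0 f (state_on {..<m} \<omega> t) \<le> case_option 0 f (state_on {..<n} \<omega> t)"
    if "m \<le> n" for m n \<omega>
    using that by (auto simp: state_on_def split: option.split)
  have "case_option 0 f (state \<omega> t) = (SUP n. case_option 0 f (state_on {..<n} \<omega> t))" (is "?l = ?r")
    if \<omega>: "\<omega> \<in> sample_space X" for \<omega>
  proof (rule antisym)
    show "?r \<le> ?l" by (intro SUP_least) (auto simp: state_on_def split: option.split)
    show "?l \<le> ?r"
    proof (cases "state \<omega> t")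
      case (Some x)
      then obtain k where k: "jump_time \<omega> k \<le> ereal t" "ereal t < jump_time \<omega> (Suc k)"
        by (rule state_SomeD[OF \<omega>])
      then have "state_on {..<Suc k} \<omega> t = Some x"
        using Some by (auto simp: state_on_def)
      then have "?l = case_option 0 f (state_on {..<Suc k} \<omega> t)" by (simp add: Some)
      also have "\<dots> \<le> ?r" by (rule SUP_upper) simp
      finally show ?thesis .
    qed simp
  qed
  then have "expect_on UNIV t f = (\<integral>\<^sup>+\<omega>. (SUP n. case_option 0 f (state_on {..<n} \<omega> t)) \<partial>P)"
    unfolding expect_on_def by (intro nn_integral_cong) simp
  also have "\<dots> = (SUP n. expect_on {..<n} t f)"
    unfolding expect_on_def using mono measurable_expect_at[OF f]
    by (intro nn_integral_monotone_convergence_SUP) (simp_all add: incseq_def le_fun_def)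
  finally show ?thesis .
qed

lemma expect_on_add:
  assumes "f \<in> borel_measurable X" "g \<in> borel_measurable X"
  shows "expect_on J t (\<lambda>x. f x + g x) = expect_on J t f + expect_on J t g"
proof -
  have "expect_on J t (\<lambda>x. f x + g x) =
      (\<integral>\<^sup>+\<omega>. case_option 0 f (state_on J \<omega> t) + case_option 0 g (state_on J \<omega> t) \<partial>P)"
    unfolding expect_on_def by (intro nn_integral_cong) (simp split: option.split)
  then show ?thesis
    unfolding expect_on_def using measurable_expect_at[OF assms(1)] measurable_expect_at[OF assms(2)]
    by (simp add: nn_integral_add)
qed

lemma expect_on_const: "expect_on UNIV t (\<lambda>x. c) = c * emeasure (state_marginal X P t) (Some ` space X)"
proof -
  have X: "Some ` space X \<in> sets (adjoin_point X)" by (rule Some_image_in_sets_adjoin) simp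
  have m: "(\<lambda>\<omega>. state \<omega> t) \<in> measurable P (adjoin_point X)"
    using measurable_state_at by (simp cong: measurable_cong_sets add: sets_P)
  have "expect_on UNIV t (\<lambda>x. c) = (\<integral>\<^sup>+\<omega>. c * indicator (Some ` space X) (state \<omega> t) \<partial>P)"
    unfolding expect_on_def
  proof (rule nn_integral_cong)
    fix \<omega> assume "\<omega> \<in> space P"
    then show "case_option 0 (\<lambda>x. c) (state_on UNIV \<omega> t) = c * indicator (Some ` space X) (state \<omega> t)"
      using state_on_SomeD[of \<omega> X UNIV t] by (cases "state \<omega> t") (auto simp: indicator_def)
  qed
  also have "\<dots> = (\<integral>\<^sup>+z. c * indicator (Some ` space X) z \<partial>state_marginal X P t)"
    unfolding state_marginal_def using X by (subst nn_integral_distr[OF m]) auto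
  finally show ?thesis
    using X by (simp add: nn_integral_cmult_indicator state_marginal_def)
qed

end

text \<open>Two processes with the same initial law. Under \<open>P\<^sub>\<phi>\<close>, as under a Markov policy, \<open>\<kappa>\<close> is the
  conditional law of the action given the present state and the number of past jumps; under \<open>P\<^sub>\<pi>\<close> it
  is the conditional law given the present state alone.\<close>

locale markov_comparison =
  phi: kernel_process X A D q \<gamma> \<phi> P\<^sub>\<phi> \<kappa> + pi: kernel_process X A D q \<gamma> \<pi> P\<^sub>\<pi> \<kappa>
  for X :: "'x measure" and A :: "'a measure" and D q \<gamma> \<phi> P\<^sub>\<phi> \<pi> P\<^sub>\<pi> \<kappa> +
  assumes phi_conditional: "\<And>J. phi.conditional_action J"
    and pi_conditional: "pi.conditional_action UNIV"
begin

text \<open>By the forward equation, domination for fewer than \<open>n\<close> jumps at all earlier times carries over to at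
most \<open>n\<close> jumps.\<close>

lemma expect_on_killed_le:
  assumes "0 < t" "f \<in> borel_measurable X"
  shows "phi.expect_on {..<n} t f \<le> pi.expect_on UNIV t f"
  using assms
proof (induction n arbitrary: t f)
  case 0
  then show ?case by (simp add: phi.expect_on_def state_on_def)
next
  case (Suc n)
  note t = Suc.prems(1) and f = Suc.prems(2)
  let ?h = "\<lambda>m s x y. if s \<le> t then phi.trunc f t m y * phi.survival t s y else 0"
  have h_meas: "(\<lambda>((s, x), y). ?h m s x y) \<in> borel_measurable ((pos_time \<Otimes>\<^sub>M X) \<Otimes>\<^sub>M X)" for m
  proof -
    have "(\<lambda>v. (fst (fst v), snd v)) \<in> measurable ((pos_time \<Otimes>\<^sub>M X) \<Otimes>\<^sub>M X) (borel \<Otimes>\<^sub>M X)"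
      by (intro measurable_Pair measurable_snd
          measurable_compose[OF measurable_compose[OF measurable_fst measurable_fst] measurable_pos_time_real])
    from measurable_compose[OF this phi.measurable_survival[of t]]
    have [measurable]: "(\<lambda>v. phi.survival t (fst (fst v)) (snd v)) \<in> borel_measurable ((pos_time \<Otimes>\<^sub>M X) \<Otimes>\<^sub>M X)"
      by (simp only: case_prod_unfold fst_conv snd_conv)
    have [measurable]: "(\<lambda>v. fst (fst v)) \<in> borel_measurable ((pos_time \<Otimes>\<^sub>M X) \<Otimes>\<^sub>M X)"
      by (rule measurable_compose[OF measurable_compose[OF measurable_fst measurable_fst] measurable_pos_time_real])
    have [measurable]: "(\<lambda>v. phi.trunc f t m (snd v)) \<in> borel_measurable ((pos_time \<Otimes>\<^sub>M X) \<Otimes>\<^sub>M X)"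
      by (rule measurable_compose[OF measurable_snd phi.trunc_measurable[OF f]])
    have "(\<lambda>v. if fst (fst v) \<le> t then phi.trunc f t m (snd v) * phi.survival t (fst (fst v)) (snd v) else 0)
        \<in> borel_measurable ((pos_time \<Otimes>\<^sub>M X) \<Otimes>\<^sub>M X)"
      by measurable
    then show ?thesis by (simp add: case_prod_unfold)
  qed
  have step: "phi.expect_on {..<Suc n} t (phi.trunc f t m) \<le> pi.expect_on UNIV t (phi.trunc f t m)" for m
  proof -
    have "phi.expect_on {..<Suc n} t (phi.trunc f t m) = (\<integral>\<^sup>+x. phi.trunc f t m x * phi.survival t 0 x \<partial>\<gamma>) +
        (\<integral>\<^sup>+s. phi.expect_on {..<n} s (phi.rate_op (?h m) s) \<partial>pos_lborel)"
      by (rule phi.forward_equation_trunc[OF t lessThan_Suc_eq_insert_0 phi_conditional phi_conditional f])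
    also have "\<dots> \<le> (\<integral>\<^sup>+x. phi.trunc f t m x * phi.survival t 0 x \<partial>\<gamma>) +
        (\<integral>\<^sup>+s. pi.expect_on UNIV s (phi.rate_op (?h m) s) \<partial>pos_lborel)"
    proof (intro add_left_mono nn_integral_mono)
      fix s assume "s \<in> space pos_lborel"
      then have s: "0 < s" by simp
      have "phi.rate_op (?h m) s \<in> borel_measurable X"
        using measurable_compose[OF measurable_Pair1' phi.measurable_rate_op[OF h_meas], of s] s by simp
      then show "phi.expect_on {..<n} s (phi.rate_op (?h m) s) \<le> pi.expect_on UNIV s (phi.rate_op (?h m) s)"
        by (rule Suc.IH[OF s])
    qed
    also have "\<dots> = pi.expect_on UNIV t (phi.trunc f t m)"
      by (rule pi.forward_equation_trunc[OF t _ pi_conditional pi_conditional f, symmetric])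
        (use UNIV_nat_eq in simp)
    finally show ?thesis .
  qed
  show ?case
    unfolding phi.expect_on_trunc[OF f] pi.expect_on_trunc[OF f] by (intro SUP_mono') (rule step)
qed

lemma expect_on_le:
  assumes "0 < t" "f \<in> borel_measurable X"
  shows "phi.expect_on UNIV t f \<le> pi.expect_on UNIV t f"
  unfolding phi.expect_on_UNIV_SUP[OF assms(2)]
  by (intro SUP_least expect_on_killed_le[OF assms])

text \<open>For \<open>f\<close> bounded by \<open>m\<close>, the expectations of \<open>f\<close> and of \<open>m - f\<close> add up to \<open>m\<close> under \<open>P\<^sub>\<phi>\<close> and to at most
\<open>m\<close> under \<open>P\<^sub>\<pi>\<close>; neither can be strictly smaller under \<open>P\<^sub>\<phi>\<close>.\<close>

lemma expect_on_eq:
  assumes t: "0 < t" and f: "f \<in> borel_measurable X"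
    and no_explosion: "emeasure (state_marginal X P\<^sub>\<phi> t) (Some ` space X) = 1"
  shows "phi.expect_on UNIV t f = pi.expect_on UNIV t f"
proof (rule antisym[OF expect_on_le[OF t f]])
  let ?f = "\<lambda>m x. min (f x) (ennreal (real m))"
  have f_meas: "?f m \<in> borel_measurable X" for m
    by (intro borel_measurable_min f borel_measurable_const)
  have "pi.expect_on UNIV t (?f m) \<le> phi.expect_on UNIV t (?f m)" for m :: nat
  proof -
    let ?c = "ennreal (real m)"
    let ?g = "\<lambda>x. ?c - ?f m x"
    have g_meas: "?g \<in> borel_measurable X"
      by (intro borel_measurable_minus_ennreal borel_measurable_const f_meas)
    have sum: "?f m x + ?g x = ?c" for x
      by (intro add_diff_inverse_ennreal min.cobounded2)
    have "pi.expect_on UNIV t (?f m) + phi.expect_on UNIV t ?g \<le>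
        pi.expect_on UNIV t (?f m) + pi.expect_on UNIV t ?g"
      by (intro add_left_mono expect_on_le t g_meas)
    also have "\<dots> = ?c * emeasure (state_marginal X P\<^sub>\<pi> t) (Some ` space X)"
      unfolding pi.expect_on_add[OF f_meas g_meas, symmetric] sum by (rule pi.expect_on_const)
    also have "\<dots> \<le> ?c * 1"
    proof (rule mult_left_mono)
      have "(\<lambda>\<omega>. state \<omega> t) \<in> measurable P\<^sub>\<pi> (adjoin_point X)"
        using measurable_state_at by (simp cong: measurable_cong_sets add: pi.sets_P)
      then have "prob_space (state_marginal X P\<^sub>\<pi> t)"
        unfolding state_marginal_def by (rule pi.prob_space_distr)
      then show "emeasure (state_marginal X P\<^sub>\<pi> t) (Some ` space X) \<le> 1"
        by (rule prob_space.measure_le_1)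
    qed simp
    also have "\<dots> = phi.expect_on UNIV t (?f m) + phi.expect_on UNIV t ?g"
      unfolding phi.expect_on_add[OF f_meas g_meas, symmetric] sum phi.expect_on_const no_explosion ..
    finally have le: "phi.expect_on UNIV t ?g + pi.expect_on UNIV t (?f m) \<le>
        phi.expect_on UNIV t ?g + phi.expect_on UNIV t (?f m)"
      by (simp only: add.commute)
    have "phi.expect_on UNIV t ?g \<le> phi.expect_on UNIV t (\<lambda>x. ?c)"
      by (intro phi.expect_on_mono) simp
    also have "\<dots> < \<top>" unfolding phi.expect_on_const no_explosion by simp
    finally show ?thesis using le by (auto simp: ennreal_add_left_cancel_le)
  qed
  then have le: "(SUP m. pi.expect_on UNIV t (?f m)) \<le> (SUP m. phi.expect_on UNIV t (?f m))"
    by (intro SUP_mono')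
  have mono: "?f m x \<le> ?f n x" if "m \<le> n" for m n x
    using that by (intro min.mono ennreal_leI) auto
  have "phi.expect_on UNIV t (\<lambda>x. SUP m. ?f m x) = (SUP m. phi.expect_on UNIV t (?f m))"
    by (rule phi.expect_on_SUP[OF f_meas mono])
  moreover have "pi.expect_on UNIV t (\<lambda>x. SUP m. ?f m x) = (SUP m. pi.expect_on UNIV t (?f m))"
    by (rule pi.expect_on_SUP[OF f_meas mono])
  ultimately show "pi.expect_on UNIV t f \<le> phi.expect_on UNIV t f"
    using le by (simp only: SUP_min_nat)
qed

end

section \<open>Costs\<close>

context ctjmdp
begin

lemma measurable_admissible_cost:
  assumes f: "case_prod f \<in> borel_measurable (adjoin_point X \<Otimes>\<^sub>M adjoin_point A)"
  shows "(\<lambda>(x, b). f (Some x) (Some b) * indicator (D x) b :: ennreal) \<in> borel_measurable (X \<Otimes>\<^sub>M A)"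
proof -
  have "(\<lambda>w. (Some (fst w), Some (snd w))) \<in> measurable (X \<Otimes>\<^sub>M A) (adjoin_point X \<Otimes>\<^sub>M adjoin_point A)"
    by (intro measurable_Pair measurable_compose[OF measurable_fst measurable_Some_adjoin]
        measurable_compose[OF measurable_snd measurable_Some_adjoin])
  from measurable_compose[OF this f]
  have "(\<lambda>w. f (Some (fst w)) (Some (snd w))) \<in> borel_measurable (X \<Otimes>\<^sub>M A)" by simp
  from borel_measurable_times_ennreal[OF this D_indicator_measurable[unfolded case_prod_unfold]]
  show ?thesis by (simp add: case_prod_unfold)
qed

end

context markov_rates
begin

text \<open>The average of a cost function over the admissible actions drawn from \<open>\<kappa> x s\<close>.\<close>

definition mean_cost :: "('x option \<Rightarrow> 'a option \<Rightarrow> ennreal) \<Rightarrow> real \<Rightarrow> 'x \<Rightarrow> ennreal" where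
  "mean_cost f s x = (\<integral>\<^sup>+b. f (Some x) (Some b) * indicator (D x) b \<partial>\<kappa> x s)"

lemma measurable_mean_cost:
  assumes f: "case_prod f \<in> borel_measurable (adjoin_point X \<Otimes>\<^sub>M adjoin_point A)"
  shows "(\<lambda>(s, x). mean_cost f s x) \<in> borel_measurable (pos_time \<Otimes>\<^sub>M X)"
  unfolding mean_cost_def
proof (rule measurable_kernel_integral)
  have "(\<lambda>u. (snd (fst u), snd u)) \<in> measurable ((pos_time \<Otimes>\<^sub>M X) \<Otimes>\<^sub>M A) (X \<Otimes>\<^sub>M A)"
    by (intro measurable_Pair measurable_snd measurable_compose[OF measurable_fst measurable_snd])
  from measurable_compose[OF this measurable_admissible_cost[OF f]]
  show "(\<lambda>((s, x), b). f (Some x) (Some b) * indicator (D x) b) \<in> borel_measurable ((pos_time \<Otimes>\<^sub>M X) \<Otimes>\<^sub>M A)"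
    by (simp add: case_prod_unfold)
qed

lemma measurable_mean_cost_at:
  assumes "case_prod f \<in> borel_measurable (adjoin_point X \<Otimes>\<^sub>M adjoin_point A)" "0 < s"
  shows "mean_cost f s \<in> borel_measurable X"
  using measurable_compose[OF measurable_Pair1' measurable_mean_cost[OF assms(1)], of s] assms(2) by simp

text \<open>The total cost as a function of the marginal laws of the states: \<open>E t f\<close> stands for the
  expectation of \<open>f\<close> at the state occupied at time \<open>t\<close>.\<close>

definition marginal_cost ::
    "(nat \<Rightarrow> real) \<Rightarrow> ('x option \<Rightarrow> 'a option \<Rightarrow> ennreal) \<Rightarrow> ('x option \<Rightarrow> 'x option \<Rightarrow> ennreal) \<Rightarrow>
     (nat \<Rightarrow> 'x option \<Rightarrow> 'a option \<Rightarrow> ennreal) \<Rightarrow> (nat \<Rightarrow> 'x option \<Rightarrow> ennreal) \<Rightarrow>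
     real \<Rightarrow> 'x measure \<Rightarrow> (real \<Rightarrow> ('x \<Rightarrow> ennreal) \<Rightarrow> ennreal) \<Rightarrow> ennreal" where
  "marginal_cost u c C G G0 \<alpha> \<gamma> E =
    (\<integral>\<^sup>+s. ennreal (exp (- \<alpha> * s)) * E s (mean_cost c s) \<partial>pos_lborel) +
    (\<integral>\<^sup>+s. E s (rate_op (\<lambda>s x y. ennreal (exp (- \<alpha> * s)) * C (Some x) (Some y)) s) \<partial>pos_lborel) +
    (\<Sum>i. ennreal (exp (- \<alpha> * u i)) *
      (if u i = 0 then \<integral>\<^sup>+x. G0 i (Some x) \<partial>\<gamma> else E (u i) (mean_cost (G i) (u i))))"

lemma measurable_discounted_jump_cost:
  assumes C: "case_prod C \<in> borel_measurable (adjoin_point X \<Otimes>\<^sub>M adjoin_point X)"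
  shows "(\<lambda>((s, x), y). ennreal (exp (- \<alpha> * s)) * C (Some x) (Some y))
    \<in> borel_measurable step_space"
proof -
  let ?N = "step_space"
  have "(\<lambda>v. (Some (snd (fst v)), Some (snd v))) \<in> measurable ?N (adjoin_point X \<Otimes>\<^sub>M adjoin_point X)"
    by (intro measurable_Pair measurable_compose[OF measurable_snd measurable_Some_adjoin]
        measurable_compose[OF measurable_compose[OF measurable_fst measurable_snd] measurable_Some_adjoin])
  from measurable_compose[OF this C]
  have [measurable]: "(\<lambda>v. C (Some (snd (fst v))) (Some (snd v))) \<in> borel_measurable ?N" by simp
  have [measurable]: "(\<lambda>v. fst (fst v)) \<in> borel_measurable ?N"
    by (rule measurable_compose[OF measurable_compose[OF measurable_fst measurable_fst] measurable_pos_time_real])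
  have "(\<lambda>v. ennreal (exp (- \<alpha> * fst (fst v))) * C (Some (snd (fst v))) (Some (snd v))) \<in> borel_measurable ?N"
    by measurable
  then show ?thesis by (simp add: case_prod_unfold)
qed

lemma marginal_cost_mono:
  assumes costs: "cost_functions X A u c C G G0" and u: "\<And>i. 0 \<le> u i"
    and E: "\<And>t f. 0 < t \<Longrightarrow> f \<in> borel_measurable X \<Longrightarrow> E t f \<le> E' t f"
  shows "marginal_cost u c C G G0 \<alpha> \<gamma> E \<le> marginal_cost u c C G G0 \<alpha> \<gamma> E'"
  unfolding marginal_cost_def
proof (intro add_mono)
  note costs = costs[unfolded cost_functions_def Let_def]
  show "(\<integral>\<^sup>+s. ennreal (exp (- \<alpha> * s)) * E s (mean_cost c s) \<partial>pos_lborel)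
      \<le> (\<integral>\<^sup>+s. ennreal (exp (- \<alpha> * s)) * E' s (mean_cost c s) \<partial>pos_lborel)"
    using costs by (intro nn_integral_mono mult_left_mono E measurable_mean_cost_at) simp_all
  have C: "case_prod C \<in> borel_measurable (adjoin_point X \<Otimes>\<^sub>M adjoin_point X)"
    using costs by blast
  show "(\<integral>\<^sup>+s. E s (rate_op (\<lambda>s x y. ennreal (exp (- \<alpha> * s)) * C (Some x) (Some y)) s) \<partial>pos_lborel)
      \<le> (\<integral>\<^sup>+s. E' s (rate_op (\<lambda>s x y. ennreal (exp (- \<alpha> * s)) * C (Some x) (Some y)) s) \<partial>pos_lborel)"
  proof (intro nn_integral_mono E)
    fix s assume "s \<in> space pos_lborel"
    then show "0 < s" by simp
    then show "rate_op (\<lambda>s x y. ennreal (exp (- \<alpha> * s)) * C (Some x) (Some y)) s \<in> borel_measurable X"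
      using measurable_compose[OF measurable_Pair1' measurable_rate_op[OF measurable_discounted_jump_cost[OF C]], of s]
      by simp
  qed
  show "(\<Sum>i. ennreal (exp (- \<alpha> * u i)) *
        (if u i = 0 then \<integral>\<^sup>+x. G0 i (Some x) \<partial>\<gamma> else E (u i) (mean_cost (G i) (u i))))
      \<le> (\<Sum>i. ennreal (exp (- \<alpha> * u i)) *
        (if u i = 0 then \<integral>\<^sup>+x. G0 i (Some x) \<partial>\<gamma> else E' (u i) (mean_cost (G i) (u i))))"
  proof (intro suminf_le summableI mult_left_mono)
    fix i
    show "(if u i = 0 then \<integral>\<^sup>+x. G0 i (Some x) \<partial>\<gamma> else E (u i) (mean_cost (G i) (u i))) \<le>
        (if u i = 0 then \<integral>\<^sup>+x. G0 i (Some x) \<partial>\<gamma> else E' (u i) (mean_cost (G i) (u i)))"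
    proof (cases "u i = 0")
      case False
      then have "0 < u i" using u[of i] by simp
      moreover have "case_prod (G i) \<in> borel_measurable (adjoin_point X \<Otimes>\<^sub>M adjoin_point A)"
        using costs False by blast
      ultimately show ?thesis using E measurable_mean_cost_at by simp
    qed simp
  qed simp
qed

end

context kernel_process
begin

text \<open>After the explosion time only the adjoined action is admissible, and it costs nothing.\<close>

lemma action_average_state:
  assumes f: "case_prod f \<in> borel_measurable (adjoin_point X \<Otimes>\<^sub>M adjoin_point A)" "f None None = 0"
    and \<omega>: "\<omega> \<in> sample_space X" and s: "0 < s"
  shows "action_average D f (state \<omega> s) (\<pi> \<omega> s) =
    case_option 0 (\<lambda>x. \<integral>\<^sup>+b. f (Some x) (Some b) * indicator (D x) b \<partial>act \<omega> s) (state \<omega> s)"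
proof (cases "state \<omega> s")
  case None
  have "f None a * indicator {None} a = 0" for a
    using f(2) by (cases a) simp_all
  then show ?thesis
    unfolding None action_average_def admissible_def option.case by (simp only:) simp
next
  case (Some x)
  then have x: "x \<in> space X" using state_on_SomeD[OF \<omega>, of UNIV s x] by simp
  have "(\<lambda>b. f (Some x) (Some b) * indicator (D x) b) \<in> borel_measurable A"
    using measurable_Pair2[OF measurable_admissible_cost[OF f(1)] x] by simp
  from action_average_Some[where f=f, OF sets_policy[OF \<omega> s] x this] show ?thesis
    by (simp add: Some act_def)
qed

lemma measurable_action_average:
  assumes f: "case_prod f \<in> borel_measurable (adjoin_point X \<Otimes>\<^sub>M adjoin_point A)"
  shows "(\<lambda>w. case_option (0::ennreal)
      (\<lambda>x. \<integral>\<^sup>+b. f (Some x) (Some b) * indicator (D x) b \<partial>act (fst w) (snd w)) (state (fst w) (snd w)))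
    \<in> borel_measurable traj_time"
proof -
  have "(\<lambda>u. (snd (fst u), snd u)) \<in> measurable ((traj_time \<Otimes>\<^sub>M X) \<Otimes>\<^sub>M A) (X \<Otimes>\<^sub>M A)"
    by (intro measurable_Pair measurable_snd measurable_compose[OF measurable_fst measurable_snd])
  from measurable_compose[OF this measurable_admissible_cost[OF f]]
  have "(\<lambda>((w, x), b). f (Some x) (Some b) * indicator (D x) b)
      \<in> borel_measurable ((traj_time \<Otimes>\<^sub>M X) \<Otimes>\<^sub>M A)"
    by (simp add: case_prod_unfold)
  from measurable_action_integral[OF this, of UNIV] show ?thesis by simp
qed

lemma nn_integral_action_average:
  assumes cond: "conditional_action UNIV"
    and f: "case_prod f \<in> borel_measurable (adjoin_point X \<Otimes>\<^sub>M adjoin_point A)" and s: "0 < s"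
  shows "(\<integral>\<^sup>+\<omega>. case_option 0 (\<lambda>x. \<integral>\<^sup>+b. f (Some x) (Some b) * indicator (D x) b \<partial>act \<omega> s) (state \<omega> s) \<partial>P) =
    expect_on UNIV s (mean_cost f s)"
  using cond s measurable_admissible_cost[OF f] unfolding conditional_action_def
  by (auto simp: mean_cost_def[abs_def] dest!: bspec[of _ _ "\<lambda>(x, b). f (Some x) (Some b) * indicator (D x) b"])

lemma total_cost_eq_marginal_cost:
  assumes cond: "conditional_action UNIV"
    and costs: "cost_functions X A u c C G G0" and u: "\<And>i. 0 \<le> u i"
  shows "total_cost D u c C G G0 \<alpha> \<pi> P = marginal_cost u c C G G0 \<alpha> \<gamma> (expect_on UNIV)"
proof -
  let ?e = "\<lambda>s. ennreal (exp (- \<alpha> * s))"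
  note costs = costs[unfolded cost_functions_def Let_def]
  have c: "case_prod c \<in> borel_measurable (adjoin_point X \<Otimes>\<^sub>M adjoin_point A)" "c None None = 0"
    using costs by auto
  have C: "case_prod C \<in> borel_measurable (adjoin_point X \<Otimes>\<^sub>M adjoin_point X)"
    using costs by blast
  have G: "case_prod (G i) \<in> borel_measurable (adjoin_point X \<Otimes>\<^sub>M adjoin_point A)" "G i None None = 0"
    if "u i \<noteq> 0" for i
    using costs that by auto
  have G0: "G0 i \<in> borel_measurable (adjoin_point X)" if "u i = 0" for i
    using costs that by blast
  let ?a = "\<lambda>f \<omega> s. case_option (0::ennreal)
      (\<lambda>x. \<integral>\<^sup>+b. f (Some x) (Some b) * indicator (D x) b \<partial>act \<omega> s) (state \<omega> s)"
  let ?h = "\<lambda>s x y. ?e s * C (Some x) (Some y)"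
  let ?run = "\<lambda>\<omega>. \<integral>\<^sup>+s. ?e s * ?a c \<omega> s \<partial>pos_lborel"
  let ?jump = "\<lambda>\<omega>. jump_sum UNIV ?h \<omega>"
  let ?inst = "\<lambda>i \<omega>. ?e (u i) * (if u i = 0 then G0 i (Some (fst \<omega>)) else ?a (G i) \<omega> (u i))"
  have e_meas: "(\<lambda>w. ?e (snd w)) \<in> borel_measurable traj_time"
  proof -
    have [measurable]: "(\<lambda>w. snd w) \<in> borel_measurable traj_time"
      by (rule measurable_compose[OF measurable_snd measurable_pos_time_real])
    show ?thesis by measurable
  qed
  have run_meas: "(\<lambda>w. ?e (snd w) * ?a c (fst w) (snd w)) \<in> borel_measurable traj_time"
    by (rule borel_measurable_times_ennreal[OF e_meas measurable_action_average[OF c(1)]])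
  have run_P: "?run \<in> borel_measurable P"
  proof -
    interpret T: sigma_finite_measure pos_lborel by (rule sigma_finite_pos_lborel)
    show ?thesis
      using borel_measurable_P_pos[OF run_meas]
      by (intro T.borel_measurable_nn_integral) (simp add: case_prod_unfold)
  qed
  have fst_meas: "fst \<in> measurable P X"
    unfolding measurable_cong_sets[OF sets_P refl] trajectories_def
    by (rule measurable_restrict_space1) simp
  have act_P: "(\<lambda>\<omega>. ?a f \<omega> s) \<in> borel_measurable P"
    if "case_prod f \<in> borel_measurable (adjoin_point X \<Otimes>\<^sub>M adjoin_point A)" "0 < s" for f s
    using measurable_compose[OF measurable_Pair_traj[OF that(2)] measurable_action_average[OF that(1)]]
    by (intro borel_measurable_P) (simp cong: option.case_cong)
  have G0_X: "(\<lambda>x. G0 i (Some x)) \<in> borel_measurable X" if "u i = 0" for i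
    by (rule measurable_compose[OF measurable_Some_adjoin G0[OF that]])
  have u_pos: "0 < u i" if "u i \<noteq> 0" for i using u[of i] that by simp
  have inst_P: "?inst i \<in> borel_measurable P" for i
  proof (cases "u i = 0")
    case True
    then show ?thesis
      using measurable_compose[OF fst_meas G0_X[OF True]]
      by (simp add: True)
  next
    case False
    then show ?thesis
      using act_P[OF G(1)[OF False] u_pos[OF False]]
      by (simp add: borel_measurable_times_ennreal)
  qed
  have jump_term: "(if jump_time \<omega> (Suc n) < \<infinity>
                then ?e (real_of_ereal (jump_time \<omega> (Suc n))) * C (jump_state \<omega> n) (jump_state \<omega> (Suc n))
                else 0) =
        (if n \<in> UNIV \<and> jump_time \<omega> (Suc n) < \<infinity>
        then ?h (real_of_ereal (jump_time \<omega> (Suc n))) (the (jump_state \<omega> n)) (the (jump_state \<omega> (Suc n))) else 0)"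
    if \<omega>: "\<omega> \<in> sample_space X" for \<omega> n
  proof -
    have "jump_time \<omega> n < \<infinity>" if "jump_time \<omega> (Suc n) < \<infinity>"
      using jump_time_mono[OF \<omega>, of n "Suc n"] that by (auto intro: le_less_trans)
    then have "\<exists>x y. jump_state \<omega> n = Some x \<and> jump_state \<omega> (Suc n) = Some y" if "jump_time \<omega> (Suc n) < \<infinity>"
      using jump_state_finite[OF \<omega>, of n] jump_state_finite[OF \<omega>, of "Suc n"] that by blast
    then show ?thesis by (cases "jump_time \<omega> (Suc n) < \<infinity>") auto
  qed
  have pointwise: "(\<integral>\<^sup>+s\<in>{s. 0 < s \<and> ereal s < explosion_time \<omega>}.
            (?e s * action_average D c (state \<omega> s) (\<pi> \<omega> s)) \<partial>lborel)
         + (\<Sum>n. if jump_time \<omega> (Suc n) < \<infinity>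
                then ?e (real_of_ereal (jump_time \<omega> (Suc n))) * C (jump_state \<omega> n) (jump_state \<omega> (Suc n))
                else 0)
         + (\<Sum>i. ?e (u i) * (if u i = 0 then G0 i (state \<omega> 0)
                 else action_average D (G i) (state \<omega> (u i)) (\<pi> \<omega> (u i))))
      = ?run \<omega> + ?jump \<omega> + (\<Sum>i. ?inst i \<omega>)" if \<omega>: "\<omega> \<in> sample_space X" for \<omega>
  proof (intro arg_cong2[where f="(+)"] suminf_cong)
    show "(\<integral>\<^sup>+s\<in>{s. 0 < s \<and> ereal s < explosion_time \<omega>}.
            (?e s * action_average D c (state \<omega> s) (\<pi> \<omega> s)) \<partial>lborel) = ?run \<omega>"
      unfolding nn_integral_pos_lborel
    proof (rule nn_integral_cong)
      fix s :: real
      show "?e s * action_average D c (state \<omega> s) (\<pi> \<omega> s) * indicator {s. 0 < s \<and> ereal s < explosion_time \<omega>} s =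
          ?e s * ?a c \<omega> s * indicator {0<..} s"
      proof (cases "0 < s")
        case True
        then show ?thesis
          using action_average_state[OF c \<omega> True] state_Some_less_explosion[OF \<omega>, of s]
          by (cases "state \<omega> s") (simp_all split: split_indicator)
      qed simp
    qed
  next
    fix n
    show "(if jump_time \<omega> (Suc n) < \<infinity>
                then ?e (real_of_ereal (jump_time \<omega> (Suc n))) * C (jump_state \<omega> n) (jump_state \<omega> (Suc n))
                else 0) =
        (if n \<in> UNIV \<and> jump_time \<omega> (Suc n) < \<infinity>
        then ?h (real_of_ereal (jump_time \<omega> (Suc n))) (the (jump_state \<omega> n)) (the (jump_state \<omega> (Suc n))) else 0)"
      by (rule jump_term[OF \<omega>])
  next
    fix i
    show "?e (u i) * (if u i = 0 then G0 i (state \<omega> 0)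
                 else action_average D (G i) (state \<omega> (u i)) (\<pi> \<omega> (u i))) = ?inst i \<omega>"
    proof (cases "u i = 0")
      case False
      then show ?thesis using action_average_state[OF G[OF False] \<omega> u_pos[OF False]] by simp
    qed (simp add: state_initial[OF \<omega>])
  qed
  have jump_P: "?jump \<in> borel_measurable P"
  proof (intro borel_measurable_P)
    have pair: "(\<lambda>\<omega>. (jump_state \<omega> n, jump_state \<omega> (Suc n)))
        \<in> measurable (trajectories X) (adjoin_point X \<Otimes>\<^sub>M adjoin_point X)" for n
      by (intro measurable_Pair measurable_jump_state)
    have [measurable]: "(\<lambda>\<omega>. C (jump_state \<omega> n) (jump_state \<omega> (Suc n))) \<in> borel_measurable (trajectories X)" for n
      using measurable_compose[OF pair C] by simp
    have "(\<lambda>\<omega>. \<Sum>n. if jump_time \<omega> (Suc n) < \<infinity>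
                then ?e (real_of_ereal (jump_time \<omega> (Suc n))) * C (jump_state \<omega> n) (jump_state \<omega> (Suc n))
                else 0) \<in> borel_measurable (trajectories X)"
      by measurable
    then show "?jump \<in> borel_measurable (trajectories X)"
    proof (rule measurable_cong[THEN iffD1, rotated], intro suminf_cong)
      fix \<omega> n assume "\<omega> \<in> space (trajectories X)"
      then have \<omega>: "\<omega> \<in> sample_space X" by simp
      show "(if jump_time \<omega> (Suc n) < \<infinity>
                then ?e (real_of_ereal (jump_time \<omega> (Suc n))) * C (jump_state \<omega> n) (jump_state \<omega> (Suc n))
                else 0) =
        (if n \<in> UNIV \<and> jump_time \<omega> (Suc n) < \<infinity>
        then ?h (real_of_ereal (jump_time \<omega> (Suc n))) (the (jump_state \<omega> n)) (the (jump_state \<omega> (Suc n))) else 0)"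
        by (rule jump_term[OF \<omega>])
    qed
  qed
  have sum_P: "(\<lambda>\<omega>. \<Sum>i. ?inst i \<omega>) \<in> borel_measurable P"
    by (rule borel_measurable_suminf_order[OF inst_P])
  have "total_cost D u c C G G0 \<alpha> \<pi> P = (\<integral>\<^sup>+\<omega>. ?run \<omega> + ?jump \<omega> + (\<Sum>i. ?inst i \<omega>) \<partial>P)"
    unfolding total_cost_def by (rule nn_integral_cong) (rule pointwise, simp)
  also have "\<dots> = (\<integral>\<^sup>+\<omega>. ?run \<omega> \<partial>P) + (\<integral>\<^sup>+\<omega>. ?jump \<omega> \<partial>P) + (\<integral>\<^sup>+\<omega>. (\<Sum>i. ?inst i \<omega>) \<partial>P)"
    by (simp only: nn_integral_add run_P jump_P sum_P borel_measurable_add)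
  also have "(\<integral>\<^sup>+\<omega>. ?run \<omega> \<partial>P) = (\<integral>\<^sup>+s. ?e s * expect_on UNIV s (mean_cost c s) \<partial>pos_lborel)"
    unfolding nn_integral_time_swap[OF run_meas]
  proof (rule nn_integral_cong)
    fix s assume "s \<in> space pos_lborel"
    then have s: "0 < s" by simp
    show "(\<integral>\<^sup>+\<omega>. ?e s * ?a c \<omega> s \<partial>P) = ?e s * expect_on UNIV s (mean_cost c s)"
      unfolding nn_integral_action_average[OF cond c(1) s, symmetric]
      by (rule nn_integral_cmult[OF act_P[OF c(1) s]])
  qed
  also have "(\<integral>\<^sup>+\<omega>. ?jump \<omega> \<partial>P) = (\<integral>\<^sup>+s. expect_on UNIV s (rate_op ?h s) \<partial>pos_lborel)"
    by (rule jump_formula[OF measurable_discounted_jump_cost[OF C] cond])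
  also have "(\<integral>\<^sup>+\<omega>. (\<Sum>i. ?inst i \<omega>) \<partial>P) = (\<Sum>i. \<integral>\<^sup>+\<omega>. ?inst i \<omega> \<partial>P)"
    by (rule nn_integral_suminf[OF inst_P])
  also have "\<dots> = (\<Sum>i. ?e (u i) * (if u i = 0 then \<integral>\<^sup>+x. G0 i (Some x) \<partial>\<gamma>
      else expect_on UNIV (u i) (mean_cost (G i) (u i))))"
  proof (rule suminf_cong)
    fix i
    show "(\<integral>\<^sup>+\<omega>. ?inst i \<omega> \<partial>P) = ?e (u i) * (if u i = 0 then \<integral>\<^sup>+x. G0 i (Some x) \<partial>\<gamma>
      else expect_on UNIV (u i) (mean_cost (G i) (u i)))"
    proof (cases "u i = 0")
      case True
      have "(\<integral>\<^sup>+\<omega>. G0 i (Some (fst \<omega>)) \<partial>P) = (\<integral>\<^sup>+x. G0 i (Some x) \<partial>\<gamma>)"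
        unfolding initial_law[symmetric]
        by (rule nn_integral_distr[OF fst_meas, symmetric]) (use G0_X[OF True] in simp)
      then show ?thesis by (simp add: True)
    next
      case False
      have "(\<integral>\<^sup>+\<omega>. ?e (u i) * ?a (G i) \<omega> (u i) \<partial>P) = ?e (u i) * (\<integral>\<^sup>+\<omega>. ?a (G i) \<omega> (u i) \<partial>P)"
        by (rule nn_integral_cmult[OF act_P[OF G(1)[OF False] u_pos[OF False]]])
      then show ?thesis
        using nn_integral_action_average[OF cond G(1)[OF False] u_pos[OF False]] False by simp
    qed
  qed
  finally show ?thesis unfolding marginal_cost_def .
qed

end

section \<open>Comparison of the total costs\<close>

theorem theorem5:
  fixes X :: "'x measure" and A :: "'a measure"
    and D :: "'x \<Rightarrow> 'a set" and q :: "'x \<Rightarrow> 'a \<Rightarrow> 'x set \<Rightarrow> real"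
    and u :: "nat \<Rightarrow> real"
    and c :: "'x option \<Rightarrow> 'a option \<Rightarrow> ennreal"
    and C :: "'x option \<Rightarrow> 'x option \<Rightarrow> ennreal"
    and G :: "nat \<Rightarrow> 'x option \<Rightarrow> 'a option \<Rightarrow> ennreal"
    and G0 :: "nat \<Rightarrow> 'x option \<Rightarrow> ennreal"
    and \<gamma> :: "'x measure"
    and \<pi> \<phi> :: "'x traj \<Rightarrow> real \<Rightarrow> 'a option measure"
    and \<kappa> :: "'x \<Rightarrow> real \<Rightarrow> 'a measure"
    and P\<^sub>\<pi> P\<^sub>\<phi> :: "'x traj measure"
  assumes model: "ctjmdp X A D q"
    and rate_bounded: "\<And>x. x \<in> space X \<Longrightarrow> max_jump_rate X D q x < \<infinity>"
    and epochs: "\<And>i. 0 \<le> u i"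
    and costs: "cost_functions X A u c C G G0"
    and initial: "\<gamma> \<in> space (prob_algebra X)"
    and policy_pi: "policy X A D \<pi>"
    and policy_phi: "markov_policy X A D \<phi> \<kappa>"
    and law_pi: "controlled_law X D q \<gamma> \<pi> P\<^sub>\<pi>"
    and law_phi: "controlled_law X D q \<gamma> \<phi> P\<^sub>\<phi>"
    and marginals: "\<And>t Z B. 0 < t \<Longrightarrow> Z \<in> sets X \<Longrightarrow> B \<in> sets A \<Longrightarrow>
      state_action_marginal P\<^sub>\<pi> \<pi> t (Some ` Z) (Some ` B) =
      (\<integral>\<^sup>+z\<in>Some ` Z. emeasure (\<kappa> (the z) t) B \<partial>state_marginal X P\<^sub>\<pi> t)"
  shows "(\<forall>\<alpha>\<ge>0. total_cost D u c C G G0 \<alpha> \<phi> P\<^sub>\<phi> \<le> total_cost D u c C G G0 \<alpha> \<pi> P\<^sub>\<pi>) \<and>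
    ((\<forall>t>0. emeasure (state_marginal X P\<^sub>\<phi> t) (Some ` space X) = 1) \<longrightarrow>
     (\<forall>\<alpha>\<ge>0. total_cost D u c C G G0 \<alpha> \<phi> P\<^sub>\<phi> = total_cost D u c C G G0 \<alpha> \<pi> P\<^sub>\<pi>))"
proof -
  interpret ctjmdp X A D q by (rule model)
  interpret markov_rates X A D q \<kappa>
    using policy_phi rate_bounded by unfold_locales (auto simp: markov_policy_def)
  interpret phi: kernel_process X A D q \<gamma> \<phi> P\<^sub>\<phi> \<kappa>
    using policy_phi law_phi by unfold_locales (auto simp: markov_policy_def)
  interpret pi: kernel_process X A D q \<gamma> \<pi> P\<^sub>\<pi> \<kappa>
    using policy_pi law_pi by unfold_locales
  interpret markov_comparison X A D q \<gamma> \<phi> P\<^sub>\<phi> \<pi> P\<^sub>\<pi> \<kappa>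
    using phi.conditional_action_markov[OF policy_phi] pi.conditional_action_from_marginals[OF marginals]
    by unfold_locales
  note phi_cost = phi.total_cost_eq_marginal_cost[OF phi_conditional costs epochs]
  note pi_cost = pi.total_cost_eq_marginal_cost[OF pi_conditional costs epochs]
  show ?thesis
    unfolding phi_cost pi_cost
  proof (intro conjI impI allI)
    fix \<alpha> :: real
    show "marginal_cost u c C G G0 \<alpha> \<gamma> (phi.expect_on UNIV) \<le> marginal_cost u c C G G0 \<alpha> \<gamma> (pi.expect_on UNIV)"
      by (rule marginal_cost_mono[OF costs epochs expect_on_le])
  next
    fix \<alpha> :: real
    assume "\<forall>t>0. emeasure (state_marginal X P\<^sub>\<phi> t) (Some ` space X) = 1"
    then have eq: "phi.expect_on UNIV t f = pi.expect_on UNIV t f" if "0 < t" "f \<in> borel_measurable X" for t f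
      using expect_on_eq[OF that] that by blast
    show "marginal_cost u c C G G0 \<alpha> \<gamma> (phi.expect_on UNIV) = marginal_cost u c C G G0 \<alpha> \<gamma> (pi.expect_on UNIV)"
      by (rule antisym; rule marginal_cost_mono[OF costs epochs]; simp add: eq)
  qed
qed

end
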